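(* Let $0<\sigma<4/N$, $\mu>0$, and let $u$ be a solution to the minimization problem $\widetilde I_{1,\beta}(\mu)=\inf_{w\in M_\mu}\widetilde E_{1,\beta}(w)$ (i.e. $u\in M_\mu$ and $\widetilde E_{1,\beta}(u)=\widetilde I_{1,\beta}(\mu)$), with Lagrange multiplier $\alpha(\mu)$. Suppose that $\beta\ge 2\sqrt{\alpha(\mu)}$. Then $u$ is strictly positive (or strictly negative).
   Context: $M_\mu=\{u\in H^2(\mathbb{R}^N):\int_{\mathbb{R}^N}|u|^2\,dx=\mu\}$ (real-valued functions), $u^+=\max\{u,0\}$, and $$\widetilde E_{1,\beta}(u)=\frac12\int_{\mathbb{R}^N}|\Delta u|^2\,dx+\frac{\beta}{2}\int_{\mathbb{R}^N}|\nabla u|^2\,dx-\frac{1}{2\sigma+2}\int_{\mathbb{R}^N}|u^+|^{2\sigma+2}\,dx .$$ A minimizer $u$ solves $\Delta^2u-\beta\Delta u+\alpha(\mu)u=|u^+|^{2\sigma}u^+$ in $\mathbb{R}^N$, where the Lagrange multiplier $\alpha(\mu)\ge0$ is given by $$-\alpha(\mu)\mu=\int_{\mathbb{R}^N}\left(|\Delta u|^2+\beta|\nabla u|^2-|u^+|^{2\sigma+2}\right)dx .$$ *)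

theory Defs
  imports "HOL-Analysis.Analysis"
begin

text \<open>Elements of Lebesgue and Sobolev spaces are represented by functions; all notions below
  depend only on the class modulo equality almost everywhere.\<close>

definition partial :: "'a::euclidean_space \<Rightarrow> ('a \<Rightarrow> real) \<Rightarrow> 'a \<Rightarrow> real" where
  "partial i f = (\<lambda>x. frechet_derivative f (at x) i)"

primrec Ck :: "nat \<Rightarrow> ('a::euclidean_space \<Rightarrow> real) \<Rightarrow> bool" where
  "Ck 0 f \<longleftrightarrow> continuous_on UNIV f"
| "Ck (Suc k) f \<longleftrightarrow> (\<forall>x. f differentiable (at x)) \<and> (\<forall>i\<in>Basis. Ck k (partial i f))"

definition test_function :: "('a::euclidean_space \<Rightarrow> real) \<Rightarrow> bool" where
  "test_function \<phi> \<longleftrightarrow> (\<forall>k. Ck k \<phi>) \<and> compact (closure {x. \<phi> x \<noteq> 0})"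

definition locally_integrable :: "('a::euclidean_space \<Rightarrow> real) \<Rightarrow> bool" where
  "locally_integrable u \<longleftrightarrow> (\<forall>K. compact K \<longrightarrow> set_integrable lebesgue K u)"

text \<open>A multi-index of order \<open>k\<close> is encoded as a list of \<open>k\<close> basis vectors; the order of
  the entries is irrelevant, since partial derivatives of test functions commute.\<close>

definition weak_derivative ::
    "'a::euclidean_space list \<Rightarrow> ('a \<Rightarrow> real) \<Rightarrow> ('a \<Rightarrow> real) \<Rightarrow> bool" where
  "weak_derivative is u v \<longleftrightarrow> locally_integrable u \<and> locally_integrable v \<and>
     (\<forall>\<phi>. test_function \<phi> \<longrightarrow>
        (\<integral>x. u x * foldr partial is \<phi> x \<partial>lebesgue) =
        (-1) ^ length is * (\<integral>x. v x * \<phi> x \<partial>lebesgue))"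

text \<open>Some representative of the weak derivative, which is unique almost everywhere; it is
  meaningful only if a weak derivative exists.\<close>

definition wderiv :: "'a::euclidean_space list \<Rightarrow> ('a \<Rightarrow> real) \<Rightarrow> 'a \<Rightarrow> real" where
  "wderiv is u = (SOME v. weak_derivative is u v)"

definition weak_gradient :: "('a::euclidean_space \<Rightarrow> real) \<Rightarrow> 'a \<Rightarrow> 'a" where
  "weak_gradient u x = (\<Sum>i\<in>Basis. wderiv [i] u x *\<^sub>R i)"

definition weak_laplacian :: "('a::euclidean_space \<Rightarrow> real) \<Rightarrow> 'a \<Rightarrow> real" where
  "weak_laplacian u x = (\<Sum>i\<in>Basis. wderiv [i, i] u x)"

definition L2 :: "('a::euclidean_space \<Rightarrow> real) set" where
  "L2 = {u \<in> borel_measurable lebesgue. integrable lebesgue (\<lambda>x. \<bar>u x\<bar>\<^sup>2)}"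

definition sobolev_H :: "nat \<Rightarrow> ('a::euclidean_space \<Rightarrow> real) set" where
  "sobolev_H k = {u \<in> L2. \<forall>is. set is \<subseteq> Basis \<and> length is \<le> k \<longrightarrow>
     (\<exists>v\<in>L2. weak_derivative is u v)}"

definition mass_constraint :: "real \<Rightarrow> ('a::euclidean_space \<Rightarrow> real) set" where
  "mass_constraint \<mu> = {u \<in> sobolev_H 2. (\<integral>x. \<bar>u x\<bar>\<^sup>2 \<partial>lebesgue) = \<mu>}"

text \<open>For \<open>0 < \<sigma> < 4 / N\<close> all three integrands are integrable when \<open>u\<close> lies in
  \<open>H\<^sup>2\<close> (the last one by the Sobolev embedding), so the convention that the integral of a
  non-integrable function is \<open>0\<close> plays no role.\<close>

definition energy :: "real \<Rightarrow> real \<Rightarrow> ('a::euclidean_space \<Rightarrow> real) \<Rightarrow> real" where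
  "energy \<sigma> \<beta> u =
     1 / 2 * (\<integral>x. \<bar>weak_laplacian u x\<bar>\<^sup>2 \<partial>lebesgue)
     + \<beta> / 2 * (\<integral>x. (norm (weak_gradient u x))\<^sup>2 \<partial>lebesgue)
     - 1 / (2 * \<sigma> + 2) * (\<integral>x. \<bar>max (u x) 0\<bar> powr (2 * \<sigma> + 2) \<partial>lebesgue)"

text \<open>The infimum is taken in the extended reals, so that no boundedness from below is
  presupposed. The space is only visible in the type, hence the type argument.\<close>

definition min_energy :: "'a::euclidean_space itself \<Rightarrow> real \<Rightarrow> real \<Rightarrow> real \<Rightarrow> ereal" where
  "min_energy _ \<sigma> \<beta> \<mu> =
     (INF w \<in> (mass_constraint \<mu> :: ('a \<Rightarrow> real) set). ereal (energy \<sigma> \<beta> w))"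

text \<open>Strict positivity of a class of functions: almost everywhere for each representative, and at
  every single point for the continuous representative. Almost everywhere positivity alone would
  not exclude zeros of the continuous representative.\<close>

definition strictly_positive :: "('a::euclidean_space \<Rightarrow> real) \<Rightarrow> bool" where
  "strictly_positive u \<longleftrightarrow> (AE x in lebesgue. 0 < u x) \<and>
     (\<forall>v. continuous_on UNIV v \<and> (AE x in lebesgue. v x = u x) \<longrightarrow> (\<forall>x. 0 < v x))"

definition strictly_negative :: "('a::euclidean_space \<Rightarrow> real) \<Rightarrow> bool" where
  "strictly_negative u \<longleftrightarrow> strictly_positive (\<lambda>x. - u x)"

end

theory Submission
  imports Defs
begin

text \<open>Write \<open>\<beta> = a + b\<close> and \<open>\<alpha> = a b\<close> with \<open>a, b \<ge> 0\<close>, which is possible precisely because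
  \<open>\<beta> \<ge> 2 \<surd>\<alpha>\<close>. The Euler-Lagrange equation then factorizes as
  \<open>(-\<Delta> + a)(-\<Delta> + b) u = (u\<^sup>+)\<^bsup>2\<sigma>+1\<^esup> \<ge> 0\<close>. Hence \<open>v = -\<Delta>u + b u\<close> is a distributional
  supersolution of \<open>-\<Delta> + a\<close>, the weak maximum principle in \<open>L\<^sup>2\<close> gives \<open>v \<ge> 0\<close>, so \<open>u\<close> is a
  supersolution of \<open>-\<Delta> + b\<close>; the maximum principle gives \<open>u \<ge> 0\<close>, and a mean value inequality
  bounds a nonzero nonnegative supersolution away from zero on every ball. Spreading out a bump
  shows that the infimum is at most zero, whence \<open>\<alpha> \<ge> 0\<close>; if \<open>\<alpha> = 0\<close>, then \<open>\<Delta>u = 0\<close> and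
  \<open>u = 0\<close>. The same alternative covers a nonintegrable nonlinear term, so that no Sobolev embedding
  is needed.\<close>

section \<open>Smooth functions\<close>

text \<open>A fourth-order operator has no maximum principle of its own; this is what forces the
  detour through real second-order factors. The functions involved are mere \<open>L2\<close>
  classes without pointwise meaning, so comparison is carried out on smooth averages and returned to
  the class through test functions. Positivity almost everywhere would leave room for zeros of a
  continuous representative; only a lower bound uniform on each ball excludes them. That bound rests
  on radial test functions \<open>B(c - c |x - z|^2 / A)\<close>: up to the factor
  \<open>4 c\<close>, their Laplacian contains exactly the derivative in \<open>A\<close> of the
  bump with profile \<open>b = B'\<close>. The supersolution inequality thus becomes a differential
  inequality in the squared radius \<open>A\<close>, and letting \<open>c\<close> tend to infinity
  turns the bumps into indicators of balls. Neither the sign of \<alpha> nor that of \<beta> is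
  given, so the bound on the infimum has to hold for \<beta> of either sign. Since the nonlinear
  term is nonnegative, it is always the positive alternative that is reached.\<close>

lemma partial_eqI:
  assumes "(f has_derivative D) (at x)"
  shows "partial i f x = D i"
  using frechet_derivative_at[OF assms] by (simp add: partial_def)

lemma has_derivative_partial:
  assumes "f differentiable (at x)"
  shows "(f has_derivative (\<lambda>h. partial h f x)) (at x)"
proof -
  have "(\<lambda>h. partial h f x) = frechet_derivative f (at x)"
    by (auto simp: partial_def)
  then show ?thesis
    using assms frechet_derivative_works by metis
qed

text \<open>\<open>Ck (Suc k)\<close> asks for differentiability of \<open>f\<close> and regularity
  of its partials but does not mention \<open>Ck k f\<close>; the induction descends to the
  partials, and differentiability gives continuity at the bottom.\<close>

lemma Ck_SucD: "Ck (Suc k) f \<Longrightarrow> Ck k f"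
proof (induction k arbitrary: f)
  case 0
  then show ?case
    by (auto intro!: differentiable_imp_continuous_within simp: continuous_on_eq_continuous_within)
qed auto

lemma partial_const: "partial i (\<lambda>x. c) = (\<lambda>x. 0)"
  by (rule ext, rule partial_eqI[where D = "\<lambda>h. 0"]) auto

lemma partial_add:
  assumes "f differentiable (at x)" "g differentiable (at x)"
  shows "partial i (\<lambda>x. f x + g x) x = partial i f x + partial i g x"
  by (rule partial_eqI[where D = "\<lambda>h. partial h f x + partial h g x"])
    (intro has_derivative_add has_derivative_partial assms)

lemma partial_mult:
  assumes "f differentiable (at x)" "g differentiable (at x)"
  shows "partial i (\<lambda>x. f x * g x) x = partial i f x * g x + f x * partial i g x"
proof -
  have "partial i (\<lambda>x. f x * g x) x = f x * partial i g x + partial i f x * g x"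
    by (rule partial_eqI[where D = "\<lambda>h. f x * partial h g x + partial h f x * g x"])
      (intro has_derivative_mult has_derivative_partial assms)
  then show ?thesis by simp
qed

lemma Ck_const: "Ck k (\<lambda>x. c)"
  by (induction k arbitrary: c) (auto simp: partial_const)

lemma Ck_add: "Ck k f \<Longrightarrow> Ck k g \<Longrightarrow> Ck k (\<lambda>x. f x + g x)"
proof (induction k arbitrary: f g)
  case (Suc k)
  have "partial i (\<lambda>x. f x + g x) = (\<lambda>x. partial i f x + partial i g x)" for i
    using Suc.prems by (auto intro!: partial_add)
  then show ?case using Suc by auto
qed (auto intro: continuous_intros)

lemma Ck_mult: "Ck k f \<Longrightarrow> Ck k g \<Longrightarrow> Ck k (\<lambda>x. f x * g x)"
proof (induction k arbitrary: f g)
  case (Suc k)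
  have *: "partial i (\<lambda>x. f x * g x) = (\<lambda>x. partial i f x * g x + f x * partial i g x)" for i
    using Suc.prems by (auto intro!: partial_mult)
  have "Ck k (\<lambda>x. partial i f x * g x + f x * partial i g x)" if "i \<in> Basis" for i
    using Suc.prems Ck_SucD[of k f] Ck_SucD[of k g] that by (intro Ck_add Suc.IH) auto
  then show ?case using Suc.prems unfolding Ck.simps * by auto
qed (auto intro: continuous_intros)

lemma Ck_inner: "Ck k (\<lambda>x. x \<bullet> i)"
proof -
  have "partial j (\<lambda>x. x \<bullet> i) = (\<lambda>x. j \<bullet> i)" for j :: 'a
    by (rule ext, rule partial_eqI[where D = "\<lambda>h. h \<bullet> i"]) (auto intro!: derivative_eq_intros)
  then show ?thesis
    by (cases k) (auto intro: continuous_intros Ck_const)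
qed

definition smooth :: "('a::euclidean_space \<Rightarrow> real) \<Rightarrow> bool" where
  "smooth f \<longleftrightarrow> (\<forall>k. Ck k f)"

lemma smooth_differentiable: "smooth f \<Longrightarrow> f differentiable (at x)"
  unfolding smooth_def by (meson Ck.simps(2))

lemma smooth_continuous: "smooth f \<Longrightarrow> continuous_on S f"
  unfolding smooth_def by (metis Ck.simps(1) continuous_on_subset top_greatest)

lemma smooth_partial: "smooth f \<Longrightarrow> i \<in> Basis \<Longrightarrow> smooth (partial i f)"
  unfolding smooth_def by (meson Ck.simps(2))

lemma smooth_const [simp]: "smooth (\<lambda>x. c)"
  and smooth_inner: "smooth (\<lambda>x. x \<bullet> i)"
  and smooth_add: "smooth f \<Longrightarrow> smooth g \<Longrightarrow> smooth (\<lambda>x. f x + g x)"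
  and smooth_mult: "smooth f \<Longrightarrow> smooth g \<Longrightarrow> smooth (\<lambda>x. f x * g x)"
  by (auto simp: smooth_def Ck_const Ck_inner Ck_add Ck_mult)

lemma smooth_cmult: "smooth f \<Longrightarrow> smooth (\<lambda>x. c * f x)"
  by (intro smooth_mult smooth_const)

lemma smooth_sum: "(\<And>i. i \<in> I \<Longrightarrow> smooth (f i)) \<Longrightarrow> smooth (\<lambda>x. \<Sum>i\<in>I. f i x)"
  by (induction I rule: infinite_finite_induct) (auto intro: smooth_add)

lemma partial_translate: "partial i (\<lambda>x. f (x - z)) = (\<lambda>x. partial i f (x - z))" if "smooth f"
proof
  fix x
  have "((\<lambda>x. f (x - z)) has_derivative (\<lambda>h. partial h f (x - z))) (at x)"
    by (rule has_derivative_compose[of "\<lambda>x. x - z" "\<lambda>h. h"])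
      (auto intro!: derivative_eq_intros has_derivative_partial smooth_differentiable that)
  then show "partial i (\<lambda>x. f (x - z)) x = partial i f (x - z)"
    by (rule partial_eqI)
qed

lemma smooth_translate: assumes "smooth f" shows "smooth (\<lambda>x. f (x - z))"
proof -
  \<comment> \<open>The induction runs over all smooth \<open>f\<close> rather than over
    \<open>Ck k f\<close>: partials of smooth functions are smooth again, and
    \<open>partial_translate\<close> applies to them.\<close>
  have "smooth f \<Longrightarrow> Ck k (\<lambda>x. f (x - z))" for k
  proof (induction k arbitrary: f)
    case 0
    then show ?case
      by (auto intro!: continuous_on_compose2[OF smooth_continuous, of f UNIV] continuous_intros)
  next
    case (Suc k)
    have "(\<lambda>x. f (x - z)) differentiable (at x)" for x
      using differentiable_compose[of f "\<lambda>x. x - z" x] smooth_differentiable[OF Suc.prems]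
      by auto
    then show ?case
      using Suc by (auto simp: partial_translate intro: smooth_partial)
  qed
  then show ?thesis
    using assms by (auto simp: smooth_def)
qed

lemma partial_compose_real:
  fixes q :: "'a::euclidean_space \<Rightarrow> real"
  assumes "(h has_real_derivative h' (q x)) (at (q x))" "q differentiable (at x)"
  shows "partial i (\<lambda>x. h (q x)) x = h' (q x) * partial i q x"
proof (rule partial_eqI[where D = "\<lambda>i. h' (q x) * partial i q x"])
  show "((\<lambda>x. h (q x)) has_derivative (\<lambda>i. h' (q x) * partial i q x)) (at x)"
    using has_derivative_compose[OF has_derivative_partial[OF assms(2)], of h "(*) (h' (q x))"]
      assms(1) by (simp add: has_field_derivative_def)
qed

text \<open>The whole sequence of successive derivatives is carried along: the chain rule turns
  entry \<open>j\<close> into entry \<open>Suc j\<close> times a partial of \<open>q\<close>, so the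
  induction on the order has to range over all \<open>j\<close> at once.\<close>

lemma smooth_compose_real:
  assumes D: "\<And>j t. (D j has_real_derivative D (Suc j) t) (at t)" and q: "smooth q"
  shows "smooth (\<lambda>x. D j (q x))"
proof -
  have "Ck k (\<lambda>x. D j (q x))" for k
  proof (induction k arbitrary: j)
    case 0
    have "continuous_on UNIV (D j)"
      by (meson D DERIV_continuous_on has_field_derivative_at_within)
    then show ?case
      by (auto intro: continuous_on_compose2 smooth_continuous q)
  next
    case (Suc k)
    have "(\<lambda>x. D j (q x)) differentiable (at x)" for x
      using has_derivative_compose[OF has_derivative_partial[OF smooth_differentiable[OF q, of x]],
          of "D j" "(*) (D (Suc j) (q x))"] D[of j "q x"]
      by (auto simp: has_field_derivative_def intro: differentiableI)
    moreover have "partial i (\<lambda>x. D j (q x)) = (\<lambda>x. D (Suc j) (q x) * partial i q x)" for i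
      using D q by (auto intro!: partial_compose_real smooth_differentiable)
    ultimately show ?case
      using Suc smooth_partial[OF q] by (auto intro!: Ck_mult simp: smooth_def)
  qed
  then show ?thesis by (auto simp: smooth_def)
qed

text \<open>The squared norm keeps the function smooth at its centre. Composed with a profile that
  vanishes on the negative half-line, it yields a smooth radial bump.\<close>

definition paraboloid :: "real \<Rightarrow> real \<Rightarrow> 'a::euclidean_space \<Rightarrow> 'a \<Rightarrow> real" where
  "paraboloid a b z x = a - b * (norm (x - z))\<^sup>2"

lemma partial_paraboloid: "partial i (paraboloid a b z) x = - 2 * b * ((x - z) \<bullet> i)"
  unfolding paraboloid_def power2_norm_eq_inner
  by (rule partial_eqI[where D = "\<lambda>i. - 2 * b * ((x - z) \<bullet> i)"])
    (auto intro!: derivative_eq_intros simp: algebra_simps inner_commute)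

lemma smooth_paraboloid: "smooth (paraboloid a b z)"
proof -
  have "paraboloid a b z = (\<lambda>x. a + (-b) * (\<Sum>i\<in>Basis. ((x - z) \<bullet> i) * ((x - z) \<bullet> i)))"
  proof
    show "paraboloid a b z x = a + (-b) * (\<Sum>i\<in>Basis. ((x - z) \<bullet> i) * ((x - z) \<bullet> i))" for x
      unfolding paraboloid_def power2_norm_eq_inner using euclidean_inner[of "x - z" "x - z"] by simp
  qed
  then show ?thesis
    by (simp only:) (intro smooth_add smooth_cmult smooth_const smooth_sum smooth_mult
        smooth_translate[of "\<lambda>x. x \<bullet> i" for i] smooth_inner)
qed

definition laplacian :: "('a::euclidean_space \<Rightarrow> real) \<Rightarrow> 'a \<Rightarrow> real" where
  "laplacian f x = (\<Sum>i\<in>Basis. partial i (partial i f) x)"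

text \<open>The chain rule \<open>\<Delta>(D(q)) = D''(q) |\<nabla>q|^2 + D'(q) \<Delta>q\<close>,
  where \<open>|\<nabla>q|^2 = 4 b^2 |x - z|^2\<close> and
  \<open>\<Delta>q = - 2 b N\<close>.\<close>

lemma laplacian_profile:
  fixes z x :: "'a::euclidean_space"
  assumes D: "\<And>j t. (D j has_real_derivative D (Suc j) t) (at t)"
  shows "laplacian (\<lambda>x. D j (paraboloid a b z x)) x =
    4 * b\<^sup>2 * (norm (x - z))\<^sup>2 * D (Suc (Suc j)) (paraboloid a b z x)
    - 2 * b * DIM('a) * D (Suc j) (paraboloid a b z x)"
proof -
  let ?q = "paraboloid a b z :: 'a \<Rightarrow> real"
  have 1: "partial i (\<lambda>x. D j (?q x)) = (\<lambda>x. D (Suc j) (?q x) * (- 2 * b * ((x - z) \<bullet> i)))" for i j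
    by (rule ext, subst partial_compose_real[where h' = "D (Suc j)", OF D])
      (auto simp: partial_paraboloid intro: smooth_differentiable smooth_paraboloid)
  have lin: "partial i (\<lambda>x. - 2 * b * ((x - z) \<bullet> i)) x = - 2 * b" if "i \<in> Basis" for i
    by (rule partial_eqI[where D = "\<lambda>h. - 2 * b * (h \<bullet> i)", THEN trans])
      (use that in \<open>auto intro!: derivative_eq_intros\<close>)
  have "partial i (partial i (\<lambda>x. D j (?q x))) x =
      4 * b\<^sup>2 * ((x - z) \<bullet> i)\<^sup>2 * D (Suc (Suc j)) (?q x) - 2 * b * D (Suc j) (?q x)"
    if "i \<in> Basis" for i
  proof -
    have "partial i (\<lambda>x. D (Suc j) (?q x) * (- 2 * b * ((x - z) \<bullet> i))) x =
       partial i (\<lambda>x. D (Suc j) (?q x)) x * (- 2 * b * ((x - z) \<bullet> i)) + D (Suc j) (?q x) * (- 2 * b)"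
    proof (subst partial_mult)
      show "(\<lambda>x. D (Suc j) (?q x)) differentiable at x"
        by (intro smooth_differentiable smooth_compose_real[of D, OF D] smooth_paraboloid)
      show "(\<lambda>x. - 2 * b * ((x - z) \<bullet> i)) differentiable at x"
        by (intro smooth_differentiable smooth_cmult smooth_translate[of "\<lambda>x. x \<bullet> i"] smooth_inner)
    qed (use lin[OF that] in simp)
    then show ?thesis
      unfolding 1 by (simp add: power2_eq_square algebra_simps)
  qed
  then have "laplacian (\<lambda>x. D j (?q x)) x = (\<Sum>i\<in>Basis.
      4 * b\<^sup>2 * ((x - z) \<bullet> i)\<^sup>2 * D (Suc (Suc j)) (?q x) - 2 * b * D (Suc j) (?q x))"
    by (simp add: laplacian_def)
  also have "\<dots> = 4 * b\<^sup>2 * (\<Sum>i\<in>Basis. ((x - z) \<bullet> i)\<^sup>2) * D (Suc (Suc j)) (?q x)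
      - 2 * b * DIM('a) * D (Suc j) (?q x)"
    by (simp add: sum_subtractf sum_distrib_left sum_distrib_right)
  also have "(\<Sum>i\<in>Basis. ((x - z) \<bullet> i)\<^sup>2) = (norm (x - z))\<^sup>2"
    unfolding power2_norm_eq_inner[of "x - z"] using euclidean_inner[of "x - z" "x - z"]
    by (simp add: power2_eq_square)
  finally show ?thesis .
qed

section \<open>Smooth bumps and test functions\<close>

text \<open>With \<open>s = 1/t\<close>, the derivative of \<open>p(s) exp(-s)\<close> in
  \<open>t\<close> is \<open>-s^2\<close> times its derivative in \<open>s\<close>, that is
  \<open>s^2 (p - p')(s) exp(-s)\<close>.\<close>

fun bump_poly :: "nat \<Rightarrow> real poly" where
  "bump_poly 0 = 1"
| "bump_poly (Suc j) = [:0, 0, 1:] * (bump_poly j - pderiv (bump_poly j))"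

definition bump :: "nat \<Rightarrow> real \<Rightarrow> real" where
  "bump j t = (if t > 0 then poly (bump_poly j) (1 / t) * exp (- 1 / t) else 0)"

lemma poly_times_exp_minus_tendsto_0:
  "((\<lambda>x::real. poly p x * exp (- x)) \<longlongrightarrow> 0) at_top"
proof -
  have "((\<lambda>x::real. \<Sum>i\<le>degree p. coeff p i * (x ^ i / exp x)) \<longlongrightarrow> 0) at_top"
    by (intro tendsto_null_sum tendsto_mult_right_zero tendsto_power_div_exp_0)
  then show ?thesis
    by (simp add: poly_altdef exp_minus divide_inverse sum_distrib_right mult.assoc)
qed

text \<open>Away from the origin this is the recursion of \<open>bump_poly\<close>; at the origin
  the difference quotient is a polynomial in \<open>1/t\<close> times \<open>exp(-1/t)\<close>, and
  the exponential wins.\<close>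

lemma bump_has_derivative: "(bump j has_real_derivative bump (Suc j) t) (at t)"
proof -
  consider "t < 0" | "t = 0" | "t > 0" by linarith
  then show ?thesis
  proof cases
    case 1
    have "(bump j has_real_derivative 0) (at t)"
      by (rule has_field_derivative_transform_within_open[where S = "{..<0}" and f = "\<lambda>_. 0"])
        (use 1 in \<open>auto simp: bump_def\<close>)
    then show ?thesis using 1 by (simp add: bump_def)
  next
    case 3
    have "((\<lambda>t. poly (bump_poly j) (1 / t) * exp (- 1 / t)) has_real_derivative
        bump (Suc j) t) (at t)"
      using 3 by (auto intro!: derivative_eq_intros simp: bump_def field_simps power2_eq_square)
    then show ?thesis
      by (rule has_field_derivative_transform_within_open[where S = "{0<..}"])
        (use 3 in \<open>auto simp: bump_def\<close>)
  next
    case 2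
    have "((\<lambda>y. bump j y / y) \<longlongrightarrow> 0) (at 0)"
    proof (rule filterlim_split_at)
      show "((\<lambda>y. bump j y / y) \<longlongrightarrow> 0) (at_left 0)"
        by (rule tendsto_eventually) (auto simp: bump_def eventually_at_left_field intro: exI[of _ "-1"])
      \<comment> \<open>The additional factor \<open>[:0, 1:]\<close> is the division by
        \<open>y\<close> in the difference quotient.\<close>
      have "((\<lambda>y. poly ([:0, 1:] * bump_poly j) (inverse y) * exp (- inverse y)) \<longlongrightarrow> 0) (at_right 0)"
        by (rule filterlim_compose[OF poly_times_exp_minus_tendsto_0 filterlim_inverse_at_top_right])
      then show "((\<lambda>y. bump j y / y) \<longlongrightarrow> 0) (at_right 0)"
        by (rule Lim_transform_eventually)
          (auto simp: bump_def eventually_at_right_field field_simps intro!: exI[of _ 1])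
    qed
    then show ?thesis
      using 2 by (simp add: has_field_derivative_iff bump_def)
  qed
qed

text \<open>The normalization at the origin makes the antiderivative vanish on the whole negative
  half-line, so that it too produces compactly supported bumps.\<close>

definition bump_int :: "real \<Rightarrow> real" where
  "bump_int = (SOME F. (\<forall>t. (F has_real_derivative bump 0 t) (at t)) \<and> F 0 = 0)"

lemma bump_int: "(bump_int has_real_derivative bump 0 t) (at t)" "bump_int 0 = 0"
proof -
  have "isCont (bump 0) x" for x
    by (rule DERIV_isCont[OF bump_has_derivative])
  then obtain F where "\<And>x. (F has_vector_derivative bump 0 x) (at x)"
    using einterval_antiderivative[of "-\<infinity>" "\<infinity>" "bump 0"] by auto
  then have "(\<forall>t. ((\<lambda>t. F t - F 0) has_real_derivative bump 0 t) (at t)) \<and> F 0 - F 0 = 0"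
    by (auto simp: has_real_derivative_iff_has_vector_derivative intro!: derivative_eq_intros)
  then have "\<exists>F. (\<forall>t. (F has_real_derivative bump 0 t) (at t)) \<and> F 0 = 0"
    by (rule exI[of _ "\<lambda>t. F t - F 0"])
  from someI_ex[OF this]
  show "(bump_int has_real_derivative bump 0 t) (at t)" "bump_int 0 = 0"
    unfolding bump_int_def by auto
qed

text \<open>Entry 1 is the bump \<open>exp (-1/t)\<close>, the later entries are its derivatives and entry 0 is its
  antiderivative.\<close>

definition bump_seq :: "nat \<Rightarrow> real \<Rightarrow> real" where
  "bump_seq j = (case j of 0 \<Rightarrow> bump_int | Suc j \<Rightarrow> bump j)"

lemma bump_seq_has_derivative: "(bump_seq j has_real_derivative bump_seq (Suc j) t) (at t)"
  by (cases j) (auto simp: bump_seq_def bump_int bump_has_derivative)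

lemma bump_seq_1: "bump_seq (Suc 0) t = (if t > 0 then exp (- 1 / t) else 0)"
  by (simp add: bump_seq_def bump_def)

lemma bump_seq_1_mono: "s \<le> t \<Longrightarrow> bump_seq (Suc 0) s \<le> bump_seq (Suc 0) t"
  by (auto simp: bump_seq_1 field_simps)

lemma bump_seq_1_bounds: "0 \<le> bump_seq (Suc 0) t" "bump_seq (Suc 0) t \<le> 1"
  by (auto simp: bump_seq_1)

lemma bump_seq_0_nonpos: assumes "t \<le> 0" shows "bump_seq 0 t = 0"
proof (cases "t = 0")
  case False
  with assms have "t < 0" by simp
  then obtain z where "t < z" "z < 0" "bump_seq 0 0 - bump_seq 0 t = (0 - t) * bump_seq (Suc 0) z"
    using MVT2[of t 0 "bump_seq 0" "bump_seq (Suc 0)"] bump_seq_has_derivative[of 0] by auto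
  then show ?thesis by (simp add: bump_seq_1) (simp add: bump_seq_def bump_int)
qed (simp add: bump_seq_def bump_int)

lemma bump_seq_nonpos: "t \<le> 0 \<Longrightarrow> bump_seq j t = 0"
  by (cases j) (simp_all add: bump_seq_0_nonpos, simp add: bump_seq_def bump_def)

text \<open>By the mean value theorem on \<open>[0, t]\<close>, the antiderivative is
  \<open>t\<close> times a value of the bump at an intermediate point, and the bump is nonnegative
  and increasing.\<close>

lemma bump_seq_0_bounds: "0 \<le> bump_seq 0 t" "t > 0 \<Longrightarrow> bump_seq 0 t \<le> t * bump_seq (Suc 0) t"
proof -
  have *: "0 \<le> bump_seq 0 t \<and> bump_seq 0 t \<le> t * bump_seq (Suc 0) t" if "t > 0"
  proof -
    obtain z where z: "0 < z" "z < t" "bump_seq 0 t - bump_seq 0 0 = (t - 0) * bump_seq (Suc 0) z"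
      using MVT2[of 0 t "bump_seq 0" "bump_seq (Suc 0)"] bump_seq_has_derivative[of 0] \<open>t > 0\<close> by auto
    then have "bump_seq 0 t = t * bump_seq (Suc 0) z"
      by (simp add: bump_seq_nonpos)
    then show ?thesis
      using z \<open>t > 0\<close> bump_seq_1_bounds[of z] bump_seq_1_mono[of z t] by (simp add: mult_left_mono)
  qed
  then show "0 \<le> bump_seq 0 t" "t > 0 \<Longrightarrow> bump_seq 0 t \<le> t * bump_seq (Suc 0) t"
    by (cases "t > 0"; simp add: bump_seq_nonpos)+
qed

text \<open>A bound from above on the argument suffices because all entries vanish on the negative
  half-line; paraboloids are bounded above but not below.\<close>

lemma bump_seq_bounded: obtains M where "M > 0" "\<And>t. t \<le> T \<Longrightarrow> \<bar>bump_seq j t\<bar> \<le> M"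
proof -
  have "continuous_on {0..T} (bump_seq j)"
    by (meson bump_seq_has_derivative DERIV_continuous_on has_field_derivative_at_within)
  then have "bounded (bump_seq j ` {0..T})"
    by (intro compact_imp_bounded compact_continuous_image) auto
  then obtain M where "M > 0" and M: "\<And>t. t \<in> {0..T} \<Longrightarrow> \<bar>bump_seq j t\<bar> \<le> M"
    unfolding bounded_pos by auto
  have "\<bar>bump_seq j t\<bar> \<le> M" if "t \<le> T" for t
    using M[of t] that \<open>M > 0\<close> by (cases "t \<ge> 0") (auto simp: bump_seq_nonpos)
  with \<open>M > 0\<close> show thesis using that by blast
qed

section \<open>Test functions as smooth functions vanishing outside a ball\<close>

lemma test_function_iff:
  "test_function \<phi> \<longleftrightarrow> smooth \<phi> \<and> (\<exists>R. \<forall>x. norm x > R \<longrightarrow> \<phi> x = 0)"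
proof
  assume t: "test_function \<phi>"
  then have "bounded {x. \<phi> x \<noteq> 0}"
    unfolding test_function_def by (meson bounded_subset closure_subset compact_imp_bounded)
  then obtain R where "\<And>x. \<phi> x \<noteq> 0 \<Longrightarrow> norm x \<le> R"
    unfolding bounded_iff by auto
  then show "smooth \<phi> \<and> (\<exists>R. \<forall>x. norm x > R \<longrightarrow> \<phi> x = 0)"
    using t by (metis leD smooth_def test_function_def)
next
  assume a: "smooth \<phi> \<and> (\<exists>R. \<forall>x. norm x > R \<longrightarrow> \<phi> x = 0)"
  then obtain R where R: "\<And>x. norm x > R \<Longrightarrow> \<phi> x = 0" by auto
  have "{x. \<phi> x \<noteq> 0} \<subseteq> cball 0 R"
    using R by (force simp: not_less[symmetric])
  then show "test_function \<phi>"
    using a unfolding test_function_def smooth_def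
    by (meson bounded_cball bounded_subset compact_closure)
qed

lemma test_functionI: "smooth \<phi> \<Longrightarrow> (\<And>x. norm x > R \<Longrightarrow> \<phi> x = 0) \<Longrightarrow> test_function \<phi>"
  by (auto simp: test_function_iff)

lemma test_function_smooth: "test_function \<phi> \<Longrightarrow> smooth \<phi>"
  by (simp add: test_function_iff)

lemma test_function_support:
  assumes "test_function \<phi>"
  obtains R where "R > 0" "\<And>x. norm x > R \<Longrightarrow> \<phi> x = 0"
proof -
  obtain R where "\<And>x. norm x > R \<Longrightarrow> \<phi> x = 0"
    using assms by (auto simp: test_function_iff)
  then show thesis using that[of "max R 1"] by auto
qed

lemma test_function_bounded:
  assumes "test_function \<phi>"
  obtains M where "M > 0" "\<And>x. \<bar>\<phi> x\<bar> \<le> M"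
proof -
  obtain R where R: "R > 0" "\<And>x. norm x > R \<Longrightarrow> \<phi> x = 0"
    using assms test_function_support by blast
  have "bounded (\<phi> ` cball 0 R)"
    by (intro compact_imp_bounded compact_continuous_image smooth_continuous
        test_function_smooth assms) auto
  then obtain M where "M > 0" and M: "\<And>x. norm x \<le> R \<Longrightarrow> \<bar>\<phi> x\<bar> \<le> M"
    unfolding bounded_pos by auto
  have "\<bar>\<phi> x\<bar> \<le> M" for x
    using M[of x] R(2)[of x] \<open>M > 0\<close> by (cases "norm x \<le> R") auto
  with \<open>M > 0\<close> show thesis using that by blast
qed

lemma test_function_partial:
  assumes "test_function \<phi>" "i \<in> Basis"
  shows "test_function (partial i \<phi>)"
proof -
  obtain R where R: "\<And>x. norm x > R \<Longrightarrow> \<phi> x = 0"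
    using assms test_function_support by blast
  have "partial i \<phi> x = 0" if "norm x > R" for x
  proof (rule partial_eqI[where D = "\<lambda>_. 0", simplified])
    have "open {x::'a. norm x > R}"
      by (intro open_Collect_less continuous_intros)
    then show "(\<phi> has_derivative (\<lambda>_. 0)) (at x)"
      by (rule has_derivative_transform_within_open[OF has_derivative_const]) (use that R in auto)
  qed
  then show ?thesis
    using assms
    by (auto intro!: test_functionI[where R = R] intro: smooth_partial test_function_smooth)
qed

lemma test_function_add:
  assumes "test_function \<phi>" "test_function \<psi>"
  shows "test_function (\<lambda>x. \<phi> x + \<psi> x)"
proof -
  obtain R S where "\<And>x. norm x > R \<Longrightarrow> \<phi> x = 0" "\<And>x. norm x > S \<Longrightarrow> \<psi> x = 0"
    using assms test_function_support by metis
  then show ?thesis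
    using assms
    by (auto intro!: test_functionI[where R = "max R S"] intro: smooth_add dest: test_function_smooth)
qed

lemma test_function_mult:
  assumes "test_function \<phi>" "smooth \<psi>"
  shows "test_function (\<lambda>x. \<phi> x * \<psi> x)"
proof -
  obtain R where "\<And>x. norm x > R \<Longrightarrow> \<phi> x = 0"
    using assms test_function_support by metis
  then show ?thesis
    using assms
    by (auto intro!: test_functionI[where R = R] intro: smooth_mult dest: test_function_smooth)
qed

lemma test_function_zero: "test_function (\<lambda>x. 0)"
  by (auto simp: test_function_iff)

lemma test_function_sum:
  "(\<And>i. i \<in> I \<Longrightarrow> test_function (f i)) \<Longrightarrow> test_function (\<lambda>x. \<Sum>i\<in>I. f i x)"
  by (induction I rule: infinite_finite_induct) (auto intro: test_function_add test_function_zero)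

lemma test_function_translate:
  assumes "test_function \<phi>" shows "test_function (\<lambda>x. \<phi> (x - z))"
proof -
  obtain R where R: "\<And>x. norm x > R \<Longrightarrow> \<phi> x = 0"
    using assms test_function_support by metis
  have "\<phi> (x - z) = 0" if "norm x > R + norm z" for x
    using that norm_triangle_ineq2[of x z] by (intro R) linarith
  then show ?thesis
    using assms
    by (auto intro!: test_functionI[where R = "R + norm z"] intro: smooth_translate dest: test_function_smooth)
qed

lemma test_function_laplacian: "test_function \<phi> \<Longrightarrow> test_function (laplacian \<phi>)"
  using test_function_sum[of Basis "\<lambda>i. partial i (partial i \<phi>)"]
  by (simp add: laplacian_def[abs_def] test_function_partial)

lemma test_function_bump:
  assumes "b > 0" shows "test_function (\<lambda>x. bump_seq j (paraboloid a b z x))"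
proof -
  have "bump_seq j (paraboloid a b z x) = 0" if "norm x > norm z + sqrt (\<bar>a\<bar> / b)" for x
  proof (rule bump_seq_nonpos)
    have "norm (x - z) \<ge> sqrt (\<bar>a\<bar> / b)"
      using that norm_triangle_ineq2[of x z] by linarith
    then have "(norm (x - z))\<^sup>2 \<ge> \<bar>a\<bar> / b"
      using sqrt_le_D by blast
    then show "paraboloid a b z x \<le> 0"
      using assms by (simp add: paraboloid_def field_simps)
  qed
  then show ?thesis
    using smooth_compose_real[of bump_seq, OF bump_seq_has_derivative smooth_paraboloid]
    by (intro test_functionI[where R = "norm z + sqrt (\<bar>a\<bar> / b)"])
qed

lemma borel_measurable_smooth [measurable (raw)]:
  "smooth f \<Longrightarrow> f \<in> borel_measurable borel"
  "smooth f \<Longrightarrow> f \<in> borel_measurable lebesgue"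
proof -
  assume "smooth f"
  then show "f \<in> borel_measurable borel"
    by (intro borel_measurable_continuous_onI smooth_continuous)
  then show "f \<in> borel_measurable lebesgue"
    by (simp add: measurable_completion)
qed

lemma test_function_measurable: "test_function f \<Longrightarrow> f \<in> borel_measurable lebesgue"
  by (intro borel_measurable_smooth test_function_smooth)

section \<open>Local integrability and integration against bounded kernels of bounded
  support\<close>

lemma integrable_mult_cball:
  assumes w: "locally_integrable w" and k: "k \<in> borel_measurable lebesgue"
    and M: "\<And>x. \<bar>k x\<bar> \<le> M" and R: "\<And>x. norm x > R \<Longrightarrow> k x = 0"
  shows "integrable lebesgue (\<lambda>x. w x * k x)"
proof -
  let ?w = "\<lambda>x. indicator (cball 0 R) x *\<^sub>R w x"
  have *: "integrable lebesgue ?w"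
    using w unfolding locally_integrable_def set_integrable_def by simp
  have eq: "(\<lambda>x. w x * k x) = (\<lambda>x. ?w x * k x)"
    using R by (auto simp: fun_eq_iff indicator_def)
  show ?thesis unfolding eq
  proof (rule Bochner_Integration.integrable_bound[of _ "\<lambda>x. M * ?w x"])
    show "integrable lebesgue (\<lambda>x. M * ?w x)" using * by simp
    show "(\<lambda>x. ?w x * k x) \<in> borel_measurable lebesgue"
      using k borel_measurable_integrable[OF *] by (rule borel_measurable_times[rotated])
    have "0 \<le> M" using M[of 0] by linarith
    then show "AE x in lebesgue. norm (?w x * k x) \<le> norm (M * ?w x)"
      using M by (auto simp: abs_mult indicator_def mult.commute intro!: mult_right_mono)
  qed
qed

text \<open>Dominated convergence with \<open>M\<close> times the absolute value of
  \<open>w\<close>, cut off to the common ball, as dominating function. It serves difference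
  quotients, translates and bumps alike.\<close>

lemma tendsto_integral_mult_cball:
  assumes w: "locally_integrable w" and k: "\<And>n. k n \<in> borel_measurable lebesgue"
    and M: "\<And>n x. \<bar>k n x\<bar> \<le> M" and R: "\<And>n x. norm x > R \<Longrightarrow> k n x = 0"
    and lim: "\<And>x. (\<lambda>n. k n x) \<longlonglongrightarrow> k' x"
  shows "(\<lambda>n. \<integral>x. w x * k n x \<partial>lebesgue) \<longlonglongrightarrow> (\<integral>x. w x * k' x \<partial>lebesgue)"
proof -
  let ?w = "\<lambda>x. indicator (cball 0 R) x *\<^sub>R w x"
  have *: "integrable lebesgue ?w"
    using w unfolding locally_integrable_def set_integrable_def by simp
  have k': "k' \<in> borel_measurable lebesgue"
    by (rule borel_measurable_LIMSEQ_real[OF lim k])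
  have R': "k' x = 0" if "norm x > R" for x
    using lim[of x] R[OF that] by (simp add: LIMSEQ_const_iff)
  have eq: "w x * k n x = ?w x * k n x" "w x * k' x = ?w x * k' x" for x n
    using R[of x n] R'[of x] by (auto simp: indicator_def)
  have wm: "?w \<in> borel_measurable lebesgue" using * by blast
  show ?thesis unfolding eq
  proof (rule integral_dominated_convergence[where w = "\<lambda>x. M * \<bar>?w x\<bar>"])
    show "(\<lambda>x. ?w x * k' x) \<in> borel_measurable lebesgue" 
      "\<And>n. (\<lambda>x. ?w x * k n x) \<in> borel_measurable lebesgue"
      using wm k k' by (auto intro: borel_measurable_times)
    show "integrable lebesgue (\<lambda>x. M * \<bar>?w x\<bar>)" using * by simp
    show "AE x in lebesgue. (\<lambda>n. ?w x * k n x) \<longlonglongrightarrow> ?w x * k' x"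
      by (intro AE_I2 tendsto_intros lim)
    show "AE x in lebesgue. norm (?w x * k n x) \<le> M * \<bar>?w x\<bar>" for n
      using M[of n] by (auto simp: abs_mult indicator_def mult.commute[of "\<bar>w _\<bar>"] intro!: mult_right_mono)
  qed
qed

lemma integrable_mult_test:
  assumes "locally_integrable w" "test_function \<phi>"
  shows "integrable lebesgue (\<lambda>x. w x * \<phi> x)"
proof -
  obtain M where "\<And>x. \<bar>\<phi> x\<bar> \<le> M" using test_function_bounded[OF assms(2)] by blast
  moreover obtain R where "\<And>x. norm x > R \<Longrightarrow> \<phi> x = 0"
    using test_function_support[OF assms(2)] by blast
  ultimately show ?thesis
    using integrable_mult_cball[OF assms(1) test_function_measurable[OF assms(2)]] by blast
qed

lemma locally_integrable_const: "locally_integrable (\<lambda>x. c)"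
  unfolding locally_integrable_def set_integrable_def
proof (intro allI impI)
  fix K :: "'a set" assume "compact K"
  then have "K \<in> lmeasurable" by (rule lmeasurable_compact)
  then show "integrable lebesgue (\<lambda>x. indicator K x *\<^sub>R c)"
    by (intro integrable_scaleR_left integrable_real_indicator)
      (auto simp: fmeasurable_def)
qed

lemma integrable_test: "test_function \<phi> \<Longrightarrow> integrable lebesgue \<phi>"
  using integrable_mult_test[OF locally_integrable_const[of 1]] by simp

lemma locally_integrable_test: "test_function \<phi> \<Longrightarrow> locally_integrable \<phi>"
  unfolding locally_integrable_def set_integrable_def
  by (intro allI impI integrable_mult_indicator integrable_test lmeasurable_compact fmeasurableD)

lemma locally_integrable_add:
  "locally_integrable f \<Longrightarrow> locally_integrable g \<Longrightarrow> locally_integrable (\<lambda>x. f x + g x)"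
  unfolding locally_integrable_def by auto

lemma locally_integrable_diff:
  "locally_integrable f \<Longrightarrow> locally_integrable g \<Longrightarrow> locally_integrable (\<lambda>x. f x - g x)"
  unfolding locally_integrable_def by auto

lemma locally_integrable_cmult:
  "locally_integrable f \<Longrightarrow> locally_integrable (\<lambda>x. c * f x)"
  unfolding locally_integrable_def by auto

section \<open>Integration by parts and the fundamental lemma\<close>

lemma smooth_line_derivative:
  assumes "smooth f"
  shows "((\<lambda>t. f (x + t *\<^sub>R h)) has_real_derivative partial h f (x + t *\<^sub>R h)) (at t)"
proof -
  let ?y = "x + t *\<^sub>R h"
  have D: "(f has_derivative (\<lambda>h. partial h f ?y)) (at ?y)"
    using assms by (intro has_derivative_partial smooth_differentiable)
  have "((\<lambda>t. f (x + t *\<^sub>R h)) has_derivative (\<lambda>s. partial (s *\<^sub>R h) f ?y)) (at t)"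
    by (rule has_derivative_compose[where f' = "\<lambda>s. s *\<^sub>R h"])
      (auto intro!: derivative_eq_intros D)
  moreover have "partial (s *\<^sub>R h) f ?y = partial h f ?y * s" for s
    using linear_cmul[OF has_derivative_linear[OF D]] by simp
  ultimately show ?thesis
    by (simp add: has_field_derivative_def)
qed

lemma integral_lebesgue_translate:
  fixes F :: "'a::euclidean_space \<Rightarrow> real"
  assumes "F \<in> borel_measurable borel"
  shows "(\<integral>x. F (x + c) \<partial>lebesgue) = (\<integral>x. F x \<partial>lebesgue)"
proof -
  have "(\<integral>x. F x \<partial>lborel) = (\<integral>x. F x \<partial>(distr lborel borel ((+) c)))"
    by (simp add: lborel_distr_plus)
  also have "\<dots> = (\<integral>x. F (c + x) \<partial>lborel)"
    using assms by (intro integral_distr) auto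
  finally show ?thesis
    using assms by (simp add: integral_completion add.commute)
qed

text \<open>Difference quotients of \<open>F\<close> have integral zero by translation invariance,
  and they converge boundedly to the partial derivative; iterated integrals and boundary terms are
  thus avoided.\<close>

lemma integral_partial_test_eq_0:
  assumes F: "test_function F" and i: "i \<in> Basis"
  shows "(\<integral>x. partial i F x \<partial>lebesgue) = 0"
proof -
  note sF = test_function_smooth[OF F]
  obtain M where M: "M > 0" "\<And>x. \<bar>partial i F x\<bar> \<le> M"
    using test_function_bounded[OF test_function_partial[OF F i]] by blast
  obtain R where R: "R > 0" "\<And>x. norm x > R \<Longrightarrow> F x = 0"
    using test_function_support[OF F] by blast
  define t where "t n = inverse (real (Suc n))" for n
  have t: "0 < t n" "t n \<le> 1" for n by (auto simp: t_def field_simps)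
  define k where "k n x = (F (x + t n *\<^sub>R i) - F x) / t n" for n x
  \<comment> \<open>The steps \<open>t n\<close> are at most 1, whence the radius
    \<open>R + 1\<close>; the mean value theorem bounds the quotients by the bound \<open>M\<close>
    of the partial derivative.\<close>
  have "(\<lambda>n. \<integral>x. 1 * k n x \<partial>lebesgue) \<longlonglongrightarrow> (\<integral>x. 1 * partial i F x \<partial>lebesgue)"
  proof (rule tendsto_integral_mult_cball[OF locally_integrable_const, where M = M and R = "R + 1"])
    have "smooth (\<lambda>x. F (x + t n *\<^sub>R i))" for n
      using smooth_translate[OF sF, of "- t n *\<^sub>R i"] by simp
    then show "k n \<in> borel_measurable lebesgue" for n
      unfolding k_def by (intro borel_measurable_divide borel_measurable_diff borel_measurable_const
          borel_measurable_smooth sF)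
    show "\<bar>k n x\<bar> \<le> M" for n x
    proof -
      obtain z where "F (x + t n *\<^sub>R i) - F (x + 0 *\<^sub>R i) = (t n - 0) * partial i F (x + z *\<^sub>R i)"
        using MVT2[OF t(1)[of n] smooth_line_derivative[OF sF, of x i]] by auto
      then have "k n x = partial i F (x + z *\<^sub>R i)"
        using t(1)[of n] by (simp add: k_def)
      then show ?thesis using M by simp
    qed
    show "k n x = 0" if "norm x > R + 1" for n x
    proof -
      have "norm (x + t n *\<^sub>R i) \<ge> norm x - norm (t n *\<^sub>R i)"
        using norm_triangle_ineq2[of x "- (t n *\<^sub>R i)"] by simp
      moreover have "norm (t n *\<^sub>R i) \<le> 1"
        using t[of n] i by simp
      ultimately show ?thesis
        using that R(2)[of x] R(2)[of "x + t n *\<^sub>R i"] by (simp add: k_def)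
    qed
    show "(\<lambda>n. k n x) \<longlonglongrightarrow> partial i F x" for x
    proof -
      have "((\<lambda>s. (F (x + s *\<^sub>R i) - F x) / s) \<longlongrightarrow> partial i F x) (at 0)"
        using smooth_line_derivative[OF sF, of x i 0] by (simp add: has_field_derivative_iff)
      moreover have "filterlim t (at 0) sequentially"
        unfolding t_def filterlim_at using LIMSEQ_inverse_real_of_nat by auto
      ultimately show ?thesis
        unfolding k_def by (rule filterlim_compose)
    qed
  qed
  moreover have "(\<integral>x. 1 * k n x \<partial>lebesgue) = 0" for n
  proof -
    have "integrable lebesgue (\<lambda>x. F (x + t n *\<^sub>R i))"
      using integrable_test[OF test_function_translate[OF F, of "- t n *\<^sub>R i"]] by simp
    then have "(\<integral>x. F (x + t n *\<^sub>R i) - F x \<partial>lebesgue) = 0"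
      using integral_lebesgue_translate[OF borel_measurable_smooth(1)[OF sF]] integrable_test[OF F]
      by simp
    then show ?thesis by (simp add: k_def)
  qed
  ultimately show ?thesis
    by (simp add: LIMSEQ_const_iff)
qed

lemma integral_by_parts_test:
  assumes \<phi>: "test_function \<phi>" and \<psi>: "test_function \<psi>" and i: "i \<in> Basis"
  shows "(\<integral>x. \<phi> x * partial i \<psi> x \<partial>lebesgue) = - (\<integral>x. partial i \<phi> x * \<psi> x \<partial>lebesgue)"
proof -
  have "(\<integral>x. partial i \<phi> x * \<psi> x + \<phi> x * partial i \<psi> x \<partial>lebesgue)
      = (\<integral>x. partial i (\<lambda>x. \<phi> x * \<psi> x) x \<partial>lebesgue)"
    by (simp add: partial_mult smooth_differentiable test_function_smooth \<phi> \<psi>)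
  also have "\<dots> = 0"
    by (intro integral_partial_test_eq_0 test_function_mult \<phi> test_function_smooth[OF \<psi>] i)
  finally show ?thesis
    by (subst (asm) Bochner_Integration.integral_add)
      (auto intro!: integrable_mult_test locally_integrable_test test_function_partial \<phi> \<psi> i)
qed

lemma foldr_partial_test_function:
  "test_function \<phi> \<Longrightarrow> set is \<subseteq> Basis \<Longrightarrow> test_function (foldr partial is \<phi>)"
  by (induction "is") (auto intro: test_function_partial)

text \<open>Each integration by parts takes the outermost partial off \<open>\<psi>\<close> and
  makes it the innermost one on \<open>\<phi>\<close>. Recording the reversed list spares an appeal
  to the symmetry of mixed partials.\<close>

lemma weak_derivative_test_function:
  assumes "test_function \<phi>" "set is \<subseteq> Basis"
  shows "weak_derivative is \<phi> (foldr partial (rev is) \<phi>)"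
proof -
  have "(\<integral>x. \<phi> x * foldr partial is \<psi> x \<partial>lebesgue) =
      (-1) ^ length is * (\<integral>x. foldr partial (rev is) \<phi> x * \<psi> x \<partial>lebesgue)"
    if "test_function \<phi>" "test_function \<psi>" "set is \<subseteq> Basis" for \<phi> \<psi> :: "'a \<Rightarrow> real"
    using that
  proof (induction "is" arbitrary: \<phi>)
    case (Cons i "is")
    have "(\<integral>x. \<phi> x * foldr partial (i # is) \<psi> x \<partial>lebesgue) =
        - (\<integral>x. partial i \<phi> x * foldr partial is \<psi> x \<partial>lebesgue)"
      using Cons.prems by (simp add: integral_by_parts_test foldr_partial_test_function)
    also have "\<dots> = - ((-1) ^ length is * (\<integral>x. foldr partial (rev is) (partial i \<phi>) x * \<psi> x \<partial>lebesgue))"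
      using Cons.prems by (subst Cons.IH) (auto intro: test_function_partial)
    finally show ?case by simp
  qed simp
  then show ?thesis
    using assms unfolding weak_derivative_def
    by (auto intro!: locally_integrable_test foldr_partial_test_function)
qed

section \<open>The sign of a locally integrable function from its integrals over balls\<close>

lemma locally_integrable_measurable:
  assumes "locally_integrable f"
  shows "f \<in> borel_measurable lebesgue"
proof (rule borel_measurable_LIMSEQ_real)
  show "(\<lambda>x. indicator (cball 0 (real n)) x *\<^sub>R f x) \<in> borel_measurable lebesgue" for n
    using assms unfolding locally_integrable_def set_integrable_def
    by (intro borel_measurable_integrable) auto
  show "(\<lambda>n. indicator (cball 0 (real n)) x *\<^sub>R f x) \<longlonglongrightarrow> f x" for x
  proof (rule tendsto_eventually)
    show "\<forall>\<^sub>F n in sequentially. indicator (cball 0 (real n)) x *\<^sub>R f x = f x"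
      using eventually_ge_at_top[of "nat \<lceil>norm x\<rceil>"]
      by eventually_elim (auto simp: indicator_def nat_le_iff ceiling_le_iff)
  qed
qed

text \<open>Vitali's covering theorem exhausts \<open>V\<close>, up to a null set, by countably many
  disjoint balls inside \<open>V\<close>, and their contributions add up.\<close>

lemma set_integral_nonneg_open:
  fixes f :: "'a::euclidean_space \<Rightarrow> real"
  assumes f: "integrable lebesgue f" and "open V"
    and ball: "\<And>z r. r > 0 \<Longrightarrow> ball z r \<subseteq> V \<Longrightarrow> 0 \<le> (LINT x:ball z r|lebesgue. f x)"
  shows "0 \<le> (LINT x:V|lebesgue. f x)"
proof -
  have si: "set_integrable lebesgue A f" if "A \<in> sets lebesgue" for A
    unfolding set_integrable_def using f that by (intro integrable_mult_indicator)
  define K where "K = {p::'a \<times> real. snd p > 0 \<and> ball (fst p) (snd p) \<subseteq> V}"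
  have "\<exists>p. p \<in> K \<and> x \<in> ball (fst p) (snd p) \<and> snd p < d" if "x \<in> V" "0 < d" for x d
  proof -
    obtain e where "e > 0" "ball x e \<subseteq> V"
      using \<open>open V\<close> \<open>x \<in> V\<close> openE by blast
    then have "ball x (min e (d / 2)) \<subseteq> V"
      using subset_ball[of "min e (d / 2)" e x] by auto
    then show ?thesis
      using \<open>e > 0\<close> \<open>0 < d\<close> by (intro exI[of _ "(x, min e (d / 2))"]) (auto simp: K_def)
  qed
  then obtain C where C: "countable C" "C \<subseteq> K"
      "pairwise (\<lambda>i j. disjnt (ball (fst i) (snd i)) (ball (fst j) (snd j))) C"
      "negligible (V - (\<Union>i\<in>C. ball (fst i) (snd i)))"
    by (rule Vitali_covering_theorem_balls[of V K fst snd])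
  let ?B = "\<lambda>p::'a \<times> real. ball (fst p) (snd p)"
  \<comment> \<open>Indices outside the enumeration get the empty set, so that finite and infinite
    families of balls are treated alike.\<close>
  define A where "A n = (if n \<in> to_nat_on C ` C then ?B (from_nat_into C n) else {})" for n
  have UA: "(\<Union>n. A n) = (\<Union>p\<in>C. ?B p)"
    using \<open>countable C\<close> by (force simp: A_def)
  have A_to_nat: "A (to_nat_on C p) = ?B p" if "p \<in> C" for p
    using \<open>countable C\<close> that by (simp add: A_def)
  have disj: "A m \<inter> A n = {}" if "m \<noteq> n" for m n
  proof (cases "m \<in> to_nat_on C ` C \<and> n \<in> to_nat_on C ` C")
    case True
    then obtain p q where pq: "p \<in> C" "q \<in> C" "m = to_nat_on C p" "n = to_nat_on C q" by blast
    then have "disjnt (?B p) (?B q)"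
      using C(3) \<open>m \<noteq> n\<close> unfolding pairwise_def by metis
    then show ?thesis
      unfolding pq A_to_nat[OF pq(1)] A_to_nat[OF pq(2)] disjnt_def .
  next
    case False
    then have "A m = {} \<or> A n = {}" unfolding A_def by presburger
    then show ?thesis by blast
  qed
  have Ameas: "A n \<in> sets lebesgue" for n by (simp add: A_def)
  have UAmeas: "(\<Union>n. A n) \<in> sets lebesgue" using Ameas by blast
  have An: "0 \<le> (LINT x:A n|lebesgue. f x)" for n
  proof (cases "n \<in> to_nat_on C ` C")
    case True
    then obtain p where p: "p \<in> C" "n = to_nat_on C p" by blast
    then have "p \<in> K" using C(2) by blast
    then show ?thesis
      unfolding p(2) A_to_nat[OF p(1)] K_def using ball by blast
  qed (simp add: A_def set_lebesgue_integral_def)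
  have "(\<lambda>n. LINT x:(\<Union>i<n. A i)|lebesgue. f x) \<longlonglongrightarrow> (LINT x:(\<Union>n. \<Union>i<n. A i)|lebesgue. f x)"
  proof (rule set_integral_cont_up)
    show "incseq (\<lambda>n. \<Union>i<n. A i)"
      by (rule incseq_SucI) (auto simp: lessThan_Suc)
    show "set_integrable lebesgue (\<Union>n. \<Union>i<n. A i) f"
      using Ameas by (intro si) auto
  qed (use Ameas in auto)
  moreover have "(\<Union>n. \<Union>i<n. A i) = (\<Union>n. A n)" by auto
  moreover have "0 \<le> (LINT x:(\<Union>i<n. A i)|lebesgue. f x)" for n
    by (subst set_integral_finite_Union)
      (auto simp: disjoint_family_on_def disj Ameas si An intro!: sum_nonneg)
  ultimately have "0 \<le> (LINT x:(\<Union>n. A n)|lebesgue. f x)"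
    by (intro LIMSEQ_le_const) auto
  also have "\<dots> = (LINT x:V|lebesgue. f x)"
    unfolding set_lebesgue_integral_def
  proof (rule integral_cong_AE)
    show "(\<lambda>x. indicator (\<Union>n. A n) x *\<^sub>R f x) \<in> borel_measurable lebesgue"
      using si[OF UAmeas] unfolding set_integrable_def by blast
    show "(\<lambda>x. indicator V x *\<^sub>R f x) \<in> borel_measurable lebesgue"
      using si[of V] \<open>open V\<close> unfolding set_integrable_def by (auto intro: borel_measurable_integrable)
    have "AE x in lebesgue. x \<notin> V - (\<Union>n. A n)"
      using C(4) unfolding UA negligible_iff_null_sets by (rule AE_not_in)
    moreover have "(\<Union>n. A n) \<subseteq> V"
      using C(2) unfolding UA K_def by auto
    ultimately show "AE x in lebesgue. indicator (\<Union>n. A n) x *\<^sub>R f x = indicator V x *\<^sub>R f x"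
      by (auto simp: indicator_def elim!: eventually_mono)
  qed
  finally show ?thesis .
qed

text \<open>Let \<open>A\<close> be the part of a bounded window where \<open>f\<close> is negative.
  Approximating \<open>A\<close> from outside by open sets carries nonnegativity of the integral
  over to \<open>A\<close>, where the integrand is negative; hence \<open>A\<close> is null. Neither
  Lebesgue points nor a differentiation theorem is involved.\<close>

lemma AE_nonneg_if_balls:
  fixes f :: "'a::euclidean_space \<Rightarrow> real"
  assumes f: "locally_integrable f" and U: "open U"
    and ball: "\<And>z r. r > 0 \<Longrightarrow> ball z r \<subseteq> U \<Longrightarrow> 0 \<le> (LINT x:ball z r|lebesgue. f x)"
  shows "AE x in lebesgue. x \<in> U \<longrightarrow> 0 \<le> f x"
proof -
  note fm = locally_integrable_measurable[OF f]
  have "AE x in lebesgue. x \<in> U \<inter> ball 0 (real n) \<longrightarrow> 0 \<le> f x" for n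
  proof -
    define W where "W = U \<inter> ball 0 (real n)"
    define A where "A = {x. x \<in> W \<and> f x < 0}"
    define g where "g x = indicator (cball 0 (real n)) x *\<^sub>R f x" for x
    have g: "integrable lebesgue g"
      using f unfolding g_def locally_integrable_def set_integrable_def by auto
    have "open W" using U by (auto simp: W_def)
    have A: "A \<in> sets lebesgue"
    proof -
      have "A = W \<inter> {x\<in>space lebesgue. f x < 0}" by (auto simp: A_def)
      also have "\<dots> \<in> sets lebesgue"
        using fm \<open>open W\<close> by (intro sets.Int borel_measurable_less) auto
      finally show ?thesis .
    qed
    then obtain G T where G: "gdelta G" "T \<in> null_sets lebesgue" "A \<union> T = G"
      using lebesgue_set_almost_gdelta by metis
    obtain F where F: "\<And>n::nat. open (F n)" "G = \<Inter>(range F)"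
      using G(1) by cases blast
    \<comment> \<open>Finite intersections are still open and decrease to \<open>G\<close> inside
      the window, which agrees with \<open>A\<close> up to the null set \<open>T\<close>.\<close>
    define V where "V m = (\<Inter>i\<le>m. F i) \<inter> W" for m
    have oV: "open (V m)" for m
      unfolding V_def using F(1) \<open>open W\<close> by auto
    have nonneg: "0 \<le> (LINT x:V m|lebesgue. g x)" for m
    proof (rule set_integral_nonneg_open[OF g oV])
      fix z r assume r: "r > 0" "ball z r \<subseteq> V m"
      then have sub: "ball z r \<subseteq> U" "ball z r \<subseteq> cball 0 (real n)" 
        by (force simp: V_def W_def)+
      have "(LINT x:ball z r|lebesgue. g x) = (LINT x:ball z r|lebesgue. f x)"
        unfolding set_lebesgue_integral_def g_def
        by (rule Bochner_Integration.integral_cong) (use sub in \<open>auto simp: indicator_def\<close>)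
      then show "0 \<le> (LINT x:ball z r|lebesgue. g x)"
        using ball r sub by simp
    qed
    have "(\<lambda>m. LINT x:V m|lebesgue. g x) \<longlonglongrightarrow> (LINT x:A|lebesgue. g x)"
      unfolding set_lebesgue_integral_def
    proof (rule integral_dominated_convergence[where w = "\<lambda>x. \<bar>g x\<bar>"])
      show "(\<lambda>x. indicator A x *\<^sub>R g x) \<in> borel_measurable lebesgue"
        using integrable_mult_indicator[OF A g] by blast
      show "(\<lambda>x. indicator (V m) x *\<^sub>R g x) \<in> borel_measurable lebesgue" for m
        using integrable_mult_indicator[OF _ g, of "V m"] oV[of m]
        by (auto intro: borel_measurable_integrable)
      show "integrable lebesgue (\<lambda>x. \<bar>g x\<bar>)" using g by simp
      show "AE x in lebesgue. norm (indicator (V m) x *\<^sub>R g x) \<le> \<bar>g x\<bar>" for m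
        by (auto simp: indicator_def)
      have "AE x in lebesgue. x \<notin> T" using G(2) by (rule AE_not_in)
      then show "AE x in lebesgue. (\<lambda>m. indicator (V m) x *\<^sub>R g x) \<longlonglongrightarrow> indicator A x *\<^sub>R g x"
      proof eventually_elim
        case (elim x)
        show ?case
        proof (cases "x \<in> A")
          case True
          then have "x \<in> V m" for m
            using G(3) F(2) by (auto simp: V_def A_def)
          then show ?thesis using True by simp
        next
          case False
          then have "x \<notin> G" using elim G(3) by auto
          then obtain i where "x \<notin> F i" using F(2) by auto
          then have "indicator (V m) x *\<^sub>R g x = indicator A x *\<^sub>R g x" if "m \<ge> i" for m
            using that False by (auto simp: V_def indicator_def)
          then show ?thesis
            by (intro tendsto_eventually) (auto simp: eventually_at_top_linorder)
        qed
      qed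
    qed
    then have "0 \<le> (LINT x:A|lebesgue. g x)"
      by (rule LIMSEQ_le_const) (use nonneg in auto)
    moreover have sign: "0 \<le> - (indicator A x *\<^sub>R g x)" for x
      by (auto simp: indicator_def A_def g_def)
    moreover have "0 \<le> (\<integral>x. - (indicator A x *\<^sub>R g x) \<partial>lebesgue)"
      using sign by (rule Bochner_Integration.integral_nonneg)
    ultimately have "(\<integral>x. - (indicator A x *\<^sub>R g x) \<partial>lebesgue) = 0"
      unfolding set_lebesgue_integral_def by simp
    then have "AE x in lebesgue. - (indicator A x *\<^sub>R g x) = 0"
      using integral_nonneg_eq_0_iff_AE[of lebesgue "\<lambda>x. - (indicator A x *\<^sub>R g x)"]
        sign integrable_mult_indicator[OF A g] by simp
    then show ?thesis
      by eventually_elim (auto simp: A_def W_def g_def indicator_def split: if_splits)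
  qed
  then have "AE x in lebesgue. \<forall>n. x \<in> U \<inter> ball 0 (real n) \<longrightarrow> 0 \<le> f x"
    unfolding AE_all_countable by blast
  then show ?thesis
  proof eventually_elim
    case (elim x)
    obtain n where "norm x < real n" using reals_Archimedean2 by blast
    then show ?case using elim by auto
  qed
qed

text \<open>Peak and curvature grow together, so the paraboloid keeps its zero set, the sphere of
  radius \<open>r\<close>, while its values inside tend to infinity: a smooth approximation of the
  indicator of the ball. \<open>Suc n\<close> keeps the peak positive.\<close>

definition ball_bump :: "'a::euclidean_space \<Rightarrow> real \<Rightarrow> nat \<Rightarrow> 'a \<Rightarrow> real" where
  "ball_bump z r n x = bump_seq (Suc 0) (paraboloid (Suc n) (Suc n / r\<^sup>2) z x)"

lemma test_function_ball_bump: "r > 0 \<Longrightarrow> test_function (ball_bump z r n)"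
  unfolding ball_bump_def[abs_def] by (intro test_function_bump) auto

lemma ball_bump_bounds: "0 \<le> ball_bump z r n x" "ball_bump z r n x \<le> 1"
  by (auto simp: ball_bump_def bump_seq_1_bounds)

lemma paraboloid_ball:
  assumes "r > 0" "c > 0"
  shows "paraboloid c (c / r\<^sup>2) z x > 0 \<longleftrightarrow> x \<in> ball z r"
proof -
  have "paraboloid c (c / r\<^sup>2) z x = c / r\<^sup>2 * (r\<^sup>2 - (norm (x - z))\<^sup>2)"
    using assms by (simp add: paraboloid_def field_simps)
  then have "paraboloid c (c / r\<^sup>2) z x > 0 \<longleftrightarrow> (norm (x - z))\<^sup>2 < r\<^sup>2"
    using assms by (auto simp: zero_less_mult_iff zero_less_divide_iff)
  also have "\<dots> \<longleftrightarrow> norm (x - z) < r"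
    using assms power_strict_mono[of "norm (x - z)" r 2] power_mono[of r "norm (x - z)" 2]
    by (meson norm_ge_zero not_less less_imp_le zero_less_numeral)
  finally show ?thesis by (simp add: dist_norm norm_minus_commute)
qed

lemma ball_bump_tendsto:
  fixes w :: "'a::euclidean_space \<Rightarrow> real"
  assumes w: "locally_integrable w" and r: "r > 0"
  shows "(\<lambda>n. \<integral>x. w x * ball_bump z r n x \<partial>lebesgue) \<longlonglongrightarrow> (LINT x:ball z r|lebesgue. w x)"
proof -
  have "(\<lambda>n. \<integral>x. w x * ball_bump z r n x \<partial>lebesgue) \<longlonglongrightarrow> (\<integral>x. w x * indicator (ball z r) x \<partial>lebesgue)"
  proof (rule tendsto_integral_mult_cball[OF w, where M = 1 and R = "norm z + r"])
    show "ball_bump z r n \<in> borel_measurable lebesgue" for n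
      using r by (intro test_function_measurable test_function_ball_bump)
    show "\<bar>ball_bump z r n x\<bar> \<le> 1" for n x
      using ball_bump_bounds[of z r n x] by simp
    have off: "ball_bump z r n x = 0" if "x \<notin> ball z r" for n x
      unfolding ball_bump_def
      using paraboloid_ball[OF r, of "Suc n" z x] that by (intro bump_seq_nonpos) auto
    show "ball_bump z r n x = 0" if "norm x > norm z + r" for n x
    proof (rule off)
      show "x \<notin> ball z r"
        using that norm_triangle_ineq2[of x z] by (auto simp: dist_norm norm_minus_commute)
    qed
    show "(\<lambda>n. ball_bump z r n x) \<longlonglongrightarrow> indicator (ball z r) x" for x
    proof (cases "x \<in> ball z r")
      case True
      define t where "t = paraboloid 1 (1 / r\<^sup>2) z x"
      have "t > 0" using True r paraboloid_ball[of r 1 z x] by (simp add: t_def)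
      have "paraboloid (Suc n) (Suc n / r\<^sup>2) z x = real (Suc n) * t" for n
        by (simp add: paraboloid_def t_def algebra_simps)
      then have eq: "ball_bump z r n x = exp (- (1 / t) * inverse (real (Suc n)))" for n
        using \<open>t > 0\<close> by (simp add: ball_bump_def bump_seq_1 divide_inverse mult_pos_pos del: of_nat_Suc)
      have "(\<lambda>n. exp (- (1 / t) * inverse (real (Suc n)))) \<longlonglongrightarrow> exp (- (1 / t) * 0)"
        by (intro tendsto_intros LIMSEQ_inverse_real_of_nat)
      then show ?thesis using True by (simp add: eq)
    qed (simp add: off)
  qed
  then show ?thesis
    by (simp add: set_lebesgue_integral_def mult.commute)
qed

lemma AE_nonneg_if_test:
  assumes f: "locally_integrable f"
    and test: "\<And>\<phi>. test_function \<phi> \<Longrightarrow> (\<And>x. 0 \<le> \<phi> x) \<Longrightarrow> 0 \<le> (\<integral>x. f x * \<phi> x \<partial>lebesgue)"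
  shows "AE x in lebesgue. 0 \<le> f x"
proof -
  have "0 \<le> (LINT x:ball z r|lebesgue. f x)" if "r > 0" for z r
    by (rule LIMSEQ_le_const[OF ball_bump_tendsto[OF f that]])
      (auto intro!: test test_function_ball_bump that ball_bump_bounds)
  then have "AE x in lebesgue. x \<in> UNIV \<longrightarrow> 0 \<le> f x"
    by (intro AE_nonneg_if_balls f) auto
  then show ?thesis by simp
qed

lemma AE_zero_if_test:
  assumes f: "locally_integrable f"
    and test: "\<And>\<phi>. test_function \<phi> \<Longrightarrow> (\<integral>x. f x * \<phi> x \<partial>lebesgue) = 0"
  shows "AE x in lebesgue. f x = 0"
proof -
  have "AE x in lebesgue. 0 \<le> f x"
    by (rule AE_nonneg_if_test[OF f]) (simp add: test)
  moreover have "AE x in lebesgue. 0 \<le> - 1 * f x"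
    by (rule AE_nonneg_if_test[OF locally_integrable_cmult[OF f]]) (simp add: test)
  ultimately show ?thesis
    by eventually_elim simp
qed

lemma weak_derivative_unique:
  assumes "weak_derivative is u v" "weak_derivative is u v'"
  shows "AE x in lebesgue. v x = v' x"
proof -
  have "AE x in lebesgue. v x - v' x = 0"
  proof (rule AE_zero_if_test)
    show "locally_integrable (\<lambda>x. v x - v' x)"
      using assms by (auto simp: weak_derivative_def intro: locally_integrable_diff)
    fix \<phi> :: "'a \<Rightarrow> real" assume \<phi>: "test_function \<phi>"
    then have "(\<integral>x. v x * \<phi> x \<partial>lebesgue) = (\<integral>x. v' x * \<phi> x \<partial>lebesgue)"
      using assms by (auto simp: weak_derivative_def)
    moreover have "integrable lebesgue (\<lambda>x. v x * \<phi> x)" "integrable lebesgue (\<lambda>x. v' x * \<phi> x)"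
      using assms \<phi> by (auto simp: weak_derivative_def intro: integrable_mult_test)
    ultimately show "(\<integral>x. (v x - v' x) * \<phi> x \<partial>lebesgue) = 0"
      by (simp add: left_diff_distrib)
  qed
  then show ?thesis by simp
qed

section \<open>The weak maximum principle\<close>

text \<open>The distributional form of \<open>-\<Delta>w + a w \<ge> 0\<close>, with all derivatives
  on the test function.\<close>

definition supersolution :: "real \<Rightarrow> ('a::euclidean_space \<Rightarrow> real) \<Rightarrow> bool" where
  "supersolution a w \<longleftrightarrow> locally_integrable w \<and>
     (\<forall>\<phi>. test_function \<phi> \<and> (\<forall>x. 0 \<le> \<phi> x) \<longrightarrow>
       (\<integral>x. w x * laplacian \<phi> x \<partial>lebesgue) \<le> a * (\<integral>x. w x * \<phi> x \<partial>lebesgue))"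

lemma L2_measurable: "w \<in> L2 \<Longrightarrow> w \<in> borel_measurable lebesgue"
  and L2_integrable_square: "w \<in> L2 \<Longrightarrow> integrable lebesgue (\<lambda>x. (w x)\<^sup>2)"
  by (auto simp: L2_def)

lemma L2_locally_integrable: assumes "w \<in> L2" shows "locally_integrable w"
  unfolding locally_integrable_def
proof (intro allI impI)
  fix K :: "'a set" assume "compact K"
  have K: "K \<in> sets lebesgue"
    using \<open>compact K\<close> by (intro fmeasurableD lmeasurable_compact)
  show "set_integrable lebesgue K w"
    unfolding set_integrable_def
  proof (rule Bochner_Integration.integrable_bound[of _ "\<lambda>x. indicator K x *\<^sub>R 1 + (w x)\<^sup>2"])
    show "integrable lebesgue (\<lambda>x. indicator K x *\<^sub>R 1 + (w x)\<^sup>2)"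
      using locally_integrable_const[of 1] \<open>compact K\<close> L2_integrable_square[OF assms]
      unfolding locally_integrable_def set_integrable_def by (intro Bochner_Integration.integrable_add) auto
    show "(\<lambda>x. indicator K x *\<^sub>R w x) \<in> borel_measurable lebesgue"
      using K L2_measurable[OF assms] by (intro borel_measurable_scaleR borel_measurable_indicator)
    have "\<bar>t\<bar> \<le> 1 + t\<^sup>2" for t :: real
      using zero_le_power2[of "\<bar>t\<bar> - 1"] unfolding power2_diff by (simp add: power2_eq_square[of t])
    then show "AE x in lebesgue. norm (indicator K x *\<^sub>R w x) \<le> norm (indicator K x *\<^sub>R 1 + (w x)\<^sup>2)"
      by (auto simp: indicator_def)
  qed
qed

text \<open>Taylor's formula of second order at \<open>t\<close> and at \<open>-t\<close>; the
  first-order terms cancel. The two remainder points are kept apart, since both a uniform bound and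
  the limit as \<open>t\<close> tends to 0 can be read off the sum.\<close>

lemma second_difference:
  assumes f: "smooth f" and i: "i \<in> Basis"
  obtains r s where "\<bar>r\<bar> \<le> \<bar>t\<bar>" "\<bar>s\<bar> \<le> \<bar>t\<bar>"
    "f (x + t *\<^sub>R i) + f (x - t *\<^sub>R i) - 2 * f x =
      t\<^sup>2 / 2 * (partial i (partial i f) (x + r *\<^sub>R i) + partial i (partial i f) (x + s *\<^sub>R i))"
proof -
  have sm: "smooth ((partial i ^^ m) f)" for m
    by (induction m) (auto intro: f smooth_partial i)
  define d where "d m s = (partial i ^^ m) f (x + s *\<^sub>R i)" for m s
  have "\<forall>m s. (d m has_real_derivative d (Suc m) s) (at s)"
    using smooth_line_derivative[OF sm] by (simp add: d_def[abs_def])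
  then have *: "\<exists>r. \<bar>r\<bar> \<le> \<bar>t\<bar> \<and> d 0 t = (\<Sum>m<2. (d m 0 / fact m) * t ^ m) + (d 2 r / fact 2) * t ^ 2" for t
    by (rule Maclaurin_all_le[OF refl])
  obtain r where r: "\<bar>r\<bar> \<le> \<bar>t\<bar>" "d 0 t = d 0 0 + d 1 0 * t + d 2 r / 2 * t\<^sup>2"
    using *[of t] by (auto simp: numeral_2_eq_2)
  obtain s where s: "\<bar>s\<bar> \<le> \<bar>t\<bar>" "d 0 (- t) = d 0 0 - d 1 0 * t + d 2 s / 2 * t\<^sup>2"
    using *[of "- t"] by (auto simp: numeral_2_eq_2)
  have "d 0 t + d 0 (- t) - 2 * d 0 0 = t\<^sup>2 / 2 * (d 2 r + d 2 s)"
    using r s by (simp add: field_simps)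
  then show thesis
    using that[OF r(1) s(1)] by (simp add: d_def numeral_2_eq_2)
qed

text \<open>The mollification \<open>W\<close> of \<open>w\<close> vanishes at infinity, so a negative value makes \<open>W - d |x|\<^sup>2\<close>
  attain a minimum at a point where \<open>W\<close> is negative; second differences there contradict the
  supersolution property.\<close>

lemma weak_maximum_principle:
  fixes w :: "'a::euclidean_space \<Rightarrow> real"
  assumes w: "w \<in> L2" and super: "supersolution a w" and "a \<ge> 0"
  shows "AE x in lebesgue. 0 \<le> w x"
proof (rule AE_nonneg_if_test)
  show lw: "locally_integrable w" using w by (rule L2_locally_integrable)
  fix \<phi> :: "'a \<Rightarrow> real" assume \<phi>: "test_function \<phi>" and pos: "\<And>x. 0 \<le> \<phi> x"
  note s\<phi> = test_function_smooth[OF \<phi>]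
  obtain M where M: "M > 0" "\<And>x. \<bar>\<phi> x\<bar> \<le> M"
    using test_function_bounded[OF \<phi>] by blast
  obtain R where R: "R > 0" "\<And>x. norm x > R \<Longrightarrow> \<phi> x = 0"
    using test_function_support[OF \<phi>] by blast
  note tr = test_function_translate[OF \<phi>]
  define W where "W z = (\<integral>x. w x * \<phi> (x - z) \<partial>lebesgue)" for z
  have contW: "continuous_on UNIV W"
  proof (rule continuous_on_sequentiallyI)
    fix u :: "nat \<Rightarrow> 'a" and z assume "u \<longlonglongrightarrow> z"
    then obtain B where B: "\<And>n. norm (u n) \<le> B"
      using convergent_imp_Bseq[of u] by (auto simp: convergent_def Bseq_def)
    show "(\<lambda>n. W (u n)) \<longlonglongrightarrow> W z" unfolding W_def
    proof (rule tendsto_integral_mult_cball[OF lw, where M = M and R = "R + B"])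
      show "(\<lambda>x. \<phi> (x - u n)) \<in> borel_measurable lebesgue" for n
        by (intro test_function_measurable tr)
      show "\<bar>\<phi> (x - u n)\<bar> \<le> M" for n x by (rule M)
      show "\<phi> (x - u n) = 0" if "norm x > R + B" for n x
        using that B[of n] norm_triangle_ineq2[of x "u n"] by (intro R) linarith
      have "isCont \<phi> (x - z)" for x
        using smooth_continuous[OF s\<phi>, of UNIV] by (simp add: continuous_on_eq_continuous_at)
      then show "(\<lambda>n. \<phi> (x - u n)) \<longlonglongrightarrow> \<phi> (x - z)" for x
        by (rule isCont_tendsto_compose) (intro tendsto_intros \<open>u \<longlonglongrightarrow> z\<close>)
    qed
  qed
  have decay: "\<exists>\<rho>>0. \<forall>z. norm z \<ge> \<rho> \<longrightarrow> \<bar>W z\<bar> \<le> e" if "e > 0" for e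
  proof -
    define P where "P = (\<integral>x. (\<phi> x)\<^sup>2 \<partial>lebesgue)"
    have "P \<ge> 0" by (simp add: P_def)
    \<comment> \<open>Weight for Young's inequality
      \<open>|w \<phi>| \<le> \<delta>/2 \<phi>^2 + w^2/(2 \<delta>)\<close>. The integral of the
      translated \<open>\<phi>^2\<close> is always \<open>P\<close>, so the first term gives at most
      \<open>e/2\<close>; far out only the tail of \<open>w^2\<close> is met, and the bound
      \<open>\<delta> * e\<close> on it makes the second at most \<open>e/2\<close>. The summand 1
      avoids division by zero.\<close>
    define \<delta> where "\<delta> = e / (P + 1)"
    have "\<delta> > 0" using \<open>e > 0\<close> \<open>P \<ge> 0\<close> by (simp add: \<delta>_def)
    have "\<delta> * P \<le> e" using \<open>e > 0\<close> \<open>P \<ge> 0\<close> by (simp add: \<delta>_def field_simps)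
    define tail where "tail \<rho> x = indicator (- cball 0 \<rho>) x * (w x)\<^sup>2" for \<rho> x
    have tail: "integrable lebesgue (tail \<rho>)" for \<rho>
      using integrable_mult_indicator[OF _ L2_integrable_square[OF w], of "- cball 0 \<rho>"]
      by (simp add: tail_def[abs_def])
    have "(\<lambda>n. \<integral>x. tail (real n) x \<partial>lebesgue) \<longlonglongrightarrow> (\<integral>x. 0 \<partial>(lebesgue :: 'a measure))"
    proof (rule integral_dominated_convergence[where w = "\<lambda>x. (w x)\<^sup>2"])
      show "AE x in lebesgue. (\<lambda>n. tail (real n) x) \<longlonglongrightarrow> 0"
      proof (intro AE_I2 tendsto_eventually)
        show "\<forall>\<^sub>F n in sequentially. tail (real n) x = 0" for x
          using eventually_ge_at_top[of "nat \<lceil>norm x\<rceil>"]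
          by eventually_elim (auto simp: tail_def indicator_def nat_le_iff ceiling_le_iff)
      qed
      show "AE x in lebesgue. norm (tail (real n) x) \<le> (w x)\<^sup>2" for n
        by (auto simp: tail_def indicator_def)
    qed (use tail L2_integrable_square[OF w] in \<open>auto intro: borel_measurable_integrable\<close>)
    then have "\<forall>\<^sub>F n in sequentially. (\<integral>x. tail (real n) x \<partial>lebesgue) < \<delta> * e"
      using \<open>\<delta> > 0\<close> \<open>e > 0\<close> by (intro order_tendstoD(2)[of _ 0]) auto
    then obtain n where n: "(\<integral>x. tail (real n) x \<partial>lebesgue) < \<delta> * e"
      by (auto simp: eventually_at_top_linorder)
    have "\<bar>W z\<bar> \<le> e" if z: "norm z \<ge> real n + R + 1" for z
    proof -
      have t2: "test_function (\<lambda>x. (\<phi> x)\<^sup>2)"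
        unfolding power2_eq_square by (intro test_function_mult \<phi> s\<phi>)
      have int2: "integrable lebesgue (\<lambda>x. (\<phi> (x - z))\<^sup>2)"
        using integrable_test[OF test_function_translate[OF t2]] by simp
      have P: "(\<integral>x. (\<phi> (x - z))\<^sup>2 \<partial>lebesgue) = P"
        unfolding P_def
        using integral_lebesgue_translate[OF borel_measurable_smooth(1)[OF test_function_smooth[OF t2]], of "- z"]
        by simp
      have "\<bar>W z\<bar> \<le> (\<integral>x. \<bar>w x * \<phi> (x - z)\<bar> \<partial>lebesgue)"
        unfolding W_def by (rule integral_abs_bound)
      also have "\<dots> \<le> (\<integral>x. \<delta> / 2 * (\<phi> (x - z))\<^sup>2 + 1 / (2 * \<delta>) * tail (real n) x \<partial>lebesgue)"
      proof (rule integral_mono)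
        show "integrable lebesgue (\<lambda>x. \<bar>w x * \<phi> (x - z)\<bar>)"
          using integrable_mult_test[OF lw tr] by simp
        show "integrable lebesgue (\<lambda>x. \<delta> / 2 * (\<phi> (x - z))\<^sup>2 + 1 / (2 * \<delta>) * tail (real n) x)"
          by (intro Bochner_Integration.integrable_add integrable_mult_right int2 tail)
        show "\<bar>w x * \<phi> (x - z)\<bar> \<le> \<delta> / 2 * (\<phi> (x - z))\<^sup>2 + 1 / (2 * \<delta>) * tail (real n) x" for x
        proof (cases "\<phi> (x - z) = 0")
          case False
          then have "norm (x - z) \<le> R" using R(2) by (meson not_less)
          then have "norm x > real n"
            using z norm_triangle_ineq2[of z x] by (simp add: norm_minus_commute)
          moreover have "\<bar>w x * \<phi> (x - z)\<bar> \<le> \<delta> / 2 * (\<phi> (x - z))\<^sup>2 + 1 / (2 * \<delta>) * (w x)\<^sup>2"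
          proof -
            have "2 * \<delta> * \<bar>w x * \<phi> (x - z)\<bar> \<le> \<delta>\<^sup>2 * (\<phi> (x - z))\<^sup>2 + (w x)\<^sup>2"
              using zero_le_power2[of "\<delta> * \<bar>\<phi> (x - z)\<bar> - \<bar>w x\<bar>"]
              by (simp add: power2_diff power_mult_distrib abs_mult mult_ac)
            then show ?thesis
              using \<open>\<delta> > 0\<close> by (simp add: field_simps power2_eq_square)
          qed
          ultimately show ?thesis by (simp add: tail_def)
        qed (use \<open>\<delta> > 0\<close> in \<open>simp add: tail_def\<close>)
      qed
      also have "\<dots> = \<delta> / 2 * P + 1 / (2 * \<delta>) * (\<integral>x. tail (real n) x \<partial>lebesgue)"
        using int2 tail P by (subst Bochner_Integration.integral_add) auto
      also have "\<dots> \<le> \<delta> / 2 * P + 1 / (2 * \<delta>) * (\<delta> * e)"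
        using n \<open>\<delta> > 0\<close> by (intro add_left_mono mult_left_mono) auto
      also have "\<dots> \<le> e" using \<open>\<delta> > 0\<close> \<open>\<delta> * P \<le> e\<close> by simp
      finally show ?thesis .
    qed
    then show ?thesis using \<open>R > 0\<close> by (intro exI[of _ "real n + R + 1"]) auto
  qed
  have "0 \<le> W 0"
  proof (rule ccontr)
    assume "\<not> 0 \<le> W 0"
    define m where "m = - W 0"
    have "m > 0" using \<open>\<not> 0 \<le> W 0\<close> by (simp add: m_def)
    obtain \<rho> where \<rho>: "\<rho> > 0" "\<And>z. norm z \<ge> \<rho> \<Longrightarrow> \<bar>W z\<bar> \<le> m / 2"
      using decay[of "m / 2"] \<open>m > 0\<close> by auto
    \<comment> \<open>On the ball the quadratic correction is at most \<open>m/4\<close>, so at the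
      minimum point \<open>W\<close> is at most \<open>-3m/4\<close>. On the sphere of radius \<rho>
      it is at least \<open>-m/2\<close>; hence the minimum is interior.\<close>
    define d where "d = m / (4 * \<rho>\<^sup>2)"
    have "d > 0" "d * \<rho>\<^sup>2 = m / 4" using \<open>m > 0\<close> \<rho> by (simp_all add: d_def)
    obtain z where z: "z \<in> cball 0 \<rho>"
        "\<And>x. x \<in> cball 0 \<rho> \<Longrightarrow> W z - d * (norm z)\<^sup>2 \<le> W x - d * (norm x)\<^sup>2"
    proof -
      have "continuous_on (cball 0 \<rho>) (\<lambda>x. W x - d * (norm x)\<^sup>2)"
        by (intro continuous_intros continuous_on_subset[OF contW]) auto
      then have "\<exists>z\<in>cball 0 \<rho>. \<forall>x\<in>cball 0 \<rho>. W z - d * (norm z)\<^sup>2 \<le> W x - d * (norm x)\<^sup>2"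
        using \<rho>(1) by (intro continuous_attains_inf) auto
      then show thesis using that by blast
    qed
    have Wz: "W z \<le> d * (norm z)\<^sup>2 - m"
      using z(2)[of 0] \<rho>(1) by (simp add: m_def)
    have dz: "d * (norm z)\<^sup>2 \<le> m / 4"
      using z(1) \<open>d > 0\<close> \<open>d * \<rho>\<^sup>2 = m / 4\<close>
      by (metis less_imp_le mem_cball_0 mult_left_mono norm_ge_zero power_mono)
    have "norm z < \<rho>"
      using \<rho>(2)[of z] Wz dz \<open>m > 0\<close> by linarith
    have lap: "2 * d \<le> (\<integral>x. w x * partial i (partial i \<phi>) (x - z) \<partial>lebesgue)" if i: "i \<in> Basis" for i
    proof -
      have tii: "test_function (partial i (partial i \<phi>))"
        using \<phi> i by (intro test_function_partial)
      obtain M2 where M2: "\<And>x. \<bar>partial i (partial i \<phi>) x\<bar> \<le> M2"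
        using test_function_bounded[OF tii] by blast
      define t where "t n = inverse (real (Suc n))" for n
      have t: "0 < t n" "t n \<le> 1" for n by (auto simp: t_def field_simps)
      have t0: "t \<longlonglongrightarrow> 0" unfolding t_def by (rule LIMSEQ_inverse_real_of_nat)
      \<comment> \<open>The second difference of \<open>W\<close> at \<open>z\<close> in direction
        \<open>i\<close>, moved under the integral onto \<open>\<phi>\<close>. Minimality of
        \<open>W - d |x|^2\<close> makes its quotient at least \<open>2 * d\<close>.\<close>
      define k where "k n x = (\<phi> (x - z + t n *\<^sub>R i) + \<phi> (x - z - t n *\<^sub>R i) - 2 * \<phi> (x - z)) / (t n)\<^sup>2" for n x
      have "\<exists>r s. \<bar>r\<bar> \<le> \<bar>t n\<bar> \<and> \<bar>s\<bar> \<le> \<bar>t n\<bar> \<and> k n x =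
          (partial i (partial i \<phi>) (x - z + r *\<^sub>R i) + partial i (partial i \<phi>) (x - z + s *\<^sub>R i)) / 2" for n x
        using second_difference[OF s\<phi> i, of "t n" "x - z"] t(1)[of n]
        unfolding k_def by (smt (verit) nonzero_mult_div_cancel_left power_not_zero times_divide_eq_left times_divide_eq_right)
      then obtain r s where rs: "\<And>n x. \<bar>r n x\<bar> \<le> t n" "\<And>n x. \<bar>s n x\<bar> \<le> t n"
        "\<And>n x. k n x = (partial i (partial i \<phi>) (x - z + r n x *\<^sub>R i)
            + partial i (partial i \<phi>) (x - z + s n x *\<^sub>R i)) / 2"
        using t(1) by (metis abs_of_pos)
      have t1: "\<phi> (x - z + t n *\<^sub>R i) = \<phi> (x - (z - t n *\<^sub>R i))"
          "\<phi> (x - z - t n *\<^sub>R i) = \<phi> (x - (z + t n *\<^sub>R i))" for n x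
        by (simp_all add: algebra_simps)
      have "(\<lambda>n. \<integral>x. w x * k n x \<partial>lebesgue) \<longlonglongrightarrow> (\<integral>x. w x * partial i (partial i \<phi>) (x - z) \<partial>lebesgue)"
      proof (rule tendsto_integral_mult_cball[OF lw, where M = M2 and R = "R + norm z + 1"])
        show "k n \<in> borel_measurable lebesgue" for n
          unfolding k_def t1
          by (intro borel_measurable_divide borel_measurable_diff borel_measurable_add
              borel_measurable_times borel_measurable_const test_function_measurable tr)
        show "\<bar>k n x\<bar> \<le> M2" for n x
          unfolding rs(3) using M2[of "x - z + r n x *\<^sub>R i"] M2[of "x - z + s n x *\<^sub>R i"] by (simp add: abs_le_iff)
        show "k n x = 0" if x: "norm x > R + norm z + 1" for n x
        proof -
          have "norm (x - z) > R + 1"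
            using x norm_triangle_ineq2[of x z] by linarith
          moreover have "norm (t n *\<^sub>R i) \<le> 1"
            using t[of n] i by simp
          ultimately have "norm (x - z + t n *\<^sub>R i) > R" "norm (x - z - t n *\<^sub>R i) > R" "norm (x - z) > R"
            using norm_triangle_ineq2[of "x - z" "t n *\<^sub>R i"] norm_triangle_ineq2[of "x - z" "- (t n *\<^sub>R i)"]
            by simp_all
          then show ?thesis by (simp add: k_def R(2))
        qed
        show "(\<lambda>n. k n x) \<longlonglongrightarrow> partial i (partial i \<phi>) (x - z)" for x
        proof -
          have cont: "isCont (partial i (partial i \<phi>)) (x - z)"
            using smooth_continuous[OF test_function_smooth[OF tii], of UNIV]
            by (simp add: continuous_on_eq_continuous_at)
          have "(\<lambda>n. r n x) \<longlonglongrightarrow> 0" "(\<lambda>n. s n x) \<longlonglongrightarrow> 0"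
            using rs(1,2) by (auto intro!: Lim_null_comparison[OF _ t0])
          note lims = this[THEN tendsto_scaleR, OF tendsto_const, THEN tendsto_add[OF tendsto_const]]
          have "(\<lambda>n. x - z + r n x *\<^sub>R i) \<longlonglongrightarrow> x - z + 0 *\<^sub>R i" "(\<lambda>n. x - z + s n x *\<^sub>R i) \<longlonglongrightarrow> x - z + 0 *\<^sub>R i"
            by (rule lims)+
          then have "(\<lambda>n. partial i (partial i \<phi>) (x - z + r n x *\<^sub>R i)) \<longlonglongrightarrow> partial i (partial i \<phi>) (x - z)"
            "(\<lambda>n. partial i (partial i \<phi>) (x - z + s n x *\<^sub>R i)) \<longlonglongrightarrow> partial i (partial i \<phi>) (x - z)"
            using isCont_tendsto_compose[OF cont] by auto
          from tendsto_divide[OF tendsto_add[OF this] tendsto_const[of 2]]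
          show ?thesis unfolding rs(3) by simp
        qed
      qed
      moreover have "\<exists>n0. \<forall>n\<ge>n0. 2 * d \<le> (\<integral>x. w x * k n x \<partial>lebesgue)"
      proof -
        have "\<forall>\<^sub>F n in sequentially. t n < \<rho> - norm z"
          using \<open>norm z < \<rho>\<close> by (intro order_tendstoD(2)[OF t0]) auto
        then obtain n0 where n0: "\<And>n. n \<ge> n0 \<Longrightarrow> t n < \<rho> - norm z"
          by (auto simp: eventually_at_top_linorder)
        have "2 * d \<le> (\<integral>x. w x * k n x \<partial>lebesgue)" if "n \<ge> n0" for n
        proof -
          let ?h = "t n *\<^sub>R i"
          have "norm ?h < \<rho> - norm z" using n0[OF that] i t(1)[of n] by simp
          then have "z + ?h \<in> cball 0 \<rho>" "z - ?h \<in> cball 0 \<rho>"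
            using norm_triangle_ineq[of z ?h] norm_triangle_ineq4[of z ?h] by auto
          from z(2)[OF this(1)] z(2)[OF this(2)]
          have "d * ((norm (z + ?h))\<^sup>2 + (norm (z - ?h))\<^sup>2 - 2 * (norm z)\<^sup>2) \<le> W (z + ?h) + W (z - ?h) - 2 * W z"
            by (simp add: algebra_simps)
          moreover have "(norm (z + ?h))\<^sup>2 + (norm (z - ?h))\<^sup>2 - 2 * (norm z)\<^sup>2 = 2 * (t n)\<^sup>2"
            unfolding power2_norm_eq_inner using i
            by (simp add: algebra_simps power2_eq_square inner_commute inner_Basis)
          moreover have "W (z + ?h) + W (z - ?h) - 2 * W z = (t n)\<^sup>2 * (\<integral>x. w x * k n x \<partial>lebesgue)"
          proof -
            note ints = integrable_mult_test[OF lw tr]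
            have "W (z + ?h) + W (z - ?h) - 2 * W z =
              (\<integral>x. (w x * \<phi> (x - (z + ?h)) + w x * \<phi> (x - (z - ?h))) - 2 * (w x * \<phi> (x - z)) \<partial>lebesgue)"
              unfolding W_def using ints[of "z + ?h"] ints[of "z - ?h"] ints[of z] by simp
            also have "\<dots> = (\<integral>x. (t n)\<^sup>2 * (w x * k n x) \<partial>lebesgue)"
              unfolding k_def t1 using t(1)[of n]
              by (intro Bochner_Integration.integral_cong) (auto simp: field_simps)
            finally show ?thesis by simp
          qed
          ultimately have "(t n)\<^sup>2 * (2 * d) \<le> (t n)\<^sup>2 * (\<integral>x. w x * k n x \<partial>lebesgue)"
            by (simp add: mult_ac)
          then show ?thesis
            using t(1)[of n] by (simp add: mult_le_cancel_left)
        qed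
        then show ?thesis by blast
      qed
      ultimately show ?thesis by (rule LIMSEQ_le_const)
    qed
    have lap_tr: "laplacian (\<lambda>x. \<phi> (x - z)) = (\<lambda>x. laplacian \<phi> (x - z))"
      unfolding laplacian_def
      by (intro ext sum.cong refl) (simp add: partial_translate s\<phi> smooth_partial)
    \<comment> \<open>This strictness is what the quadratic correction is for: when
      \<open>a = 0\<close>, a plain minimum of \<open>W\<close> would give no contradiction.\<close>
    have "0 < (\<Sum>i\<in>(Basis::'a set). 2 * d)"
      using \<open>d > 0\<close> by (simp)
    also have "\<dots> \<le> (\<Sum>i\<in>Basis. \<integral>x. w x * partial i (partial i \<phi>) (x - z) \<partial>lebesgue)"
      by (intro sum_mono lap)
    also have "\<dots> = (\<integral>x. w x * laplacian (\<lambda>x. \<phi> (x - z)) x \<partial>lebesgue)"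
      unfolding lap_tr laplacian_def sum_distrib_left
      by (rule Bochner_Integration.integral_sum[symmetric])
        (auto intro!: integrable_mult_test lw test_function_translate test_function_partial \<phi>)
    also have "\<dots> \<le> a * W z"
      using super tr[of z] pos by (simp add: supersolution_def W_def)
    also have "\<dots> \<le> 0"
      using \<open>a \<ge> 0\<close> Wz dz \<open>m > 0\<close> by (intro mult_nonneg_nonpos) auto
    finally show False by simp
  qed
  then show "0 \<le> (\<integral>x. w x * \<phi> x \<partial>lebesgue)"
    by (simp add: W_def)
qed

section \<open>Strict positivity of supersolutions\<close>

lemma supersolutionD:
  assumes "supersolution a w" "test_function \<phi>" "\<And>x. 0 \<le> \<phi> x"
  shows "(\<integral>x. w x * laplacian \<phi> x \<partial>lebesgue) \<le> a * (\<integral>x. w x * \<phi> x \<partial>lebesgue)"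
  using assms by (auto simp: supersolution_def)

section \<open>Dilated bumps and their dependence on the squared radius\<close>

lemma paraboloid_scale_derivative:
  assumes "t \<noteq> 0"
  shows "((\<lambda>t. paraboloid c (c / t) z x) has_real_derivative c / t\<^sup>2 * (norm (x - z))\<^sup>2) (at t)"
  unfolding paraboloid_def using assms
  by (auto intro!: derivative_eq_intros simp: field_simps power2_eq_square)

text \<open>The quadratic factor is harmless: where the squared distance is below \<open>t\<close>
  it is at most \<open>c / t\<close>, and elsewhere the bump vanishes.\<close>

lemma bump_scale_bound:
  assumes "0 < t" "0 < c" and M: "\<And>s. s \<le> c \<Longrightarrow> \<bar>bump_seq j s\<bar> \<le> M"
  shows "\<bar>bump_seq j (paraboloid c (c / t) z x) * (c / t\<^sup>2 * (norm (x - z))\<^sup>2)\<bar> \<le> M * (c / t)"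
proof (cases "(norm (x - z))\<^sup>2 < t")
  case True
  have "M \<ge> 0" using M[of c] by linarith
  have "c / t\<^sup>2 * (norm (x - z))\<^sup>2 \<le> c / t\<^sup>2 * t"
    using assms True by (intro mult_left_mono) auto
  also have "\<dots> = c / t" using assms by (simp add: power2_eq_square)
  finally have "c / t\<^sup>2 * (norm (x - z))\<^sup>2 \<le> c / t" .
  moreover have "paraboloid c (c / t) z x \<le> c"
    using assms by (simp add: paraboloid_def)
  ultimately show ?thesis
    unfolding abs_mult[of "bump_seq _ _"] using assms \<open>M \<ge> 0\<close> by (intro mult_mono M) auto
next
  case False
  have "M \<ge> 0" using M[of c] by linarith
  have "paraboloid c (c / t) z x \<le> 0"
    using False assms by (simp add: paraboloid_def field_simps)
  then show ?thesis using assms \<open>M \<ge> 0\<close> by (simp add: bump_seq_nonpos)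
qed

lemma paraboloid_far:
  assumes "0 < t" "t < S" "0 < c" "norm x > norm z + sqrt S"
  shows "paraboloid c (c / t) z x \<le> 0"
proof -
  have "sqrt S \<le> norm (x - z)"
    using assms norm_triangle_ineq2[of x z] by linarith
  then have "S \<le> (norm (x - z))\<^sup>2" by (rule sqrt_le_D)
  then have "t \<le> (norm (x - z))\<^sup>2" using assms by linarith
  then show ?thesis using assms by (simp add: paraboloid_def field_simps)
qed

lemma bump_integral_derivative:
  fixes w :: "'a::euclidean_space \<Rightarrow> real"
  assumes w: "locally_integrable w" and "0 < A" "0 < c"
  shows "((\<lambda>t. \<integral>x. w x * bump_seq j (paraboloid c (c / t) z x) \<partial>lebesgue) has_real_derivative
    (\<integral>x. w x * (bump_seq (Suc j) (paraboloid c (c / A) z x) * (c / A\<^sup>2 * (norm (x - z))\<^sup>2)) \<partial>lebesgue)) (at A)"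
proof -
  let ?b = "\<lambda>t x. bump_seq j (paraboloid c (c / t) z x)"
  let ?b' = "\<lambda>t x. bump_seq (Suc j) (paraboloid c (c / t) z x) * (c / t\<^sup>2 * (norm (x - z))\<^sup>2)"
  obtain M where M: "M > 0" "\<And>s. s \<le> c \<Longrightarrow> \<bar>bump_seq (Suc j) s\<bar> \<le> M"
    using bump_seq_bounded[of c "Suc j"] by blast
  have D: "((\<lambda>t. ?b t x) has_real_derivative ?b' t x) (at t)" if "t > 0" for t x
    using that by (intro DERIV_chain2[OF bump_seq_has_derivative paraboloid_scale_derivative]) auto
  \<comment> \<open>On this neighbourhood the supports stay in the ball of radius
    \<open>sqrt (2 * A)\<close> about \<open>z\<close>, and the derivatives in \<open>t\<close> stay
    below \<open>M * (c / (A / 2))\<close>; both are uniform, as dominated convergence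
    demands.\<close>
  let ?S = "{A / 2<..<2 * A}"
  let ?F = "\<lambda>t. \<integral>x. w x * ?b t x \<partial>lebesgue"
  have tb: "test_function (?b t)" if "t > 0" for t
    using that \<open>0 < c\<close> by (intro test_function_bump) auto
  have "((\<lambda>t. (?F t - ?F A) / (t - A)) \<longlongrightarrow> (\<integral>x. w x * ?b' A x \<partial>lebesgue)) (at A within ?S)"
    unfolding tendsto_at_iff_sequentially comp_def
  proof (intro allI impI)
    fix X assume "\<forall>i. X i \<in> ?S - {A}" and XA: "X \<longlonglongrightarrow> A"
    then have X: "A / 2 < X n" "X n < 2 * A" "X n \<noteq> A" for n by auto
    have X0: "X n > 0" for n using X(1)[of n] \<open>0 < A\<close> by linarith
    have "(\<lambda>n. \<integral>x. w x * ((?b (X n) x - ?b A x) / (X n - A)) \<partial>lebesgue) \<longlonglongrightarrow> (\<integral>x. w x * ?b' A x \<partial>lebesgue)"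
    proof (rule tendsto_integral_mult_cball[OF w, where M = "M * (c / (A / 2))" and R = "norm z + sqrt (2 * A)"])
      show "(\<lambda>x. (?b (X n) x - ?b A x) / (X n - A)) \<in> borel_measurable lebesgue" for n
        using X0[of n] \<open>0 < A\<close>
        by (intro borel_measurable_divide borel_measurable_diff borel_measurable_const test_function_measurable tb)
      show "\<bar>(?b (X n) x - ?b A x) / (X n - A)\<bar> \<le> M * (c / (A / 2))" for n x
      proof -
        have quot: "(v - u) / (q - p) = d" if "u - v = (p - q) * d" "p \<noteq> q" for u v p q d :: real
          using that by (simp add: field_simps)
        have "\<exists>t. A / 2 < t \<and> (?b (X n) x - ?b A x) / (X n - A) = ?b' t x"
        proof (cases "X n < A")
          case True
          then obtain t where "X n < t" "?b A x - ?b (X n) x = (A - X n) * ?b' t x"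
            using MVT2[of "X n" A "\<lambda>t. ?b t x" "\<lambda>t. ?b' t x"] D X0[of n] by (meson less_le_trans)
          then have "(?b (X n) x - ?b A x) / (X n - A) = ?b' t x"
            using True by (intro quot) auto
          then show ?thesis using X(1)[of n] \<open>X n < t\<close> by (meson less_trans)
        next
          case False
          then have "A < X n" using X(3)[of n] by simp
          then obtain t where "A < t" "?b (X n) x - ?b A x = (X n - A) * ?b' t x"
            using MVT2[of A "X n" "\<lambda>t. ?b t x" "\<lambda>t. ?b' t x"] D \<open>0 < A\<close> by (meson less_le_trans)
          then have "(?b (X n) x - ?b A x) / (X n - A) = ?b' t x" "A / 2 < t"
            using \<open>A < X n\<close> \<open>A < t\<close> \<open>0 < A\<close> by auto
          then show ?thesis by blast
        qed
        then obtain t where t: "A / 2 < t" "(?b (X n) x - ?b A x) / (X n - A) = ?b' t x" by blast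
        have "0 < t" using t(1) \<open>0 < A\<close> by linarith
        then have "\<bar>?b' t x\<bar> \<le> M * (c / t)"
          using \<open>0 < c\<close> M(2) by (rule bump_scale_bound)
        also have "\<dots> \<le> M * (c / (A / 2))"
          using t(1) \<open>0 < A\<close> \<open>0 < c\<close> M(1) by (intro mult_left_mono divide_left_mono) auto
        finally show ?thesis using t(2) by simp
      qed
      show "(?b (X n) x - ?b A x) / (X n - A) = 0" if "norm x > norm z + sqrt (2 * A)" for n x
        using paraboloid_far[OF X0 X(2) \<open>0 < c\<close> that, of n] paraboloid_far[of A "2 * A" c z x] that \<open>0 < A\<close> \<open>0 < c\<close>
        by (simp add: bump_seq_nonpos)
      show "(\<lambda>n. (?b (X n) x - ?b A x) / (X n - A)) \<longlonglongrightarrow> ?b' A x" for x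
      proof -
        have "((\<lambda>t. (?b t x - ?b A x) / (t - A)) \<longlongrightarrow> ?b' A x) (at A)"
          using D[OF \<open>0 < A\<close>] by (simp only: has_field_derivative_iff)
        moreover have "filterlim X (at A) sequentially"
          unfolding filterlim_at using XA X(3) by auto
        ultimately show ?thesis by (rule filterlim_compose)
      qed
    qed
    moreover have "(\<integral>x. w x * ((?b (X n) x - ?b A x) / (X n - A)) \<partial>lebesgue) = (?F (X n) - ?F A) / (X n - A)" for n
    proof -
      have "(\<integral>x. w x * ((?b (X n) x - ?b A x) / (X n - A)) \<partial>lebesgue)
          = (\<integral>x. (w x * ?b (X n) x - w x * ?b A x) / (X n - A) \<partial>lebesgue)"
        by (simp add: algebra_simps)
      also have "\<dots> = (?F (X n) - ?F A) / (X n - A)"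
        using integrable_mult_test[OF w tb[OF X0]] integrable_mult_test[OF w tb[OF \<open>0 < A\<close>]] by simp
      finally show ?thesis .
    qed
    ultimately show "(\<lambda>n. (?F (X n) - ?F A) / (X n - A)) \<longlonglongrightarrow> (\<integral>x. w x * ?b' A x \<partial>lebesgue)"
      by (simp only:)
  qed
  moreover have "at A within ?S = at A"
    using \<open>0 < A\<close> by (intro at_within_open) auto
  ultimately show ?thesis
    by (simp add: has_field_derivative_iff)
qed

text \<open>The derivative of \<open>A \<mapsto> A\<^bsup>-N/2\<^esup> b (c - c |x - z|\<^sup>2 / A)\<close> is a positive multiple of the Laplacian
  of the same expression with \<open>b\<close> replaced by its antiderivative \<open>B\<close>, which is an admissible test
  function, and \<open>B \<le> c b\<close> because \<open>b\<close> is increasing.\<close>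

lemma bump_integral_growth:
  fixes w :: "'a::euclidean_space \<Rightarrow> real" and z :: 'a
  assumes w: "AE x in lebesgue. 0 \<le> w x" and super: "supersolution a w" and a: "0 \<le> a"
    and c: "0 < c" and st: "0 < s" "s \<le> t"
  defines "F \<equiv> \<lambda>t. \<integral>x. w x * bump_seq (Suc 0) (paraboloid c (c / t) z x) \<partial>lebesgue"
  shows "t powr (- real DIM('a) / 2) * exp (- a * t / 4) * F t
    \<le> s powr (- real DIM('a) / 2) * exp (- a * s / 4) * F s"
proof (rule DERIV_nonpos_imp_nonincreasing[OF st(2)])
  fix A assume "s \<le> A" "A \<le> t"
  then have "0 < A" using st by simp
  have lw: "locally_integrable w" using super by (simp add: supersolution_def)
  let ?N = "real DIM('a)"
  let ?q = "paraboloid c (c / A) z"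
  define J where "J = (\<integral>x. w x * (bump_seq (Suc (Suc 0)) (?q x) * (c / A\<^sup>2 * (norm (x - z))\<^sup>2)) \<partial>lebesgue)"
  have t: "test_function (\<lambda>x. bump_seq j (?q x))" for j
    using \<open>0 < A\<close> c by (intro test_function_bump) auto
  have int: "integrable lebesgue (\<lambda>x. w x * bump_seq j (?q x))" for j
    by (rule integrable_mult_test[OF lw t])
  have FJ: "(F has_real_derivative J) (at A)"
    unfolding F_def J_def by (rule bump_integral_derivative[OF lw \<open>0 < A\<close> c])
  \<comment> \<open>The second-order part is \<open>4 * c\<close> times the
    \<open>A\<close>-derivative of the bump, which is precisely the kernel in
    \<open>J\<close>.\<close>
  have lap: "laplacian (\<lambda>x. bump_seq 0 (?q x)) x =
      4 * c * (bump_seq (Suc (Suc 0)) (?q x) * (c / A\<^sup>2 * (norm (x - z))\<^sup>2)) - 2 * c / A * ?N * bump_seq (Suc 0) (?q x)" for x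
    unfolding laplacian_profile[of bump_seq, OF bump_seq_has_derivative]
    by (simp add: power2_eq_square)
  have intlap: "integrable lebesgue (\<lambda>x. w x * laplacian (\<lambda>x. bump_seq 0 (?q x)) x)"
    by (intro integrable_mult_test lw test_function_laplacian t)
  have "4 * c * J = (\<integral>x. w x * laplacian (\<lambda>x. bump_seq 0 (?q x)) x + 2 * c / A * ?N * (w x * bump_seq (Suc 0) (?q x)) \<partial>lebesgue)"
    unfolding J_def lap by (subst integral_mult_right_zero[symmetric]) (simp add: algebra_simps)
  also have "\<dots> = (\<integral>x. w x * laplacian (\<lambda>x. bump_seq 0 (?q x)) x \<partial>lebesgue) + 2 * c / A * ?N * F A"
    using intlap int by (subst Bochner_Integration.integral_add) (auto simp: F_def)
  also have "(\<integral>x. w x * laplacian (\<lambda>x. bump_seq 0 (?q x)) x \<partial>lebesgue) \<le> a * (\<integral>x. w x * bump_seq 0 (?q x) \<partial>lebesgue)"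
    by (intro supersolutionD super t bump_seq_0_bounds)
  also have "\<dots> \<le> a * (c * F A)"
  proof (rule mult_left_mono[OF _ a])
    have "(\<integral>x. w x * bump_seq 0 (?q x) \<partial>lebesgue) \<le> (\<integral>x. c * (w x * bump_seq (Suc 0) (?q x)) \<partial>lebesgue)"
    proof (rule integral_mono_AE)
      show "AE x in lebesgue. w x * bump_seq 0 (?q x) \<le> c * (w x * bump_seq (Suc 0) (?q x))"
        using w
      proof eventually_elim
        case (elim x)
        have "bump_seq 0 (?q x) \<le> c * bump_seq (Suc 0) (?q x)"
        proof (cases "?q x > 0")
          case True
          then have "bump_seq 0 (?q x) \<le> ?q x * bump_seq (Suc 0) (?q x)"
            by (rule bump_seq_0_bounds)
          also have "\<dots> \<le> c * bump_seq (Suc 0) (?q x)"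
            using c \<open>0 < A\<close> by (intro mult_right_mono bump_seq_1_bounds) (simp add: paraboloid_def)
          finally show ?thesis .
        qed (simp add: bump_seq_nonpos)
        then show ?case
          using mult_left_mono[OF _ elim] by (metis mult.left_commute)
      qed
    qed (use int in auto)
    then show "(\<integral>x. w x * bump_seq 0 (?q x) \<partial>lebesgue) \<le> c * F A"
      by (simp add: F_def)
  qed
  finally have "4 * c * J \<le> 4 * c * ((?N / (2 * A) + a / 4) * F A)"
    by (simp add: algebra_simps)
  then have J: "J - (?N / (2 * A) + a / 4) * F A \<le> 0"
    using c by (simp add: mult_le_cancel_left)
  \<comment> \<open>The integrating factor for
    \<open>F' \<le> (N / (2 A) + a / 4) F\<close>.\<close>
  let ?p = "A powr (- ?N / 2) * exp (- a * A / 4)"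
  have "((\<lambda>t. t powr (- ?N / 2)) has_real_derivative (- ?N / 2) * (A powr (- ?N / 2) / A)) (at A)"
    using has_real_derivative_powr[OF \<open>0 < A\<close>, of "- ?N / 2"] \<open>0 < A\<close> by (simp only: powr_diff powr_one)
  moreover have "((\<lambda>t. exp (- a * t / 4)) has_real_derivative exp (- a * A / 4) * (- a / 4)) (at A)"
    by (auto intro!: derivative_eq_intros)
  ultimately have "((\<lambda>t. t powr (- ?N / 2) * exp (- a * t / 4) * F t) has_real_derivative
      ?p * (J - (?N / (2 * A) + a / 4) * F A)) (at A)"
    by (rule DERIV_cong[OF DERIV_mult[OF DERIV_mult FJ]]) (simp add: algebra_simps)
  moreover have "?p * (J - (?N / (2 * A) + a / 4) * F A) \<le> 0"
    using J by (intro mult_nonneg_nonpos) auto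
  ultimately show "\<exists>y. ((\<lambda>t. t powr (- ?N / 2) * exp (- a * t / 4) * F t) has_real_derivative y) (at A) \<and> y \<le> 0"
    by blast
qed

text \<open>Taking \<open>A\<close> to be the square of the radius turns the factor \<open>A\<close>
  to the power \<open>-N/2\<close> into the inverse \<open>N\<close>-th power of the radius, and
  growing peaks replace bumps by balls. The exponential on the right is at most 1 and is dropped.
  For \<open>a = 0\<close> this is the classical decrease of ball averages of a superharmonic
  function.\<close>

lemma ball_mean_growth:
  fixes w :: "'a::euclidean_space \<Rightarrow> real"
  assumes w: "AE x in lebesgue. 0 \<le> w x" and super: "supersolution a w" and a: "0 \<le> a"
    and st: "0 < s" "s \<le> t"
  shows "exp (- a * t\<^sup>2 / 4) * (LINT x:ball z t|lebesgue. w x) / t ^ DIM('a)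
    \<le> (LINT x:ball z s|lebesgue. w x) / s ^ DIM('a)"
proof -
  have lw: "locally_integrable w" using super by (simp add: supersolution_def)
  have pw: "(r\<^sup>2) powr (- real DIM('a) / 2) = 1 / r ^ DIM('a)" if "r > 0" for r :: real
  proof -
    have "r\<^sup>2 = r powr 2" using that by (simp add: powr_numeral)
    then have "(r\<^sup>2) powr (- real DIM('a) / 2) = r powr (2 * (- real DIM('a) / 2))"
      by (simp only: powr_powr)
    also have "2 * (- real DIM('a) / 2) = - real DIM('a)" by simp
    also have "r powr \<dots> = 1 / r ^ DIM('a)"
      unfolding powr_minus_divide powr_realpow[OF that] ..
    finally show ?thesis .
  qed
  have le: "exp (- a * t\<^sup>2 / 4) * (\<integral>x. w x * ball_bump z t n x \<partial>lebesgue) / t ^ DIM('a)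
      \<le> exp (- a * s\<^sup>2 / 4) * (\<integral>x. w x * ball_bump z s n x \<partial>lebesgue) / s ^ DIM('a)" for n
    using bump_integral_growth[OF w super a, of "Suc n" "s\<^sup>2" "t\<^sup>2" z] st pw[of s] pw[of t]
    by (simp add: ball_bump_def power_mono)
  have lim: "(\<lambda>n. exp (- a * r\<^sup>2 / 4) * (\<integral>x. w x * ball_bump z r n x \<partial>lebesgue) / r ^ DIM('a))
      \<longlonglongrightarrow> exp (- a * r\<^sup>2 / 4) * (LINT x:ball z r|lebesgue. w x) / r ^ DIM('a)" if "r > 0" for r
    using tendsto_mult_right[OF ball_bump_tendsto[OF lw that, of z], of "exp (- a * r\<^sup>2 / 4) / r ^ DIM('a)"]
    by (simp add: mult_ac)
  have "exp (- a * t\<^sup>2 / 4) * (LINT x:ball z t|lebesgue. w x) / t ^ DIM('a)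
      \<le> exp (- a * s\<^sup>2 / 4) * (LINT x:ball z s|lebesgue. w x) / s ^ DIM('a)"
    by (rule LIMSEQ_le[OF lim lim]) (use st le in auto)
  also have "\<dots> \<le> 1 * (LINT x:ball z s|lebesgue. w x) / s ^ DIM('a)"
  proof (intro divide_right_mono mult_right_mono)
    show "0 \<le> (LINT x:ball z s|lebesgue. w x)"
      unfolding set_lebesgue_integral_def by (rule integral_nonneg_AE) (use w in \<open>auto simp: indicator_def\<close>)
  qed (use a st in auto)
  finally show ?thesis by simp
qed

lemma set_integrable_ball:
  "locally_integrable w \<Longrightarrow> set_integrable lebesgue (ball z r) w"
  unfolding locally_integrable_def
  by (rule set_integrable_subset[of _ "cball z r"]) auto

text \<open>Some ball about the origin carries positive mass \<open>I\<close>. The average over any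
  small ball inside \<open>ball 0 R\<close> dominates, up to a fixed factor, the average over the
  concentric ball of radius \<open>S\<close>, which contains that mass; a bound on all averages is a
  bound almost everywhere.\<close>

lemma supersolution_lower_bound:
  fixes w :: "'a::euclidean_space \<Rightarrow> real"
  assumes w: "AE x in lebesgue. 0 \<le> w x" and super: "supersolution a w" and a: "0 \<le> a"
    and nz: "\<not> (AE x in lebesgue. w x = 0)" and "R > 0"
  obtains c where "c > 0" "AE x in lebesgue. x \<in> ball 0 R \<longrightarrow> c \<le> w x"
proof -
  have lw: "locally_integrable w" using super by (simp add: supersolution_def)
  have mono: "(LINT x:ball y r|lebesgue. w x) \<le> (LINT x:ball z s|lebesgue. w x)"
    if "ball y r \<subseteq> ball z s" for y z r s
    unfolding set_lebesgue_integral_def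
  proof (rule integral_mono_AE)
    show "AE x in lebesgue. indicator (ball y r) x *\<^sub>R w x \<le> indicator (ball z s) x *\<^sub>R w x"
      using w by eventually_elim (use that in \<open>auto simp: indicator_def\<close>)
  qed (use set_integrable_ball[OF lw] in \<open>auto simp: set_integrable_def\<close>)
  have "\<exists>\<rho>>0. (LINT x:ball 0 \<rho>|lebesgue. w x) > 0"
  proof (rule ccontr)
    assume "\<not> ?thesis"
    then have *: "(LINT x:ball 0 \<rho>|lebesgue. w x) \<le> 0" if "\<rho> > 0" for \<rho>
      using that by (meson not_less)
    have "0 \<le> (LINT x:ball z r|lebesgue. (-1) * w x)" if "r > 0" for z r
    proof -
      have "(LINT x:ball z r|lebesgue. w x) \<le> (LINT x:ball 0 (norm z + r)|lebesgue. w x)"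
        by (rule mono) (simp add: subset_iff, smt (verit) norm_minus_commute norm_triangle_ineq2 dist_norm)
      also have "\<dots> \<le> 0" using that by (intro *) (simp add: add_nonneg_pos)
      finally show ?thesis by (simp only: set_integral_mult_right)
    qed
    then have "AE x in lebesgue. x \<in> UNIV \<longrightarrow> 0 \<le> (-1) * w x"
      by (intro AE_nonneg_if_balls locally_integrable_cmult lw) auto
    with w have "AE x in lebesgue. w x = 0"
      by eventually_elim simp
    with nz show False by simp
  qed
  then obtain \<rho> where \<rho>: "\<rho> > 0" "(LINT x:ball 0 \<rho>|lebesgue. w x) > 0" by blast
  define I where "I = (LINT x:ball 0 \<rho>|lebesgue. w x)"
  \<comment> \<open>Large enough for \<open>ball z S\<close> to contain \<open>ball 0 \<rho>\<close>
    for every centre of norm at most \<open>R\<close>.\<close>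
  define S where "S = R + \<rho>"
  define V where "V = unit_ball_vol (real DIM('a))"
  have "V > 0" by (simp add: V_def)
  have "S > 0" using \<open>R > 0\<close> \<rho> by (simp add: S_def)
  define k where "k = exp (- a * S\<^sup>2 / 4) * I / S ^ DIM('a)"
  have "k > 0" using \<rho> \<open>S > 0\<close> by (simp add: k_def I_def)
  have "AE x in lebesgue. x \<in> ball 0 R \<longrightarrow> 0 \<le> w x - k / V"
  proof (rule AE_nonneg_if_balls)
    show "locally_integrable (\<lambda>x. w x - k / V)"
      by (intro locally_integrable_diff lw locally_integrable_const)
    fix z :: 'a and s assume s: "s > 0" "ball z s \<subseteq> ball 0 R"
    then have "norm z + s \<le> R"
      by (auto simp: ball_subset_ball_iff)
    then have "s \<le> S" "norm z \<le> R" using \<rho> s norm_ge_zero[of z] unfolding S_def by linarith+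
    have "I \<le> (LINT x:ball z S|lebesgue. w x)"
      unfolding I_def using \<open>norm z \<le> R\<close> by (intro mono) (auto simp: ball_subset_ball_iff S_def)
    then have "k \<le> exp (- a * S\<^sup>2 / 4) * (LINT x:ball z S|lebesgue. w x) / S ^ DIM('a)"
      unfolding k_def using \<open>S > 0\<close> by (intro divide_right_mono mult_left_mono) auto
    also have "\<dots> \<le> (LINT x:ball z s|lebesgue. w x) / s ^ DIM('a)"
      by (rule ball_mean_growth[OF w super a s(1) \<open>s \<le> S\<close>])
    finally have "k * s ^ DIM('a) \<le> (LINT x:ball z s|lebesgue. w x)"
      using s by (simp add: field_simps)
    moreover have "(LINT x:ball z s|lebesgue. k / V) = k * s ^ DIM('a)"
      using s \<open>V > 0\<close> by (simp add: set_lebesgue_integral_def content_ball flip: V_def)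
    ultimately show "0 \<le> (LINT x:ball z s|lebesgue. w x - k / V)"
      by (subst set_integral_diff(2)) (auto intro!: set_integrable_ball lw locally_integrable_const)
  qed simp
  then show thesis
    using \<open>k > 0\<close> \<open>V > 0\<close> by (intro that[of "k / V"]) auto
qed

lemma strictly_positive_if_supersolution:
  fixes w :: "'a::euclidean_space \<Rightarrow> real"
  assumes w: "AE x in lebesgue. 0 \<le> w x" and super: "supersolution a w" and a: "0 \<le> a"
    and nz: "\<not> (AE x in lebesgue. w x = 0)"
  shows "strictly_positive w"
  unfolding strictly_positive_def
proof (intro conjI allI impI)
  have "AE x in lebesgue. x \<in> ball 0 (real (Suc n)) \<longrightarrow> 0 < w x" for n
    by (rule supersolution_lower_bound[OF w super a nz, of "real (Suc n)"])
      (auto elim!: eventually_mono)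
  then have "AE x in lebesgue. \<forall>n. x \<in> ball 0 (real (Suc n)) \<longrightarrow> 0 < w x"
    unfolding AE_all_countable by blast
  then show "AE x in lebesgue. 0 < w x"
  proof eventually_elim
    case (elim x)
    obtain n where "norm x < real n" using reals_Archimedean2 by blast
    then show ?case using elim[rule_format, of n] by simp
  qed
next
  fix v x assume v: "continuous_on UNIV v \<and> (AE x in lebesgue. v x = w x)"
  show "0 < v x"
  proof (rule ccontr)
    assume "\<not> 0 < v x"
    obtain c where c: "c > 0" "AE y in lebesgue. y \<in> ball 0 (norm x + 1) \<longrightarrow> c \<le> w y"
      by (rule supersolution_lower_bound[OF w super a nz, of "norm x + 1"])
        (simp add: add_nonneg_pos)
    \<comment> \<open>If \<open>v\<close> were not positive at \<open>x\<close>, it would stay below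
      \<open>c\<close> on an open neighbourhood, which has positive measure.\<close>
    define O' where "O' = {y. v y < c} \<inter> ball 0 (norm x + 1)"
    have "open O'"
      unfolding O'_def using v by (intro open_Int open_Collect_less continuous_intros) auto
    have "x \<in> O'" using \<open>\<not> 0 < v x\<close> c(1) by (simp add: O'_def)
    have "AE y in lebesgue. v y = w y" using v by simp
    with c(2) have "AE y in lebesgue. y \<notin> O'"
      by eventually_elim (auto simp: O'_def)
    then have "negligible O'"
      using \<open>open O'\<close> by (simp add: negligible_iff_null_sets AE_iff_null_sets)
    then show False
      using open_not_negligible[OF \<open>open O'\<close>] \<open>x \<in> O'\<close> by blast
  qed
qed

section \<open>Weak derivatives in the second-order Sobolev space\<close>

lemma L2_cmult: "u \<in> L2 \<Longrightarrow> (\<lambda>x. c * u x) \<in> L2"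
  by (auto simp: L2_def power_mult_distrib)

lemma L2_mult_integrable:
  assumes "u \<in> L2" "v \<in> L2" shows "integrable lebesgue (\<lambda>x. u x * v x)"
proof (rule Bochner_Integration.integrable_bound[of _ "\<lambda>x. (u x)\<^sup>2 + (v x)\<^sup>2"])
  show "integrable lebesgue (\<lambda>x. (u x)\<^sup>2 + (v x)\<^sup>2)"
    by (intro Bochner_Integration.integrable_add L2_integrable_square assms)
  show "(\<lambda>x. u x * v x) \<in> borel_measurable lebesgue"
    by (intro borel_measurable_times L2_measurable assms)
  have "\<bar>s * t\<bar> \<le> s\<^sup>2 + t\<^sup>2" for s t :: real
  proof -
    have "2 * \<bar>s * t\<bar> \<le> s\<^sup>2 + t\<^sup>2"
      using zero_le_power2[of "\<bar>s\<bar> - \<bar>t\<bar>"] by (simp add: power2_diff abs_mult)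
    then show ?thesis using abs_ge_zero[of "s * t"] by linarith
  qed
  then show "AE x in lebesgue. norm (u x * v x) \<le> norm ((u x)\<^sup>2 + (v x)\<^sup>2)"
    by auto
qed

lemma L2_add:
  assumes "u \<in> L2" "v \<in> L2" shows "(\<lambda>x. u x + v x) \<in> L2"
proof -
  have "integrable lebesgue (\<lambda>x. (u x)\<^sup>2 + 2 * (u x * v x) + (v x)\<^sup>2)"
    by (intro Bochner_Integration.integrable_add integrable_mult_right L2_integrable_square L2_mult_integrable assms)
  then have "integrable lebesgue (\<lambda>x. (u x + v x)\<^sup>2)"
    by (simp add: power2_sum algebra_simps)
  then show ?thesis
    using assms by (auto simp: L2_def intro: borel_measurable_add)
qed

lemma L2_zero: "(\<lambda>x. 0) \<in> L2"
  by (simp add: L2_def)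

lemma L2_sum: "(\<And>i. i \<in> I \<Longrightarrow> f i \<in> L2) \<Longrightarrow> (\<lambda>x. \<Sum>i\<in>I. f i x) \<in> L2"
  by (induction I rule: infinite_finite_induct) (auto intro: L2_add L2_zero)

lemma L2_test_function: "test_function \<phi> \<Longrightarrow> \<phi> \<in> L2"
  using integrable_test[OF test_function_mult[of \<phi> \<phi>]]
  by (simp add: L2_def test_function_measurable test_function_smooth power2_eq_square)

lemma L2_AE_cong:
  assumes "u \<in> L2" "AE x in lebesgue. u x = v x" "v \<in> borel_measurable lebesgue"
  shows "v \<in> L2"
proof -
  have "integrable lebesgue (\<lambda>x. \<bar>v x\<bar>\<^sup>2) \<longleftrightarrow> integrable lebesgue (\<lambda>x. \<bar>u x\<bar>\<^sup>2)"
    using assms by (intro integrable_cong_AE) (auto simp: L2_def)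
  then show ?thesis using assms by (simp add: L2_def)
qed

lemma weak_derivative_add:
  assumes "weak_derivative is u v" "weak_derivative is u' v'" "set is \<subseteq> Basis"
  shows "weak_derivative is (\<lambda>x. u x + u' x) (\<lambda>x. v x + v' x)"
proof -
  have *: "(\<integral>x. (f x + g x) * \<psi> x \<partial>lebesgue) = (\<integral>x. f x * \<psi> x \<partial>lebesgue) + (\<integral>x. g x * \<psi> x \<partial>lebesgue)"
    if "locally_integrable f" "locally_integrable g" "test_function \<psi>" for f g \<psi> :: "'a \<Rightarrow> real"
    using integrable_mult_test[OF that(1,3)] integrable_mult_test[OF that(2,3)]
    by (simp add: distrib_right)
  show ?thesis
    using assms unfolding weak_derivative_def
    by (auto simp: * foldr_partial_test_function distrib_left intro: locally_integrable_add)
qed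

lemma weak_derivative_cmult:
  "weak_derivative is u v \<Longrightarrow> weak_derivative is (\<lambda>x. c * u x) (\<lambda>x. c * v x)"
  unfolding weak_derivative_def
  by (auto simp: mult.assoc intro: locally_integrable_cmult)

lemma wderiv_weak_derivative: "weak_derivative is u v \<Longrightarrow> weak_derivative is u (wderiv is u)"
  unfolding wderiv_def by (rule someI[where P = "weak_derivative is u"])

lemma wderiv_AE_eq: "weak_derivative is u v \<Longrightarrow> AE x in lebesgue. wderiv is u x = v x"
  using weak_derivative_unique wderiv_weak_derivative by blast

lemma weak_derivative_measurable: "weak_derivative is u v \<Longrightarrow> v \<in> borel_measurable lebesgue"
  by (auto simp: weak_derivative_def intro: locally_integrable_measurable)

text \<open>\<open>wderiv\<close> is an arbitrary choice among the weak derivatives; uniqueness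
  almost everywhere transfers square integrability to it from the derivative that the space
  provides.\<close>

lemma sobolev_H_wderiv:
  assumes "u \<in> sobolev_H k" "set is \<subseteq> Basis" "length is \<le> k"
  shows "weak_derivative is u (wderiv is u)" "wderiv is u \<in> L2"
proof -
  obtain v where v: "v \<in> L2" "weak_derivative is u v"
    using assms unfolding sobolev_H_def by blast
  show w: "weak_derivative is u (wderiv is u)"
    using v(2) by (rule wderiv_weak_derivative)
  show "wderiv is u \<in> L2"
    by (rule L2_AE_cong[OF v(1) weak_derivative_unique[OF v(2) w] weak_derivative_measurable[OF w]])
qed

lemma sobolev_H_L2: "u \<in> sobolev_H k \<Longrightarrow> u \<in> L2"
  by (simp add: sobolev_H_def)

lemma sobolev_H_add_test:
  assumes "u \<in> sobolev_H k" "test_function \<phi>"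
  shows "(\<lambda>x. c * (u x + t * \<phi> x)) \<in> sobolev_H k"
  unfolding sobolev_H_def
proof (intro CollectI conjI allI impI)
  show "(\<lambda>x. c * (u x + t * \<phi> x)) \<in> L2"
    using assms by (intro L2_cmult L2_add L2_test_function sobolev_H_L2)
  fix "is" :: "'a list" assume i: "set is \<subseteq> Basis \<and> length is \<le> k"
  show "\<exists>v\<in>L2. weak_derivative is (\<lambda>x. c * (u x + t * \<phi> x)) v"
  proof
    show "weak_derivative is (\<lambda>x. c * (u x + t * \<phi> x))
        (\<lambda>x. c * (wderiv is u x + t * foldr partial (rev is) \<phi> x))"
      using assms i by (intro weak_derivative_cmult weak_derivative_add sobolev_H_wderiv
          weak_derivative_test_function) auto
    show "(\<lambda>x. c * (wderiv is u x + t * foldr partial (rev is) \<phi> x)) \<in> L2"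
      using assms i by (intro L2_cmult L2_add L2_test_function sobolev_H_wderiv
          foldr_partial_test_function) auto
  qed
qed

lemma sobolev_H_zero: "(\<lambda>x. 0) \<in> sobolev_H k"
  unfolding sobolev_H_def weak_derivative_def
  using L2_zero locally_integrable_const[of 0] by auto

lemma norm_weak_gradient: "(norm (weak_gradient u x))\<^sup>2 = (\<Sum>i\<in>Basis. (wderiv [i] u x)\<^sup>2)"
proof -
  have "weak_gradient u x \<bullet> i = wderiv [i] u x" if "i \<in> Basis" for i
    using that by (simp add: weak_gradient_def inner_sum_left inner_Basis if_distrib cong: if_cong)
  then show ?thesis
    unfolding power2_norm_eq_inner
    using euclidean_inner[of "weak_gradient u x" "weak_gradient u x"]
    by (simp add: power2_eq_square)
qed

lemma weak_laplacian_L2: "u \<in> sobolev_H 2 \<Longrightarrow> weak_laplacian u \<in> L2"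
  unfolding weak_laplacian_def[abs_def] by (intro L2_sum sobolev_H_wderiv) auto

lemma weak_gradient_integrable:
  "u \<in> sobolev_H 2 \<Longrightarrow> integrable lebesgue (\<lambda>x. (norm (weak_gradient u x))\<^sup>2)"
  unfolding norm_weak_gradient
  by (intro Bochner_Integration.integrable_sum L2_integrable_square sobolev_H_wderiv) auto

text \<open>Both identities unfold the definition of weak derivatives, the second with
  \<open>partial i \<phi>\<close> as test function for the first derivative; products of two Sobolev
  functions never have to be integrated by parts.\<close>

lemma weak_laplacian_test:
  assumes u: "u \<in> sobolev_H 2" and \<phi>: "test_function \<phi>"
  shows "(\<integral>x. u x * laplacian \<phi> x \<partial>lebesgue) = (\<integral>x. weak_laplacian u x * \<phi> x \<partial>lebesgue)"
    and "(\<Sum>i\<in>Basis. \<integral>x. wderiv [i] u x * partial i \<phi> x \<partial>lebesgue) =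
      - (\<integral>x. weak_laplacian u x * \<phi> x \<partial>lebesgue)"
proof -
  have li: "locally_integrable (wderiv is u)" "locally_integrable u" if "set is \<subseteq> Basis" "length is \<le> 2" for "is"
    using sobolev_H_wderiv(1)[OF u that] by (auto simp: weak_derivative_def)
  have 2: "(\<integral>x. u x * partial i (partial i \<phi>) x \<partial>lebesgue) = (\<integral>x. wderiv [i, i] u x * \<phi> x \<partial>lebesgue)"
    if "i \<in> Basis" for i
    using sobolev_H_wderiv(1)[OF u, of "[i, i]"] \<phi> that by (simp add: weak_derivative_def)
  have 1: "(\<integral>x. u x * partial i (partial i \<phi>) x \<partial>lebesgue) = - (\<integral>x. wderiv [i] u x * partial i \<phi> x \<partial>lebesgue)"
    if "i \<in> Basis" for i
    using sobolev_H_wderiv(1)[OF u, of "[i]"] test_function_partial[OF \<phi> that] that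
    by (simp add: weak_derivative_def)
  have s: "(\<integral>x. u x * laplacian \<phi> x \<partial>lebesgue) = (\<Sum>i\<in>Basis. \<integral>x. u x * partial i (partial i \<phi>) x \<partial>lebesgue)"
    unfolding laplacian_def sum_distrib_left
    by (rule Bochner_Integration.integral_sum)
      (auto intro!: integrable_mult_test li(2)[of "[]"] test_function_partial \<phi>)
  have w: "(\<integral>x. weak_laplacian u x * \<phi> x \<partial>lebesgue) = (\<Sum>i\<in>Basis. \<integral>x. wderiv [i, i] u x * \<phi> x \<partial>lebesgue)"
    unfolding weak_laplacian_def sum_distrib_right
    by (rule Bochner_Integration.integral_sum) (auto intro!: integrable_mult_test li \<phi>)
  show "(\<integral>x. u x * laplacian \<phi> x \<partial>lebesgue) = (\<integral>x. weak_laplacian u x * \<phi> x \<partial>lebesgue)"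
    unfolding s w by (intro sum.cong refl 2)
  show "(\<Sum>i\<in>Basis. \<integral>x. wderiv [i] u x * partial i \<phi> x \<partial>lebesgue) = - (\<integral>x. weak_laplacian u x * \<phi> x \<partial>lebesgue)"
    unfolding w sum_negf[symmetric] using 1 2 by (intro sum.cong refl) simp
qed

section \<open>Twice the quadratic part of the energy, and competitors of prescribed mass\<close>

definition bending :: "real \<Rightarrow> ('a::euclidean_space \<Rightarrow> real) \<Rightarrow> real" where
  "bending \<beta> u = (\<integral>x. (weak_laplacian u x)\<^sup>2 \<partial>lebesgue)
    + \<beta> * (\<integral>x. (norm (weak_gradient u x))\<^sup>2 \<partial>lebesgue)"

text \<open>The competitor is a rescaled perturbation, so the form is \<open>c^2\<close> times a
  quadratic polynomial in \<open>t\<close>. The mixed gradient term is rewritten through the weak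
  Laplacian, whence the minus sign before \<beta>.\<close>

lemma bending_add_test:
  assumes u: "u \<in> sobolev_H 2" and \<phi>: "test_function \<phi>"
  shows "bending \<beta> (\<lambda>x. c * (u x + t * \<phi> x)) = c\<^sup>2 * (bending \<beta> u
    + 2 * t * ((\<integral>x. weak_laplacian u x * laplacian \<phi> x \<partial>lebesgue)
        - \<beta> * (\<integral>x. weak_laplacian u x * \<phi> x \<partial>lebesgue))
    + t\<^sup>2 * ((\<integral>x. (laplacian \<phi> x)\<^sup>2 \<partial>lebesgue)
        + \<beta> * (\<Sum>i\<in>Basis. \<integral>x. (partial i \<phi> x)\<^sup>2 \<partial>lebesgue)))"
proof -
  let ?w = "\<lambda>x. c * (u x + t * \<phi> x)"
  have ae: "AE x in lebesgue. wderiv is ?w x = c * (wderiv is u x + t * foldr partial (rev is) \<phi> x)"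
    if "set is \<subseteq> Basis" "length is \<le> 2" for "is"
    using that assms
    by (intro wderiv_AE_eq weak_derivative_cmult weak_derivative_add sobolev_H_wderiv
        weak_derivative_test_function) auto
  have w2: "?w \<in> sobolev_H 2" using u \<phi> by (rule sobolev_H_add_test)
  have expand: "(\<integral>x. (c * (f x + t * \<psi> x))\<^sup>2 \<partial>lebesgue) = c\<^sup>2 * ((\<integral>x. (f x)\<^sup>2 \<partial>lebesgue)
      + 2 * t * (\<integral>x. f x * \<psi> x \<partial>lebesgue) + t\<^sup>2 * (\<integral>x. (\<psi> x)\<^sup>2 \<partial>lebesgue))"
    if "f \<in> L2" "test_function \<psi>" for f \<psi> :: "'a \<Rightarrow> real"
  proof -
    have "(\<integral>x. (c * (f x + t * \<psi> x))\<^sup>2 \<partial>lebesgue)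
        = (\<integral>x. c\<^sup>2 * ((f x)\<^sup>2 + 2 * t * (f x * \<psi> x) + t\<^sup>2 * (\<psi> x)\<^sup>2) \<partial>lebesgue)"
      by (intro Bochner_Integration.integral_cong refl) (simp add: power2_eq_square algebra_simps)
    also have "\<dots> = c\<^sup>2 * ((\<integral>x. (f x)\<^sup>2 \<partial>lebesgue)
      + 2 * t * (\<integral>x. f x * \<psi> x \<partial>lebesgue) + t\<^sup>2 * (\<integral>x. (\<psi> x)\<^sup>2 \<partial>lebesgue))"
      using L2_integrable_square[OF that(1)] L2_integrable_square[OF L2_test_function[OF that(2)]]
        L2_mult_integrable[OF that(1) L2_test_function[OF that(2)]] by simp
    finally show ?thesis .
  qed
  have "AE x in lebesgue. \<forall>i\<in>Basis. wderiv [i, i] ?w x = c * (wderiv [i, i] u x + t * partial i (partial i \<phi>) x)"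
    using ae[of "[i, i]" for i] by (intro AE_finite_allI) auto
  then have "AE x in lebesgue. weak_laplacian ?w x = c * (weak_laplacian u x + t * laplacian \<phi> x)"
    by eventually_elim (simp add: weak_laplacian_def laplacian_def sum.distrib sum_distrib_left distrib_left)
  then have L: "(\<integral>x. (weak_laplacian ?w x)\<^sup>2 \<partial>lebesgue) = (\<integral>x. (c * (weak_laplacian u x + t * laplacian \<phi> x))\<^sup>2 \<partial>lebesgue)"
    using L2_measurable[OF weak_laplacian_L2[OF u]] L2_measurable[OF weak_laplacian_L2[OF w2]]
      test_function_measurable[OF test_function_laplacian[OF \<phi>]]
    by (intro integral_cong_AE borel_measurable_power borel_measurable_times borel_measurable_add
        borel_measurable_const) auto
  have G: "(\<integral>x. (norm (weak_gradient v x))\<^sup>2 \<partial>lebesgue) = (\<Sum>i\<in>Basis. \<integral>x. (wderiv [i] v x)\<^sup>2 \<partial>lebesgue)"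
    if "v \<in> sobolev_H 2" for v :: "'a \<Rightarrow> real"
    unfolding norm_weak_gradient
    using that by (intro Bochner_Integration.integral_sum L2_integrable_square sobolev_H_wderiv) auto
  have Gi: "(\<integral>x. (wderiv [i] ?w x)\<^sup>2 \<partial>lebesgue) = (\<integral>x. (c * (wderiv [i] u x + t * partial i \<phi> x))\<^sup>2 \<partial>lebesgue)"
    if "i \<in> Basis" for i
    using ae[of "[i]"] that L2_measurable[OF sobolev_H_wderiv(2)[OF u, of "[i]"]]
      L2_measurable[OF sobolev_H_wderiv(2)[OF w2, of "[i]"]]
      test_function_measurable[OF test_function_partial[OF \<phi> that]]
    by (intro integral_cong_AE borel_measurable_power borel_measurable_times borel_measurable_add
        borel_measurable_const) auto
  have "bending \<beta> ?w = (\<integral>x. (c * (weak_laplacian u x + t * laplacian \<phi> x))\<^sup>2 \<partial>lebesgue)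
      + \<beta> * (\<Sum>i\<in>Basis. \<integral>x. (c * (wderiv [i] u x + t * partial i \<phi> x))\<^sup>2 \<partial>lebesgue)"
    unfolding bending_def L G[OF w2] by (simp add: Gi cong: sum.cong)
  also have "\<dots> = c\<^sup>2 * ((\<integral>x. (weak_laplacian u x)\<^sup>2 \<partial>lebesgue)
      + 2 * t * (\<integral>x. weak_laplacian u x * laplacian \<phi> x \<partial>lebesgue) + t\<^sup>2 * (\<integral>x. (laplacian \<phi> x)\<^sup>2 \<partial>lebesgue))
      + \<beta> * (\<Sum>i\<in>Basis. c\<^sup>2 * ((\<integral>x. (wderiv [i] u x)\<^sup>2 \<partial>lebesgue)
      + 2 * t * (\<integral>x. wderiv [i] u x * partial i \<phi> x \<partial>lebesgue) + t\<^sup>2 * (\<integral>x. (partial i \<phi> x)\<^sup>2 \<partial>lebesgue)))"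
    using \<phi> by (subst expand) (auto intro!: weak_laplacian_L2 u test_function_laplacian
        test_function_partial sobolev_H_wderiv sum.cong expand)
  also have "(\<Sum>i\<in>Basis. c\<^sup>2 * ((\<integral>x. (wderiv [i] u x)\<^sup>2 \<partial>lebesgue)
      + 2 * t * (\<integral>x. wderiv [i] u x * partial i \<phi> x \<partial>lebesgue) + t\<^sup>2 * (\<integral>x. (partial i \<phi> x)\<^sup>2 \<partial>lebesgue)))
    = c\<^sup>2 * ((\<integral>x. (norm (weak_gradient u x))\<^sup>2 \<partial>lebesgue) + 2 * t * (- (\<integral>x. weak_laplacian u x * \<phi> x \<partial>lebesgue))
      + t\<^sup>2 * (\<Sum>i\<in>Basis. \<integral>x. (partial i \<phi> x)\<^sup>2 \<partial>lebesgue))"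
    unfolding G[OF u] weak_laplacian_test(2)[OF u \<phi>, symmetric]
    by (simp add: sum.distrib sum_distrib_left distrib_left)
  finally show ?thesis
    by (simp add: bending_def algebra_simps)
qed

lemma energy_bending:
  "energy \<sigma> \<beta> u = bending \<beta> u / 2 - (\<integral>x. \<bar>max (u x) 0\<bar> powr (2 * \<sigma> + 2) \<partial>lebesgue) / (2 * \<sigma> + 2)"
  by (simp add: energy_def bending_def algebra_simps)

lemma mass_constraint_normalize:
  assumes u: "u \<in> sobolev_H 2" and \<phi>: "test_function \<phi>" and "\<mu> > 0"
    and pos: "(\<integral>x. (u x + t * \<phi> x)\<^sup>2 \<partial>lebesgue) > 0"
  shows "(\<lambda>x. sqrt (\<mu> / (\<integral>x. (u x + t * \<phi> x)\<^sup>2 \<partial>lebesgue)) * (u x + t * \<phi> x)) \<in> mass_constraint \<mu>"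
  using assms sobolev_H_add_test[OF u \<phi>]
  by (simp add: mass_constraint_def power_mult_distrib)

section \<open>The infimum is nonpositive\<close>

lemma min_energy_le:
  "w \<in> mass_constraint \<mu> \<Longrightarrow> min_energy TYPE('a::euclidean_space) \<sigma> \<beta> \<mu> \<le> ereal (energy \<sigma> \<beta> (w :: 'a \<Rightarrow> real))"
  unfolding min_energy_def by (rule INF_lower)

text \<open>On a bump spread over radius \<open>r\<close>, every derivative costs a factor
  \<open>1/r\<close>, while the mass is comparable to the volume of the support. The true decay is
  quadratic in \<open>1/r\<close>; the cruder \<open>K / r\<close> is enough for a limit.\<close>

lemma spread_bump_bounds:
  fixes \<beta> :: real
  obtains K where "K > 0" "\<And>r. r \<ge> 1 \<Longrightarrow> \<exists>\<phi> :: 'a::euclidean_space \<Rightarrow> real. test_function \<phi> \<and>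
    (\<integral>x. (\<phi> x)\<^sup>2 \<partial>lebesgue) > 0 \<and>
    (\<integral>x. (laplacian \<phi> x)\<^sup>2 \<partial>lebesgue) + \<beta> * (\<Sum>i\<in>Basis. \<integral>x. (partial i \<phi> x)\<^sup>2 \<partial>lebesgue)
      \<le> K / r * (\<integral>x. (\<phi> x)\<^sup>2 \<partial>lebesgue)"
proof -
  let ?N = "DIM('a)"
  define V where "V = unit_ball_vol (real ?N)"
  have "V > 0" by (simp add: V_def)
  obtain M1 where M1: "M1 > 0" "\<And>t. t \<le> 1 \<Longrightarrow> \<bar>bump_seq (Suc (Suc 0)) t\<bar> \<le> M1"
    using bump_seq_bounded by blast
  obtain M2 where M2: "M2 > 0" "\<And>t. t \<le> 1 \<Longrightarrow> \<bar>bump_seq (Suc (Suc (Suc 0))) t\<bar> \<le> M2"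
    using bump_seq_bounded by blast
  define C1 where "C1 = 4 * M2 + 2 * ?N * M1"
  \<comment> \<open>On the half ball the paraboloid is at least \<open>1 - 1/4\<close>, so
    \<open>k\<close> bounds the bump from below there.\<close>
  define k where "k = bump_seq (Suc 0) (3 / 4)"
  have "k > 0" by (simp add: k_def bump_seq_1)
  \<comment> \<open>\<open>2 ^ N / k^2\<close> pays for estimating the mass on the half ball only,
    and \<beta> enters by its absolute value because its sign is open. \<open>C1\<close> comes from
    the radial formula for the Laplacian with \<open>b |x|^2 \<le> 1\<close>.\<close>
  define K where "K = (C1\<^sup>2 + \<bar>\<beta>\<bar> * (4 * M1\<^sup>2)) * 2 ^ ?N / k\<^sup>2"
  have "C1 > 0" using M1 M2 by (simp add: C1_def add_pos_nonneg)
  have "K > 0" using \<open>C1 > 0\<close> \<open>k > 0\<close> by (simp add: K_def add_pos_nonneg)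
  show thesis
  proof (rule that[OF \<open>K > 0\<close>])
    fix r :: real assume "r \<ge> 1"
    then have "r > 0" by simp
    define b where "b = 1 / r\<^sup>2"
    have "b > 0" using \<open>r > 0\<close> by (simp add: b_def)
    have "r\<^sup>2 \<ge> 1" using \<open>r \<ge> 1\<close> by simp
    then have "b \<le> 1" using \<open>r > 0\<close> by (simp add: b_def divide_le_eq)
    have "b \<le> 1 / r" using \<open>r \<ge> 1\<close> by (simp add: b_def power2_eq_square field_simps)
    let ?q = "paraboloid 1 b (0::'a)"
    define \<phi> :: "'a \<Rightarrow> real" where "\<phi> x = bump_seq (Suc 0) (?q x)" for x
    have \<phi>: "test_function \<phi>"
      unfolding \<phi>_def[abs_def] by (rule test_function_bump[OF \<open>b > 0\<close>])
    have q1: "?q x \<le> 1" for x using \<open>b > 0\<close> by (simp add: paraboloid_def)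
    have off: "?q x \<le> 0" if "x \<notin> ball 0 r" for x
      using paraboloid_ball[OF \<open>r > 0\<close>, of 1 0 x] that by (auto simp: b_def)
    have bx: "b * (norm x)\<^sup>2 \<le> 1" if "x \<in> ball 0 r" for x :: 'a
      using paraboloid_ball[OF \<open>r > 0\<close>, of 1 0 x] that by (auto simp: b_def paraboloid_def)
    have lap: "(laplacian \<phi> x)\<^sup>2 \<le> (C1 * b)\<^sup>2 * indicator (ball 0 r) x" for x
    proof (cases "x \<in> ball 0 r")
      case True
      have eq: "laplacian \<phi> x = 4 * b * ((b * (norm x)\<^sup>2) * bump_seq (Suc (Suc (Suc 0))) (?q x))
          - 2 * b * ?N * bump_seq (Suc (Suc 0)) (?q x)"
        unfolding \<phi>_def[abs_def] laplacian_profile[of bump_seq, OF bump_seq_has_derivative]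
        by (simp add: power2_eq_square)
      have "\<bar>(b * (norm x)\<^sup>2) * bump_seq (Suc (Suc (Suc 0))) (?q x)\<bar> \<le> 1 * M2"
        unfolding abs_mult[of "b * (norm x)\<^sup>2"] using bx[OF True] \<open>b > 0\<close> by (intro mult_mono M2(2) q1) auto
      then have "\<bar>4 * b * ((b * (norm x)\<^sup>2) * bump_seq (Suc (Suc (Suc 0))) (?q x))\<bar> \<le> 4 * b * M2"
        using \<open>b > 0\<close> unfolding abs_mult[of "4 * b"] by simp
      moreover have "\<bar>2 * b * ?N * bump_seq (Suc (Suc 0)) (?q x)\<bar> \<le> 2 * b * ?N * M1"
        using \<open>b > 0\<close> M1(2)[OF q1[of x]] unfolding abs_mult[of "2 * b * ?N"] by simp
      ultimately have "\<bar>laplacian \<phi> x\<bar> \<le> 4 * b * M2 + 2 * b * ?N * M1"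
        unfolding eq by linarith
      also have "\<dots> = C1 * b" by (simp add: C1_def algebra_simps)
      finally have "\<bar>laplacian \<phi> x\<bar>\<^sup>2 \<le> (C1 * b)\<^sup>2" by (intro power_mono) auto
      then show ?thesis using True by simp
    next
      case False
      then show ?thesis
        unfolding \<phi>_def[abs_def] laplacian_profile[of bump_seq, OF bump_seq_has_derivative]
        using off[OF False] by (simp add: bump_seq_nonpos)
    qed
    have grad_eq: "partial i \<phi> x = bump_seq (Suc (Suc 0)) (?q x) * (- 2 * b * (x \<bullet> i))" for i x
      unfolding \<phi>_def[abs_def]
      by (subst partial_compose_real[where h' = "bump_seq (Suc (Suc 0))"])
        (auto simp: partial_paraboloid intro: bump_seq_has_derivative smooth_differentiable smooth_paraboloid)
    have grad: "(\<Sum>i\<in>Basis. (partial i \<phi> x)\<^sup>2) \<le> 4 * M1\<^sup>2 * b * indicator (ball 0 r) x" for x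
    proof (cases "x \<in> ball 0 r")
      case True
      have "(\<Sum>i\<in>Basis. (partial i \<phi> x)\<^sup>2) = (bump_seq (Suc (Suc 0)) (?q x))\<^sup>2 * (4 * b * (b * (\<Sum>i\<in>Basis. (x \<bullet> i)\<^sup>2)))"
        unfolding grad_eq sum_distrib_left
        by (intro sum.cong refl) (simp add: power2_eq_square algebra_simps)
      also have "(\<Sum>i\<in>Basis. (x \<bullet> i)\<^sup>2) = (norm x)\<^sup>2"
        unfolding power2_norm_eq_inner[of x] using euclidean_inner[of x x] by (simp add: power2_eq_square)
      also have "(bump_seq (Suc (Suc 0)) (?q x))\<^sup>2 * (4 * b * (b * (norm x)\<^sup>2)) \<le> M1\<^sup>2 * (4 * b * 1)"
        using bx[OF True] \<open>b > 0\<close> power_mono[OF M1(2)[OF q1[of x]], of 2] by (intro mult_mono) auto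
      finally show ?thesis using True by (simp add: mult_ac)
    qed (simp add: grad_eq off bump_seq_nonpos)
    define v where "v = V * r ^ ?N"
    have "integrable lebesgue (indicator (ball (0::'a) s) :: _ \<Rightarrow> real)" for s
      using lmeasurable_ball[of "0::'a" s] by (intro integrable_real_indicator) (auto simp: fmeasurable_def)
    then have ballint: "integrable lebesgue (\<lambda>x. c * indicator (ball (0::'a) s) x)"
      "s > 0 \<Longrightarrow> (\<integral>x. c * indicator (ball (0::'a) s) x \<partial>lebesgue) = c * (V * s ^ ?N)" for c s :: real
      by (auto simp: content_ball V_def)
    have sq: "integrable lebesgue (\<lambda>x. (\<psi> x)\<^sup>2)" if "test_function \<psi>" for \<psi> :: "'a \<Rightarrow> real"
      by (rule L2_integrable_square[OF L2_test_function[OF that]])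
    have "(\<integral>x. (laplacian \<phi> x)\<^sup>2 \<partial>lebesgue) \<le> (\<integral>x. (C1 * b)\<^sup>2 * indicator (ball (0::'a) r) x \<partial>lebesgue)"
      by (rule integral_mono[OF sq[OF test_function_laplacian[OF \<phi>]] ballint(1) lap])
    also have "\<dots> = (C1 * b)\<^sup>2 * v"
      using ballint(2)[OF \<open>r > 0\<close>] by (simp add: v_def)
    also have "\<dots> \<le> C1\<^sup>2 * b * v"
    proof (rule mult_right_mono)
      have "b * b \<le> b" using \<open>b > 0\<close> \<open>b \<le> 1\<close> by (simp add: mult_left_le)
      then have "C1\<^sup>2 * (b * b) \<le> C1\<^sup>2 * b" by (intro mult_left_mono) auto
      then show "(C1 * b)\<^sup>2 \<le> C1\<^sup>2 * b" by (simp add: power2_eq_square mult_ac)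
    qed (use \<open>V > 0\<close> \<open>r > 0\<close> in \<open>simp add: v_def\<close>)
    finally have L: "(\<integral>x. (laplacian \<phi> x)\<^sup>2 \<partial>lebesgue) \<le> C1\<^sup>2 * b * v" .
    have "(\<Sum>i\<in>Basis. \<integral>x. (partial i \<phi> x)\<^sup>2 \<partial>lebesgue) = (\<integral>x. (\<Sum>i\<in>Basis. (partial i \<phi> x)\<^sup>2) \<partial>lebesgue)"
      by (rule Bochner_Integration.integral_sum[symmetric]) (intro sq test_function_partial \<phi>)
    also have "\<dots> \<le> (\<integral>x. 4 * M1\<^sup>2 * b * indicator (ball (0::'a) r) x \<partial>lebesgue)"
      by (rule integral_mono[OF _ ballint(1) grad])
        (intro Bochner_Integration.integrable_sum sq test_function_partial \<phi>)
    also have "\<dots> = 4 * M1\<^sup>2 * b * v"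
      using ballint(2)[OF \<open>r > 0\<close>] by (simp add: v_def)
    finally have G: "(\<Sum>i\<in>Basis. \<integral>x. (partial i \<phi> x)\<^sup>2 \<partial>lebesgue) \<le> 4 * M1\<^sup>2 * b * v" .
    have "k\<^sup>2 * (V * (r / 2) ^ ?N) = (\<integral>x. k\<^sup>2 * indicator (ball (0::'a) (r / 2)) x \<partial>lebesgue)"
      using \<open>r > 0\<close> by (subst ballint(2)) auto
    also have "\<dots> \<le> (\<integral>x. (\<phi> x)\<^sup>2 \<partial>lebesgue)"
    proof (rule integral_mono[OF ballint(1) sq[OF \<phi>]])
      show "k\<^sup>2 * indicator (ball 0 (r / 2)) x \<le> (\<phi> x)\<^sup>2" for x
      proof (cases "x \<in> ball 0 (r / 2)")
        case True
        then have "(norm x)\<^sup>2 \<le> (r / 2)\<^sup>2" by (intro power_mono) auto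
        then have "?q x \<ge> 3 / 4"
          using \<open>r > 0\<close> by (simp add: paraboloid_def b_def field_simps)
        then have "k \<le> \<phi> x" unfolding k_def \<phi>_def by (rule bump_seq_1_mono)
        then show ?thesis using True \<open>k > 0\<close> by (simp add: power_mono)
      qed simp
    qed
    finally have lower: "k\<^sup>2 * v / 2 ^ ?N \<le> (\<integral>x. (\<phi> x)\<^sup>2 \<partial>lebesgue)"
      by (simp add: v_def power_divide)
    have "v > 0" using \<open>V > 0\<close> \<open>r > 0\<close> by (simp add: v_def)
    have "\<beta> * (\<Sum>i\<in>Basis. \<integral>x. (partial i \<phi> x)\<^sup>2 \<partial>lebesgue) \<le> \<bar>\<beta>\<bar> * (4 * M1\<^sup>2 * b * v)"
      using G by (intro mult_mono) (auto intro!: sum_nonneg)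
    with L have "(\<integral>x. (laplacian \<phi> x)\<^sup>2 \<partial>lebesgue) + \<beta> * (\<Sum>i\<in>Basis. \<integral>x. (partial i \<phi> x)\<^sup>2 \<partial>lebesgue)
        \<le> (C1\<^sup>2 + \<bar>\<beta>\<bar> * (4 * M1\<^sup>2)) * b * v"
      by (simp add: algebra_simps)
    also have "\<dots> = K * b * (k\<^sup>2 * v / 2 ^ ?N)"
      using \<open>k > 0\<close> by (simp add: K_def)
    also have "\<dots> \<le> K * (1 / r) * (\<integral>x. (\<phi> x)\<^sup>2 \<partial>lebesgue)"
      using \<open>K > 0\<close> \<open>r > 0\<close> \<open>b \<le> 1 / r\<close> \<open>b > 0\<close> \<open>v > 0\<close> lower by (intro mult_mono) auto
    finally have "(\<integral>x. (laplacian \<phi> x)\<^sup>2 \<partial>lebesgue) + \<beta> * (\<Sum>i\<in>Basis. \<integral>x. (partial i \<phi> x)\<^sup>2 \<partial>lebesgue)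
      \<le> K / r * (\<integral>x. (\<phi> x)\<^sup>2 \<partial>lebesgue)" by simp
    moreover have "(\<integral>x. (\<phi> x)\<^sup>2 \<partial>lebesgue) > 0"
      using lower \<open>v > 0\<close> \<open>k > 0\<close> by (smt (verit) divide_pos_pos mult_pos_pos zero_less_power)
    ultimately show "\<exists>\<phi> :: 'a \<Rightarrow> real. test_function \<phi> \<and>
      (\<integral>x. (\<phi> x)\<^sup>2 \<partial>lebesgue) > 0 \<and>
      (\<integral>x. (laplacian \<phi> x)\<^sup>2 \<partial>lebesgue) + \<beta> * (\<Sum>i\<in>Basis. \<integral>x. (partial i \<phi> x)\<^sup>2 \<partial>lebesgue)
        \<le> K / r * (\<integral>x. (\<phi> x)\<^sup>2 \<partial>lebesgue)"
      using \<phi> by blast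
  qed
qed

text \<open>Normalized spread bumps have arbitrarily small quadratic part, and the nonlinear term
  can only lower the energy.\<close>

lemma min_energy_nonpos:
  assumes "\<mu> > 0" "\<sigma> > 0"
  shows "min_energy TYPE('a::euclidean_space) \<sigma> \<beta> \<mu> \<le> 0"
proof (rule ereal_le_epsilon2)
  fix e :: real assume "e > 0"
  obtain K where K: "K > 0" "\<And>r. r \<ge> 1 \<Longrightarrow> \<exists>\<phi> :: 'a \<Rightarrow> real. test_function \<phi> \<and>
      (\<integral>x. (\<phi> x)\<^sup>2 \<partial>lebesgue) > 0 \<and>
      (\<integral>x. (laplacian \<phi> x)\<^sup>2 \<partial>lebesgue) + \<beta> * (\<Sum>i\<in>Basis. \<integral>x. (partial i \<phi> x)\<^sup>2 \<partial>lebesgue)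
      \<le> K / r * (\<integral>x. (\<phi> x)\<^sup>2 \<partial>lebesgue)"
    using spread_bump_bounds[where 'a = 'a, of \<beta>] by blast
  \<comment> \<open>Makes the quadratic form of the normalized bump at most \<open>2 * e\<close>;
    the energy contains half of it.\<close>
  define r where "r = max 1 (\<mu> * K / (2 * e))"
  have "r \<ge> 1" "\<mu> * K / (2 * e) \<le> r" by (auto simp: r_def)
  then have re: "\<mu> * (K / r) \<le> 2 * e" using \<open>e > 0\<close> by (simp add: field_simps)
  obtain \<phi> :: "'a \<Rightarrow> real" where \<phi>: "test_function \<phi>" "(\<integral>x. (\<phi> x)\<^sup>2 \<partial>lebesgue) > 0"
      "(\<integral>x. (laplacian \<phi> x)\<^sup>2 \<partial>lebesgue) + \<beta> * (\<Sum>i\<in>Basis. \<integral>x. (partial i \<phi> x)\<^sup>2 \<partial>lebesgue)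
      \<le> K / r * (\<integral>x. (\<phi> x)\<^sup>2 \<partial>lebesgue)"
    using K(2)[OF \<open>r \<ge> 1\<close>] by blast
  define S where "S = (\<integral>x. (\<phi> x)\<^sup>2 \<partial>lebesgue)"
  define w where "w x = sqrt (\<mu> / S) * \<phi> x" for x
  have "w \<in> mass_constraint \<mu>"
    using mass_constraint_normalize[OF sobolev_H_zero \<phi>(1) \<open>\<mu> > 0\<close>, of 1] \<phi>(2)
    by (simp add: w_def[abs_def] S_def)
  then have "min_energy TYPE('a) \<sigma> \<beta> \<mu> \<le> ereal (energy \<sigma> \<beta> w)"
    by (rule min_energy_le)
  moreover have "energy \<sigma> \<beta> w \<le> e"
  proof -
    \<comment> \<open>The bump is treated as a perturbation of the zero function, whose chosen weak
      derivatives are known to vanish only almost everywhere.\<close>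
    have "AE x::'a in lebesgue. wderiv is (\<lambda>x. 0) x = 0" for "is"
      by (intro wderiv_AE_eq) (auto simp: weak_derivative_def locally_integrable_const)
    note AE_finite_allI[OF finite_Basis this]
    from this[of "\<lambda>i. [i]"] this[of "\<lambda>i. [i, i]"]
    have z: "AE x::'a in lebesgue. norm (weak_gradient (\<lambda>x. 0) x) = 0"
      "AE x::'a in lebesgue. weak_laplacian (\<lambda>x. 0) x = 0"
      by (eventually_elim, simp add: weak_gradient_def weak_laplacian_def)+
    have "bending \<beta> (\<lambda>x::'a. 0) = 0"
      unfolding bending_def using z by (subst (1 2) integral_eq_zero_AE) auto
    moreover have "(\<integral>x. weak_laplacian (\<lambda>x. 0) x * \<psi> x \<partial>lebesgue) = 0" for \<psi> :: "'a \<Rightarrow> real"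
      using z by (intro integral_eq_zero_AE) auto
    ultimately have "bending \<beta> w = \<mu> / S * ((\<integral>x. (laplacian \<phi> x)\<^sup>2 \<partial>lebesgue)
        + \<beta> * (\<Sum>i\<in>Basis. \<integral>x. (partial i \<phi> x)\<^sup>2 \<partial>lebesgue))"
      using bending_add_test[OF sobolev_H_zero \<phi>(1), of \<beta> "sqrt (\<mu> / S)" 1] \<phi>(2) \<open>\<mu> > 0\<close>
      by (simp add: w_def[abs_def] S_def)
    also have "\<dots> \<le> \<mu> / S * (K / r * S)"
      using \<phi>(2,3) \<open>\<mu> > 0\<close> unfolding S_def by (intro mult_left_mono) auto
    also have "\<dots> = \<mu> * (K / r)" using \<phi>(2) by (simp add: S_def)
    finally have "bending \<beta> w / 2 \<le> e" using re by simp
    moreover have "(\<integral>x. \<bar>max (w x) 0\<bar> powr (2 * \<sigma> + 2) \<partial>lebesgue) / (2 * \<sigma> + 2) \<ge> 0"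
      using \<open>\<sigma> > 0\<close> by (intro divide_nonneg_nonneg Bochner_Integration.integral_nonneg) auto
    ultimately show ?thesis unfolding energy_bending by linarith
  qed
  ultimately show "min_energy TYPE('a) \<sigma> \<beta> \<mu> \<le> 0 + ereal e"
    using order_trans by fastforce
qed

section \<open>The Euler-Lagrange equation\<close>

text \<open>The tangent inequality of a convex function, obtained from Young's inequality with
  conjugate exponents \<open>p\<close> and \<open>p / (p - 1)\<close>. For nonpositive
  \<open>x\<close> value and slope both vanish.\<close>

lemma pos_part_powr_tangent:
  fixes x y p :: real
  assumes "p > 1"
  shows "\<bar>max x 0\<bar> powr p + p * (max x 0 powr (p - 1)) * (y - x) \<le> \<bar>max y 0\<bar> powr p"
proof (cases "x > 0")
  case True
  define q where "q = p / (p - 1)"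
  have q: "q > 1" "1 / p + 1 / q = 1" using assms by (simp_all add: q_def field_simps)
  have xp: "x powr (p - 1) * x = x powr p"
    using True by (simp add: powr_diff)
  have "max y 0 * x powr (p - 1) \<le> max y 0 powr p / p + (x powr (p - 1)) powr q / q"
    by (rule Youngs_inequality) (use assms q in auto)
  also have "(x powr (p - 1)) powr q = x powr p"
    using assms by (simp add: powr_powr q_def)
  finally have "p * (max y 0 * x powr (p - 1)) \<le> p * (max y 0 powr p / p + x powr p / q)"
    using assms by (intro mult_left_mono) auto
  also have "\<dots> = max y 0 powr p + (p - 1) * x powr p"
    using assms by (simp add: q_def field_simps)
  finally have "p * x powr (p - 1) * max y 0 \<le> max y 0 powr p + (p - 1) * x powr p"
    by (simp add: mult_ac)
  moreover have "p * x powr (p - 1) * y \<le> p * x powr (p - 1) * max y 0"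
    using assms by (intro mult_left_mono) auto
  moreover have "p * (x powr (p - 1)) * (y - x) = p * x powr (p - 1) * y - p * x powr p"
    unfolding right_diff_distrib mult.assoc xp ..
  moreover have "(p - 1) * x powr p = p * x powr p - x powr p" by (simp add: left_diff_distrib)
  moreover have "max x 0 = x" "\<bar>x\<bar> = x" "\<bar>max y 0\<bar> = max y 0" using True by auto
  ultimately show ?thesis by simp
qed simp

lemma pos_part_powr_add_le:
  fixes x y p :: real
  assumes "p > 0"
  shows "\<bar>max (x + y) 0\<bar> powr p \<le> 2 powr p * (\<bar>max x 0\<bar> powr p + \<bar>y\<bar> powr p)"
proof -
  have "\<bar>max (x + y) 0\<bar> powr p \<le> (2 * max (max x 0) \<bar>y\<bar>) powr p"
    using assms by (intro powr_mono2) auto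
  also have "\<dots> = 2 powr p * (max (max x 0) \<bar>y\<bar>) powr p"
    by (intro powr_mult)
  also have "max (max x 0) \<bar>y\<bar> powr p \<le> \<bar>max x 0\<bar> powr p + \<bar>y\<bar> powr p"
    by (cases "max x 0 \<le> \<bar>y\<bar>") (auto simp: max_absorb1 max_absorb2)
  finally show ?thesis by simp
qed

text \<open>When the integrand is not integrable the value is 0, so the quantity is nonnegative in
  every case.\<close>

definition pos_mass :: "real \<Rightarrow> ('a::euclidean_space \<Rightarrow> real) \<Rightarrow> real" where
  "pos_mass p u = (\<integral>x. \<bar>max (u x) 0\<bar> powr p \<partial>lebesgue)"

lemma pos_mass_nonneg: "pos_mass p u \<ge> 0"
  unfolding pos_mass_def by (rule Bochner_Integration.integral_nonneg) simp

lemma pos_mass_scale: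
  assumes "c > 0" shows "pos_mass p (\<lambda>x. c * u x) = c powr p * pos_mass p u"
proof -
  have "max (c * u x) 0 = c * max (u x) 0" for x
    using assms by (simp add: max_def zero_le_mult_iff mult_le_0_iff)
  then show ?thesis
    using assms by (simp add: pos_mass_def abs_mult powr_mult)
qed

text \<open>The pointwise tangent inequality is integrated; it is valid for \<open>t\<close> of
  either sign. The perturbed integrand is integrable by \<open>pos_part_powr_add_le\<close>.\<close>

lemma pos_mass_tangent:
  fixes u :: "'a::euclidean_space \<Rightarrow> real"
  assumes u: "u \<in> borel_measurable lebesgue" and p: "p > 1" and \<phi>: "test_function \<phi>"
    and int: "integrable lebesgue (\<lambda>x. \<bar>max (u x) 0\<bar> powr p)"
  shows "integrable lebesgue (\<lambda>x. max (u x) 0 powr (p - 1) * \<phi> x)"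
    and "pos_mass p u + t * (p * (\<integral>x. max (u x) 0 powr (p - 1) * \<phi> x \<partial>lebesgue))
      \<le> pos_mass p (\<lambda>x. u x + t * \<phi> x)"
proof -
  let ?f = "\<lambda>x. max (u x) 0 powr (p - 1)"
  have fm: "?f \<in> borel_measurable lebesgue"
    using u by measurable
  have "locally_integrable ?f"
    unfolding locally_integrable_def set_integrable_def
  proof (intro allI impI)
    fix K :: "'a set" assume K: "compact K"
    show "integrable lebesgue (\<lambda>x. indicator K x *\<^sub>R ?f x)"
    proof (rule Bochner_Integration.integrable_bound)
      show "integrable lebesgue (\<lambda>x. indicator K x *\<^sub>R 1 + \<bar>max (u x) 0\<bar> powr p)"
        using locally_integrable_const[of 1] K int
        unfolding locally_integrable_def set_integrable_def
        by (intro Bochner_Integration.integrable_add) auto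
      show "(\<lambda>x. indicator K x *\<^sub>R ?f x) \<in> borel_measurable lebesgue"
        using K fm by (intro borel_measurable_scaleR borel_measurable_indicator) (auto intro: fmeasurableD lmeasurable_compact)
      \<comment> \<open>This makes the weight \<open>(u^+)^(p-1)\<close> locally integrable from
        integrability of the \<open>p\<close>-th power alone.\<close>
      have "s powr (p - 1) \<le> 1 + s powr p" if "s \<ge> 0" for s :: real
      proof (cases "s \<le> 1")
        case True
        then have "s powr (p - 1) \<le> 1 powr (p - 1)" using that p by (intro powr_mono2) auto
        then show ?thesis by (simp add: add_increasing2)
      next
        case False
        then have "s powr (p - 1) \<le> s powr p" by (intro powr_mono) auto
        then show ?thesis by simp
      qed
      from this[of "max (u _) 0"]
      show "AE x in lebesgue. norm (indicator K x *\<^sub>R ?f x) \<le> norm (indicator K x *\<^sub>R 1 + \<bar>max (u x) 0\<bar> powr p)"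
        by (auto simp: indicator_def)
    qed
  qed
  then show f\<phi>: "integrable lebesgue (\<lambda>x. ?f x * \<phi> x)"
    using \<phi> by (rule integrable_mult_test)
  obtain M where M: "\<And>x. \<bar>\<phi> x\<bar> \<le> M" using test_function_bounded[OF \<phi>] by blast
  obtain R where "R > 0" and R: "\<And>x. norm x > R \<Longrightarrow> \<phi> x = 0"
    using test_function_support[OF \<phi>] by metis
  have "integrable lebesgue (\<lambda>x. 1 * \<bar>t * \<phi> x\<bar> powr p)"
  proof (rule integrable_mult_cball[OF locally_integrable_const])
    show "(\<lambda>x. \<bar>t * \<phi> x\<bar> powr p) \<in> borel_measurable lebesgue"
      using test_function_measurable[OF \<phi>] by measurable
    show "\<bar>\<bar>t * \<phi> x\<bar> powr p\<bar> \<le> (\<bar>t\<bar> * M) powr p" for x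
      using M[of x] p by (auto simp: abs_mult intro!: powr_mono2 mult_left_mono)
    show "\<bar>t * \<phi> x\<bar> powr p = 0" if "norm x > R" for x
      using R[OF that] by simp
  qed
  then have bound: "integrable lebesgue (\<lambda>x. 2 powr p * (\<bar>max (u x) 0\<bar> powr p + \<bar>t * \<phi> x\<bar> powr p))"
    using int by simp
  have int': "integrable lebesgue (\<lambda>x. \<bar>max (u x + t * \<phi> x) 0\<bar> powr p)"
  proof (rule Bochner_Integration.integrable_bound[OF bound])
    show "(\<lambda>x. \<bar>max (u x + t * \<phi> x) 0\<bar> powr p) \<in> borel_measurable lebesgue"
      using test_function_measurable[OF \<phi>] u by measurable
    show "AE x in lebesgue. norm (\<bar>max (u x + t * \<phi> x) 0\<bar> powr p)
        \<le> norm (2 powr p * (\<bar>max (u x) 0\<bar> powr p + \<bar>t * \<phi> x\<bar> powr p))"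
    proof (rule AE_I2)
      fix x
      have "0 \<le> 2 powr p * (\<bar>max (u x) 0\<bar> powr p + \<bar>t * \<phi> x\<bar> powr p)" by simp
      then show "norm (\<bar>max (u x + t * \<phi> x) 0\<bar> powr p)
          \<le> norm (2 powr p * (\<bar>max (u x) 0\<bar> powr p + \<bar>t * \<phi> x\<bar> powr p))"
        using pos_part_powr_add_le[of p "u x" "t * \<phi> x"] p
        by (simp only: real_norm_def abs_of_nonneg powr_ge_zero)
    qed
  qed
  have "pos_mass p u + t * (p * (\<integral>x. ?f x * \<phi> x \<partial>lebesgue))
      = (\<integral>x. \<bar>max (u x) 0\<bar> powr p + t * (p * (?f x * \<phi> x)) \<partial>lebesgue)"
    unfolding pos_mass_def using int f\<phi> by simp
  also have "\<dots> \<le> pos_mass p (\<lambda>x. u x + t * \<phi> x)"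
    unfolding pos_mass_def
  proof (rule integral_mono[OF _ int'])
    show "integrable lebesgue (\<lambda>x. \<bar>max (u x) 0\<bar> powr p + t * (p * (?f x * \<phi> x)))"
      using int f\<phi> by simp
    show "\<bar>max (u x) 0\<bar> powr p + t * (p * (?f x * \<phi> x)) \<le> \<bar>max (u x + t * \<phi> x) 0\<bar> powr p" for x
      using pos_part_powr_tangent[OF p, of "u x" "u x + t * \<phi> x"] by (simp add: mult_ac)
  qed
  finally show "pos_mass p u + t * (p * (\<integral>x. ?f x * \<phi> x \<partial>lebesgue)) \<le> pos_mass p (\<lambda>x. u x + t * \<phi> x)" .
qed

lemma energy_pos_mass: "energy \<sigma> \<beta> u = bending \<beta> u / 2 - pos_mass (2 * \<sigma> + 2) u / (2 * \<sigma> + 2)"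
  unfolding energy_bending pos_mass_def ..

text \<open>Convexity of \<open>s \<mapsto> (s\<^sup>+)\<^sup>p\<close> bounds the energy of the normalized competitor \<open>u + t \<phi>\<close> by an
  explicit differentiable function \<open>H\<close> with equality at \<open>t = 0\<close>, so \<open>H' 0 = 0\<close> without
  differentiating the nonlinear term under the integral.\<close>

lemma euler_lagrange:
  fixes u :: "'a::euclidean_space \<Rightarrow> real"
  assumes "\<sigma> > 0" "\<mu> > 0" and u: "u \<in> mass_constraint \<mu>"
    and min: "ereal (energy \<sigma> \<beta> u) = min_energy TYPE('a) \<sigma> \<beta> \<mu>"
    and int: "integrable lebesgue (\<lambda>x. \<bar>max (u x) 0\<bar> powr (2 * \<sigma> + 2))"
    and \<alpha>: "- \<alpha> * \<mu> = bending \<beta> u - pos_mass (2 * \<sigma> + 2) u"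
    and \<phi>: "test_function \<phi>"
  shows "(\<integral>x. weak_laplacian u x * laplacian \<phi> x \<partial>lebesgue)
      - \<beta> * (\<integral>x. weak_laplacian u x * \<phi> x \<partial>lebesgue) + \<alpha> * (\<integral>x. u x * \<phi> x \<partial>lebesgue)
    = (\<integral>x. max (u x) 0 powr (2 * \<sigma> + 1) * \<phi> x \<partial>lebesgue)"
proof -
  define p where "p = 2 * \<sigma> + 2"
  have p: "p > 2" "2 * \<sigma> + 1 = p - 1" using \<open>\<sigma> > 0\<close> by (auto simp: p_def)
  have uH: "u \<in> sobolev_H 2" and mass: "(\<integral>x. (u x)\<^sup>2 \<partial>lebesgue) = \<mu>"
    using u by (auto simp: mass_constraint_def)
  note uL = sobolev_H_L2[OF uH]
  define G where "G = pos_mass p u"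
  define U where "U = (\<integral>x. u x * \<phi> x \<partial>lebesgue)"
  define F where "F = (\<integral>x. max (u x) 0 powr (p - 1) * \<phi> x \<partial>lebesgue)"
  define D where "D = bending \<beta> u"
  define B where "B = (\<integral>x. weak_laplacian u x * laplacian \<phi> x \<partial>lebesgue)
      - \<beta> * (\<integral>x. weak_laplacian u x * \<phi> x \<partial>lebesgue)"
  define Q where "Q = (\<integral>x. (laplacian \<phi> x)\<^sup>2 \<partial>lebesgue)
        + \<beta> * (\<Sum>i\<in>Basis. \<integral>x. (partial i \<phi> x)\<^sup>2 \<partial>lebesgue)"
  define P where "P = (\<integral>x. (\<phi> x)\<^sup>2 \<partial>lebesgue)"
  \<comment> \<open>The mass of \<open>u + t \<phi>\<close>; it is positive at least for small
    \<open>t\<close>, which a local minimum at 0 requires.\<close>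
  define m where "m t = \<mu> + 2 * t * U + t\<^sup>2 * P" for t
  have m: "(\<integral>x. (u x + t * \<phi> x)\<^sup>2 \<partial>lebesgue) = m t" for t
  proof -
    have "(\<integral>x. (u x + t * \<phi> x)\<^sup>2 \<partial>lebesgue) = (\<integral>x. (u x)\<^sup>2 + 2 * t * (u x * \<phi> x) + t\<^sup>2 * (\<phi> x)\<^sup>2 \<partial>lebesgue)"
      by (intro Bochner_Integration.integral_cong refl) (simp add: power2_eq_square algebra_simps)
    also have "\<dots> = m t"
      using L2_integrable_square[OF uL] L2_integrable_square[OF L2_test_function[OF \<phi>]]
        L2_mult_integrable[OF uL L2_test_function[OF \<phi>]] mass
      by (simp add: m_def U_def P_def)
    finally show ?thesis .
  qed
  \<comment> \<open>Normalization multiplies by \<open>c = sqrt (\<mu> / m t)\<close>: the quadratic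
    part scales with \<open>c^2\<close>, the nonlinear one with \<open>c^p\<close>, and the latter
    is replaced by its tangent in \<open>t\<close>.\<close>
  define H where "H t = (\<mu> / m t) * (D + 2 * t * B + t\<^sup>2 * Q) / 2 - (\<mu> / m t) powr (p / 2) * (G + t * (p * F)) / p" for t
  have le: "H 0 \<le> H t" if "m t > 0" for t
  proof -
    define c where "c = sqrt (\<mu> / m t)"
    have c: "c > 0" "c\<^sup>2 = \<mu> / m t" using that \<open>\<mu> > 0\<close> by (auto simp: c_def)
    have cp: "c powr p = (\<mu> / m t) powr (p / 2)"
      using that \<open>\<mu> > 0\<close> by (simp add: c_def powr_half_sqrt[symmetric] powr_powr)
    have "(\<lambda>x. c * (u x + t * \<phi> x)) \<in> mass_constraint \<mu>"
      using mass_constraint_normalize[OF uH \<phi> \<open>\<mu> > 0\<close>, of t] that by (simp add: m c_def)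
    from min_energy_le[OF this, of \<sigma> \<beta>]
    have "energy \<sigma> \<beta> u \<le> energy \<sigma> \<beta> (\<lambda>x. c * (u x + t * \<phi> x))"
      unfolding min[symmetric] by simp
    also have "\<dots> = (\<mu> / m t) * (D + 2 * t * B + t\<^sup>2 * Q) / 2 - (\<mu> / m t) powr (p / 2) * pos_mass p (\<lambda>x. u x + t * \<phi> x) / p"
      unfolding energy_pos_mass bending_add_test[OF uH \<phi>] p_def[symmetric] pos_mass_scale[OF c(1)] cp c(2)
      by (simp add: D_def B_def Q_def)
    also have "\<dots> \<le> H t"
      unfolding H_def
    proof (intro diff_left_mono divide_right_mono mult_left_mono)
      show "G + t * (p * F) \<le> pos_mass p (\<lambda>x. u x + t * \<phi> x)"
        unfolding G_def F_def using p int uL \<phi>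
        by (intro pos_mass_tangent L2_measurable) (auto simp: p_def)
    qed (use p in auto)
    finally show ?thesis
      using \<open>\<mu> > 0\<close> by (simp add: H_def m_def energy_pos_mass D_def G_def p_def)
  qed
  have m0: "m 0 = \<mu>" by (simp add: m_def)
  have r: "((\<lambda>t. \<mu> / m t) has_real_derivative - 2 * U / \<mu>) (at 0)"
    unfolding m_def using \<open>\<mu> > 0\<close>
    by (auto intro!: derivative_eq_intros simp: power2_eq_square)
  have "((\<lambda>t. (\<mu> / m t) powr (p / 2)) has_real_derivative
      p / 2 * (\<mu> / m 0) powr (p / 2 - 1) * (- 2 * U / \<mu>)) (at 0)"
    using \<open>\<mu> > 0\<close> by (intro DERIV_chain2[OF has_real_derivative_powr r]) (simp add: m0)
  moreover have "((\<lambda>t. D + 2 * t * B + t\<^sup>2 * Q) has_real_derivative 2 * B) (at 0)"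
    "((\<lambda>t. G + t * (p * F)) has_real_derivative p * F) (at 0)"
    by (auto intro!: derivative_eq_intros)
  \<comment> \<open>Since \<open>m 0 = \<mu>\<close> and \<open>m' 0 = 2 U\<close>, the
    normalization contributes the terms with \<open>U\<close>; the exponent \<open>p / 2\<close>
    cancels against the division by \<open>p\<close>.\<close>
  ultimately have "(H has_real_derivative (- 2 * U / \<mu>) * D / 2 + B - (- U / \<mu> * G + F)) (at 0)"
    unfolding H_def
    by (intro DERIV_cong[OF DERIV_diff[OF DERIV_cdivide[OF DERIV_mult[OF r]]
          DERIV_cdivide[OF DERIV_mult]]])
      (use \<open>\<mu> > 0\<close> p in \<open>auto simp: m0 field_simps\<close>)
  moreover have "\<exists>d>0. \<forall>t. \<bar>0 - t\<bar> < d \<longrightarrow> H 0 \<le> H t"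
  proof -
    have "isCont m 0" unfolding m_def by (intro continuous_intros)
    moreover have "m 0 > 0" using \<open>\<mu> > 0\<close> by (simp add: m_def)
    ultimately have "\<forall>\<^sub>F t in at 0. m t > 0"
      unfolding isCont_def by (rule order_tendstoD)
    then obtain d where "d > 0" "\<And>t. t \<noteq> 0 \<Longrightarrow> \<bar>t\<bar> < d \<Longrightarrow> m t > 0"
      unfolding eventually_at by (auto simp: dist_real_def)
    then show ?thesis using le by (metis abs_minus_cancel diff_0 order_refl)
  qed
  ultimately have "(- 2 * U / \<mu>) * D / 2 + B - (- U / \<mu> * G + F) = 0"
    by (metis DERIV_local_min)
  \<comment> \<open>The terms from the normalization combine to \<open>D - G\<close>, which is how
    the multiplier enters the equation.\<close>
  then have "B - F = U / \<mu> * (D - G)"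
    by (simp add: right_diff_distrib)
  also have "D - G = - \<alpha> * \<mu>" using \<alpha> by (simp add: D_def G_def p_def)
  also have "U / \<mu> * (- \<alpha> * \<mu>) = - \<alpha> * U" using \<open>\<mu> > 0\<close> by simp
  finally have "B + \<alpha> * U = F" by simp
  then show ?thesis by (simp add: B_def U_def F_def p)
qed

section \<open>Sign of the multiplier, factorization and positivity\<close>

theorem theorem3p1:
  fixes u :: "real ^ 'n \<Rightarrow> real" and \<sigma> \<beta> \<mu> \<alpha> :: real
  assumes "0 < \<sigma>" and "\<sigma> < 4 / real CARD('n)" and "0 < \<mu>"
    and "u \<in> mass_constraint \<mu>"
    and "ereal (energy \<sigma> \<beta> u) = min_energy TYPE(real ^ 'n) \<sigma> \<beta> \<mu>"
    and "- \<alpha> * \<mu> = (\<integral>x. \<bar>weak_laplacian u x\<bar>\<^sup>2 + \<beta> * (norm (weak_gradient u x))\<^sup>2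
                       - \<bar>max (u x) 0\<bar> powr (2 * \<sigma> + 2) \<partial>lebesgue)"
    and "\<beta> \<ge> 2 * sqrt \<alpha>"
  shows "strictly_positive u \<or> strictly_negative u"
proof -
  define p where "p = 2 * \<sigma> + 2"
  have p: "p > 2" using assms(1) by (simp add: p_def)
  have uH: "u \<in> sobolev_H 2" and mass: "(\<integral>x. (u x)\<^sup>2 \<partial>lebesgue) = \<mu>"
    using assms(4) by (auto simp: mass_constraint_def)
  note uL = sobolev_H_L2[OF uH] and wL = weak_laplacian_L2[OF uH]
  note lu = L2_locally_integrable[OF uL] and lw = L2_locally_integrable[OF wL]
  have nz: "\<not> (AE x in lebesgue. u x = 0)"
  proof
    assume "AE x in lebesgue. u x = 0"
    then have "(\<integral>x. (u x)\<^sup>2 \<partial>lebesgue) = 0" by (intro integral_eq_zero_AE) auto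
    then show False using mass assms(3) by simp
  qed
  let ?g = "\<lambda>x. \<bar>max (u x) 0\<bar> powr p"
  let ?A = "\<lambda>x. (weak_laplacian u x)\<^sup>2 + \<beta> * (norm (weak_gradient u x))\<^sup>2"
  have Aint: "integrable lebesgue ?A"
    using L2_integrable_square[OF wL] weak_gradient_integrable[OF uH] by simp
  have A: "(\<integral>x. ?A x \<partial>lebesgue) = bending \<beta> u"
    using L2_integrable_square[OF wL] weak_gradient_integrable[OF uH] by (simp add: bending_def)
  have "ereal (energy \<sigma> \<beta> u) \<le> 0"
    unfolding assms(5) by (rule min_energy_nonpos[OF assms(3,1)])
  then have en: "bending \<beta> u \<le> 2 / p * pos_mass p u"
    using p by (simp add: energy_pos_mass p_def field_simps)
  have gn: "0 \<le> pos_mass p u" by (rule pos_mass_nonneg)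
  have \<alpha>_int: "- \<alpha> * \<mu> = bending \<beta> u - pos_mass p u" if "integrable lebesgue ?g"
    using assms(6) that Aint A by (simp add: pos_mass_def p_def)
  \<comment> \<open>The quadratic part is integrable, so a nonintegrable nonlinear term makes the
    whole integrand of the multiplier identity nonintegrable. Both integrals then take the default
    value 0, and the case joins \<open>\<alpha> = 0\<close>.\<close>
  have \<alpha>_nonint: "\<alpha> = 0" "pos_mass p u = 0" if "\<not> integrable lebesgue ?g"
  proof -
    have "\<not> integrable lebesgue (\<lambda>x. ?A x - ?g x)"
    proof
      assume "integrable lebesgue (\<lambda>x. ?A x - ?g x)"
      from Bochner_Integration.integrable_diff[OF Aint this] that show False by simp
    qed
    then have "- \<alpha> * \<mu> = 0"
      using assms(6) by (simp add: not_integrable_integral_eq p_def)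
    then show "\<alpha> = 0" using assms(3) by simp
    show "pos_mass p u = 0"
      using that by (simp add: pos_mass_def not_integrable_integral_eq)
  qed
  \<comment> \<open>The energy being at most 0 bounds the quadratic form by \<open>2/p\<close> times
    the nonlinear integral, while \<open>\<alpha> * \<mu>\<close> is the excess of that integral
    over the form.\<close>
  have gap: "(1 - 2 / p) * pos_mass p u \<le> \<alpha> * \<mu>"
  proof (cases "integrable lebesgue ?g")
    case True
    then show ?thesis using \<alpha>_int en unfolding left_diff_distrib by linarith
  qed (use \<alpha>_nonint in simp)
  have "0 \<le> (1 - 2 / p) * pos_mass p u" using p gn by (intro mult_nonneg_nonneg) auto
  then have "\<alpha> \<ge> 0" using gap assms(3) by (smt (verit) mult_neg_pos)
  \<comment> \<open>\<open>sqrt\<close> extends to negative arguments as an odd function, so the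
    hypothesis on \<beta> gives this only once \<alpha> is known to be nonnegative.\<close>
  then have "\<beta> \<ge> 0" using assms(7) real_sqrt_ge_zero[of \<alpha>] by linarith
  \<comment> \<open>For \<open>\<alpha> = 0\<close> the gap removes the nonlinear integral, the
    quadratic form is at most 0 and the weak Laplacian vanishes. Then \<open>u\<close> and
    \<open>-u\<close> are both supersolutions with constant 0, and the maximum principle acts as a
    Liouville theorem in \<open>L2\<close>.\<close>
  have "\<alpha> \<noteq> 0"
  proof
    assume "\<alpha> = 0"
    then have "(1 - 2 / p) * pos_mass p u = 0" using gap \<open>0 \<le> (1 - 2 / p) * pos_mass p u\<close> by simp
    then have "bending \<beta> u \<le> 0" using en p by simp
    moreover have "0 \<le> \<beta> * (\<integral>x. (norm (weak_gradient u x))\<^sup>2 \<partial>lebesgue)"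
      using \<open>\<beta> \<ge> 0\<close> by (intro mult_nonneg_nonneg) auto
    moreover have "0 \<le> (\<integral>x. (weak_laplacian u x)\<^sup>2 \<partial>lebesgue)" by simp
    ultimately have "(\<integral>x. (weak_laplacian u x)\<^sup>2 \<partial>lebesgue) = 0"
      unfolding bending_def by linarith
    then have "AE x in lebesgue. (weak_laplacian u x)\<^sup>2 = 0"
      using integral_nonneg_eq_0_iff_AE[OF L2_integrable_square[OF wL]] by simp
    then have "(\<integral>x. u x * laplacian \<phi> x \<partial>lebesgue) = 0" if "test_function \<phi>" for \<phi>
      unfolding weak_laplacian_test(1)[OF uH that] by (intro integral_eq_zero_AE) auto
    then have "supersolution 0 (\<lambda>x. c * u x)" for c
      using lu by (simp add: supersolution_def locally_integrable_cmult mult.assoc)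
    then have "AE x in lebesgue. 0 \<le> c * u x" for c
      by (intro weak_maximum_principle L2_cmult uL) auto
    from this[of 1] this[of "-1"] have "AE x in lebesgue. u x = 0"
      by eventually_elim simp
    with nz show False by simp
  qed
  with \<open>\<alpha> \<ge> 0\<close> have "\<alpha> > 0" by simp
  then have int: "integrable lebesgue ?g" using \<alpha>_nonint by auto
  \<comment> \<open>The root of the discriminant of \<open>X^2 - \<beta> X + \<alpha>\<close>;
    \<open>a\<close> and \<open>b\<close> are the two roots of this polynomial.\<close>
  define s where "s = sqrt (\<beta>\<^sup>2 - 4 * \<alpha>)"
  have disc: "4 * \<alpha> \<le> \<beta>\<^sup>2"
    using power_mono[OF assms(7), of 2] \<open>\<alpha> > 0\<close> by (simp add: power_mult_distrib)
  have s2: "s\<^sup>2 = \<beta>\<^sup>2 - 4 * \<alpha>" and "s \<ge> 0" using disc by (auto simp: s_def)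
  have "s \<le> \<beta>" by (rule power2_le_imp_le) (use \<open>\<beta> \<ge> 0\<close> \<open>\<alpha> > 0\<close> s2 in auto)
  define a b where "a = (\<beta> + s) / 2" and "b = (\<beta> - s) / 2"
  have ab: "a \<ge> 0" "b \<ge> 0" "a + b = \<beta>" "a * b = \<alpha>"
    using \<open>s \<ge> 0\<close> \<open>s \<le> \<beta>\<close> \<open>\<beta> \<ge> 0\<close> s2
    by (auto simp: a_def b_def field_simps power2_eq_square)
  define v where "v x = (- 1) * weak_laplacian u x + b * u x" for x
  have vL: "v \<in> L2" unfolding v_def by (intro L2_add L2_cmult wL uL)
  have vint: "(\<integral>x. v x * \<psi> x \<partial>lebesgue) = b * (\<integral>x. u x * \<psi> x \<partial>lebesgue) - (\<integral>x. weak_laplacian u x * \<psi> x \<partial>lebesgue)"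
    if "test_function \<psi>" for \<psi>
  proof -
    have "(\<integral>x. v x * \<psi> x \<partial>lebesgue) = (\<integral>x. b * (u x * \<psi> x) - weak_laplacian u x * \<psi> x \<partial>lebesgue)"
      by (simp add: v_def algebra_simps)
    then show ?thesis
      using integrable_mult_test[OF lu that] integrable_mult_test[OF lw that] by simp
  qed
  have "supersolution a v"
    unfolding supersolution_def
  proof (intro conjI allI impI L2_locally_integrable vL)
    fix \<phi> :: "real ^ 'n \<Rightarrow> real" assume \<phi>: "test_function \<phi> \<and> (\<forall>x. 0 \<le> \<phi> x)"
    have "0 \<le> (\<integral>x. max (u x) 0 powr (2 * \<sigma> + 1) * \<phi> x \<partial>lebesgue)"
      using \<phi> by (intro Bochner_Integration.integral_nonneg) auto
    also have "\<dots> = (\<integral>x. weak_laplacian u x * laplacian \<phi> x \<partial>lebesgue)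
      - \<beta> * (\<integral>x. weak_laplacian u x * \<phi> x \<partial>lebesgue) + \<alpha> * (\<integral>x. u x * \<phi> x \<partial>lebesgue)"
      using euler_lagrange[OF assms(1,3,4,5), of \<alpha> \<phi>] int \<alpha>_int \<phi> by (simp add: p_def)
    \<comment> \<open>Both sides are expanded with \<open>\<beta> = a + b\<close> and
      \<open>\<alpha> = a * b\<close>. The identity for \<open>v\<close> is used with
      \<open>laplacian \<phi>\<close> as test function as well, and one Laplacian is moved from the
      test function onto \<open>u\<close>.\<close>
    also have "\<dots> = a * (\<integral>x. v x * \<phi> x \<partial>lebesgue) - (\<integral>x. v x * laplacian \<phi> x \<partial>lebesgue)"
      unfolding vint[OF conjunct1[OF \<phi>]] vint[OF test_function_laplacian[OF conjunct1[OF \<phi>]]]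
        weak_laplacian_test(1)[OF uH conjunct1[OF \<phi>]] ab(3,4)[symmetric]
      by (simp add: algebra_simps)
    finally show "(\<integral>x. v x * laplacian \<phi> x \<partial>lebesgue) \<le> a * (\<integral>x. v x * \<phi> x \<partial>lebesgue)" by simp
  qed
  then have v0: "AE x in lebesgue. 0 \<le> v x"
    using vL ab(1) by (intro weak_maximum_principle)
  have sub: "supersolution b u"
    unfolding supersolution_def
  proof (intro conjI allI impI lu)
    fix \<phi> :: "real ^ 'n \<Rightarrow> real" assume \<phi>: "test_function \<phi> \<and> (\<forall>x. 0 \<le> \<phi> x)"
    have "0 \<le> (\<integral>x. v x * \<phi> x \<partial>lebesgue)"
      using v0 \<phi> by (intro integral_nonneg_AE) auto
    then show "(\<integral>x. u x * laplacian \<phi> x \<partial>lebesgue) \<le> b * (\<integral>x. u x * \<phi> x \<partial>lebesgue)"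
      using \<phi> by (simp add: vint weak_laplacian_test(1)[OF uH])
  qed
  have "AE x in lebesgue. 0 \<le> u x"
    using uL sub ab(2) by (rule weak_maximum_principle)
  then have "strictly_positive u"
    using sub ab(2) nz by (rule strictly_positive_if_supersolution)
  then show ?thesis by simp
qed

end
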